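(* Let $C_0,c_0>0$ be constants. There exist constants $C_{gap},C>0$, which do not depend on $p_1,p_2,p_3,r_1,r_2,r_3,\lambda,\sigma,q$ (they may depend on $C_0,c_0$), such that the following holds. Let $\mathbf{Y}=\mathbf{X}+\mathbf{Z}\in\mathbb{R}^{p_1\times p_2\times p_3}$, where $\mathbf{X}$ is a fixed tensor of Tucker rank $(r_1,r_2,r_3)$, $r_k\ge1$, and $\mathbf{Z}$ has i.i.d. $N(0,\sigma^2)$ entries. Let $p=\min\{p_1,p_2,p_3\}$, let $U_k\in\mathbb{O}_{p_k,r_k}$ be the matrix of left singular vectors of $\mathcal{M}_k(\mathbf{X})$ associated with its nonzero singular values, and let $\lambda=\min_{k=1,2,3}\sigma_{r_k}(\mathcal{M}_k(\mathbf{X}))$. Suppose $p_k\le C_0p$, $r_k\le C_0p^{1/2}$ for $k=1,2,3$, $\|\mathbf{X}\|_{\rm F}\le C_0\sigma\exp(c_0p)$, and $\max\{r_1,r_2,r_3\}\le C_0\min\{r_1,r_2,r_3\}$. Let $\hat U_k^\bullet\in\mathbb{O}_{p_k,r_k}$, $k=1,2,3$, be estimators (functions of $\mathbf{Y}$) satisfying $$\min_{\hat{\mathbf{S}}^\bullet\in\mathbb{R}^{r_1\times r_2\times r_3}}\|\mathbf{Y}-\hat{\mathbf{S}}^\bullet\times_1\hat U_1^\bullet\times_2\hat U_2^\bullet\times_3\hat U_3^\bullet\|_{\rm F}^2\le\min_{\hat{\mathbf{S}}\in\mathbb{R}^{r_1\times r_2\times r_3}}\|\mathbf{Y}-\hat{\mathbf{S}}\times_1U_1\times_2U_2\times_3U_3\|_{\rm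 F}^2,$$ and let $\hat{\mathbf{X}}^\bullet=\hat{\mathbf{S}}^\bullet\times_1\hat U_1^\bullet\times_2\hat U_2^\bullet\times_3\hat U_3^\bullet$, where $\hat{\mathbf{S}}^\bullet$ attains the minimum on the left-hand side. If $$\lambda/\sigma\ge C_{gap}\,p^{1/2},$$ then $$\mathbb{E}\,r_k^{-1/q}\left\|\sin\Theta(\hat U_k^\bullet,U_k)\right\|_q\le\frac{C\sqrt{p_k}}{\lambda/\sigma},\qquad k=1,2,3,\quad1\le q\le2,$$ $$\mathbb{E}\|\hat{\mathbf{X}}^\bullet-\mathbf{X}\|_{\rm F}^2\le C\sigma^2(p_1r_1+p_2r_2+p_3r_3),\qquad\mathbb{E}\frac{\|\hat{\mathbf{X}}^\bullet-\mathbf{X}\|_{\rm F}^2}{\|\mathbf{X}\|_{\rm F}^2}\le C\left(\frac{p_1+p_2+p_3}{\lambda^2/\sigma^2}\wedge1\right).$$ In particular, these bounds hold for the maximum likelihood estimators $$(\hat U_1^{\rm mle},\hat U_2^{\rm mle},\hat U_3^{\rm mle})\in\mathop{\rm arg\,max}_{V_k\in\mathbb{O}_{p_k,r_k},\,k=1,2,3}\|\mathbf{Y}\times_1V_1^\top\times_2V_2^\top\times_3V_3^\top\|_{\rm F}^2,\qquad\hat{\mathbf{X}}^{\rm mle}=\mathbf{Y}\times_1P_{\hat U_1^{\rm mle}}\times_2P_{\hat U_2^{\rm mle}}\times_3P_{\hat U_3^{\rm mle}}.$$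
   Context: Notation. $a\wedge b=\min\{a,b\}$. $\mathbb{O}_{p,r}=\{U\in\mathbb{R}^{p\times r}:U^\top U=I_r\}$. $\sigma_j(A)$ is the $j$-th largest singular value of a matrix $A$. $P_U=UU^\top$ for $U\in\mathbb{O}_{p,r}$. For $U,\hat U\in\mathbb{O}_{p,r}$ with $\sigma_1\ge\dots\ge\sigma_r\ge0$ the singular values of $U^\top\hat U$, $\|\sin\Theta(U,\hat U)\|_q=\left(\sum_{i=1}^r(1-\sigma_i^2)^{q/2}\right)^{1/q}$ for $1\le q<\infty$. Tensors. For $\mathbf{X}\in\mathbb{R}^{p_1\times p_2\times p_3}$, the mode-$1$ matricization $\mathcal{M}_1(\mathbf{X})\in\mathbb{R}^{p_1\times(p_2p_3)}$ is $[\mathcal{M}_1(\mathbf{X})]_{i,(j-1)p_3+k}=X_{ijk}$; $\mathcal{M}_2(\mathbf{X})\in\mathbb{R}^{p_2\times(p_3p_1)}$ and $\mathcal{M}_3(\mathbf{X})\in\mathbb{R}^{p_3\times(p_1p_2)}$ are defined in the same fashion. The Tucker rank of $\mathbf{X}$ is $(r_1,r_2,r_3)$ with $r_k=\mathrm{rank}(\mathcal{M}_k(\mathbf{X}))$. For $A\in\mathbb{R}^{m\times p_1}$, $(\mathbf{X}\times_1A)_{ijk}=\sum_{i'}A_{ii'}X_{i'jk}$; $\times_2,\times_3$ are defined similarly. $\|\mathbf{X}\|_{\rm F}=(\sum_{i,j,k}X_{ijk}^2)^{1/2}$. *)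

theory Defs
  imports
    "HOL-Probability.Probability"
    "Jordan_Normal_Form.DL_Rank"
    "Jordan_Normal_Form.Char_Poly"
begin

section \<open>Matrices\<close>

definition mat_rank :: "real mat \<Rightarrow> nat" where
  "mat_rank A = vec_space.rank (dim_row A) A"

definition stiefel :: "nat \<Rightarrow> nat \<Rightarrow> real mat set" where
  "stiefel p r = {U \<in> carrier_mat p r. transpose_mat U * U = 1\<^sub>m r}"

text \<open>
  Decreasing list of the square roots of the eigenvalues of \<open>A\<^sup>T A\<close>, with multiplicity. It has
  \<open>dim_col A\<close> entries, so if \<open>A\<close> has more columns than rows, the usual list of length
  \<open>min (dim_row A) (dim_col A)\<close> is padded with zeros at the end.
\<close>

definition singular_values :: "real mat \<Rightarrow> real list" where
  "singular_values A =
     rev (sorted_list_of_multiset (image_mset sqrt (proots (char_poly (transpose_mat A * A)))))"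

text \<open>The \<open>j\<close>-th largest singular value, counted from \<open>j = 1\<close>.\<close>

definition sing_val :: "nat \<Rightarrow> real mat \<Rightarrow> real" where
  "sing_val j A = singular_values A ! (j - 1)"

text \<open>
  \<open>U\<close> is the left factor of a compact singular value decomposition of \<open>A\<close>. It is unique only up
  to the choice of orthonormal bases of the singular subspaces, hence a predicate.
\<close>

definition is_left_singular_matrix :: "real mat \<Rightarrow> real mat \<Rightarrow> bool" where
  "is_left_singular_matrix A U \<longleftrightarrow>
     U \<in> stiefel (dim_row A) (mat_rank A) \<and>
     (\<exists>V \<in> stiefel (dim_col A) (mat_rank A).
        A = U * mat_diag (mat_rank A) (\<lambda>i. sing_val (i + 1) A) * transpose_mat V)"

definition proj :: "real mat \<Rightarrow> real mat" where
  "proj U = U * transpose_mat U"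

definition sin_theta_norm :: "real \<Rightarrow> real mat \<Rightarrow> real mat \<Rightarrow> real" where
  "sin_theta_norm q U V =
     (\<Sum>i = 1..dim_col U. (1 - (sing_val i (transpose_mat U * V))\<^sup>2) powr (q / 2)) powr (1 / q)"

section \<open>Tensors of order three\<close>

text \<open>
  Dimensions (and ranks, factor matrices) are families indexed by the modes \<open>1, 2, 3\<close>; their values
  elsewhere are irrelevant. Tensor entries are indexed from \<open>0\<close>. A tensor of dimensions \<open>p\<close> is a
  function that is extensional on \<open>idx p\<close>, so that \<open>tensors p\<close> is the space of a product measure.
\<close>

type_synonym tensor = "nat \<times> nat \<times> nat \<Rightarrow> real"

definition idx :: "(nat \<Rightarrow> nat) \<Rightarrow> (nat \<times> nat \<times> nat) set" where
  "idx p = {..<p 1} \<times> {..<p 2} \<times> {..<p 3}"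

definition tensors :: "(nat \<Rightarrow> nat) \<Rightarrow> tensor set" where
  "tensors p = idx p \<rightarrow>\<^sub>E UNIV"

definition fro_norm :: "(nat \<Rightarrow> nat) \<Rightarrow> tensor \<Rightarrow> real" where
  "fro_norm p X = sqrt (\<Sum>x\<in>idx p. (X x)\<^sup>2)"

text \<open>Columns are ordered cyclically: mode 1 by \<open>(j, k)\<close>, mode 2 by \<open>(k, i)\<close>, mode 3 by \<open>(i, j)\<close>.\<close>

definition matricize :: "(nat \<Rightarrow> nat) \<Rightarrow> nat \<Rightarrow> tensor \<Rightarrow> real mat" where
  "matricize p m X =
     (if m = 1 then Matrix.mat (p 1) (p 2 * p 3) (\<lambda>(i, c). X (i, c div p 3, c mod p 3))
      else if m = 2 then Matrix.mat (p 2) (p 3 * p 1) (\<lambda>(j, c). X (c mod p 1, j, c div p 1))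
      else Matrix.mat (p 3) (p 1 * p 2) (\<lambda>(k, c). X (c div p 2, c mod p 2, k)))"

text \<open>
  The mode products are meaningful only at indices within the dimensions of the result; they are
  only ever used below inside \<open>fro_norm\<close>, which looks at no other index.
\<close>

definition mode_prod1 :: "tensor \<Rightarrow> real mat \<Rightarrow> tensor" (infixl "\<times>\<^sub>1" 75) where
  "X \<times>\<^sub>1 A = (\<lambda>(i, j, k). \<Sum>l<dim_col A. A $$ (i, l) * X (l, j, k))"

definition mode_prod2 :: "tensor \<Rightarrow> real mat \<Rightarrow> tensor" (infixl "\<times>\<^sub>2" 75) where
  "X \<times>\<^sub>2 A = (\<lambda>(i, j, k). \<Sum>l<dim_col A. A $$ (j, l) * X (i, l, k))"

definition mode_prod3 :: "tensor \<Rightarrow> real mat \<Rightarrow> tensor" (infixl "\<times>\<^sub>3" 75) where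
  "X \<times>\<^sub>3 A = (\<lambda>(i, j, k). \<Sum>l<dim_col A. A $$ (k, l) * X (i, j, l))"

definition tucker_prod :: "tensor \<Rightarrow> (nat \<Rightarrow> real mat) \<Rightarrow> tensor" where
  "tucker_prod S V = S \<times>\<^sub>1 V 1 \<times>\<^sub>2 V 2 \<times>\<^sub>3 V 3"

definition sq_residual :: "(nat \<Rightarrow> nat) \<Rightarrow> tensor \<Rightarrow> (nat \<Rightarrow> real mat) \<Rightarrow> tensor \<Rightarrow> real" where
  "sq_residual p Y V S = (fro_norm p (\<lambda>x. Y x - tucker_prod S V x))\<^sup>2"

section \<open>The statistical model\<close>

text \<open>The law of a tensor with independent \<open>N(0, \<sigma>\<^sup>2)\<close> entries.\<close>

definition noise :: "(nat \<Rightarrow> nat) \<Rightarrow> real \<Rightarrow> tensor measure" where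
  "noise p \<sigma> = PiM (idx p) (\<lambda>_. density lborel (\<lambda>x. ennreal (normal_density 0 \<sigma> x)))"

definition observation :: "(nat \<Rightarrow> nat) \<Rightarrow> tensor \<Rightarrow> tensor \<Rightarrow> tensor" where
  "observation p X Z = (\<lambda>x\<in>idx p. X x + Z x)"

definition subspace_estimator :: "(nat \<Rightarrow> nat) \<Rightarrow> nat \<Rightarrow> nat \<Rightarrow> (tensor \<Rightarrow> real mat) \<Rightarrow> bool" where
  "subspace_estimator p n r E \<longleftrightarrow>
     (\<forall>Y\<in>tensors p. E Y \<in> stiefel n r) \<and>
     (\<forall>i<n. \<forall>j<r. (\<lambda>Y. E Y $$ (i, j)) \<in> borel_measurable (PiM (idx p) (\<lambda>_. borel)))"

text \<open>
  The risk bounds for subspace estimators \<open>E 1, E 2, E 3\<close> and a tensor estimator \<open>XE\<close>. Expectations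
  of nonnegative quantities are taken in the extended sense, so the bounds include finiteness.
\<close>

definition risk_bounds ::
  "real \<Rightarrow> (nat \<Rightarrow> nat) \<Rightarrow> (nat \<Rightarrow> nat) \<Rightarrow> real \<Rightarrow> real \<Rightarrow> tensor \<Rightarrow> (nat \<Rightarrow> real mat) \<Rightarrow>
   (nat \<Rightarrow> tensor \<Rightarrow> real mat) \<Rightarrow> (tensor \<Rightarrow> tensor) \<Rightarrow> bool" where
  "risk_bounds C p r \<sigma> lam X U E XE \<longleftrightarrow>
     (\<forall>k\<in>{1, 2, 3}. \<forall>q::real. 1 \<le> q \<and> q \<le> 2 \<longrightarrow>
        (\<integral>\<^sup>+Z. ennreal (real (r k) powr (- 1 / q) *
                sin_theta_norm q (E k (observation p X Z)) (U k)) \<partial>noise p \<sigma>)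
        \<le> ennreal (C * sqrt (real (p k)) / (lam / \<sigma>))) \<and>
     (\<integral>\<^sup>+Z. ennreal ((fro_norm p (\<lambda>x. XE (observation p X Z) x - X x))\<^sup>2) \<partial>noise p \<sigma>)
       \<le> ennreal (C * \<sigma>\<^sup>2 * real (p 1 * r 1 + p 2 * r 2 + p 3 * r 3)) \<and>
     (\<integral>\<^sup>+Z. ennreal ((fro_norm p (\<lambda>x. XE (observation p X Z) x - X x))\<^sup>2 / (fro_norm p X)\<^sup>2)
          \<partial>noise p \<sigma>)
       \<le> ennreal (C * min (real (p 1 + p 2 + p 3) / (lam\<^sup>2 / \<sigma>\<^sup>2)) 1)"

end

theory Submission
  imports Defs "Jordan_Normal_Form.Schur_Decomposition"
begin

text \<open>
  Since the residual of \<open>Xh\<close> is at most that of \<open>X\<close>, the error \<open>W = Xh - X\<close> satisfies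
  \<open>\<parallel>W\<parallel>\<^sup>2 \<le> 2 \<langle>Z, W\<rangle>\<close>. In mode \<open>k\<close>, \<open>W\<close> lives in the span of at most \<open>2 r\<^sub>k\<close> vectors, so it
  remains to bound \<open>\<langle>Z, W\<rangle>\<close> uniformly over unit tensors of low multilinear rank. Instead of a net
  argument this uses a change of measure: perturbing a low-rank tensor by independent mean-zero
  roundings of its factors to a lattice does not change the mean of \<open>\<langle>Z, W\<rangle>\<close>, so Jensen's inequality
  bounds its exponential, up to the relative entropy of the rounding, by one random variable of mean
  at most \<open>1\<close> (\<open>evidence\<close>), namely an average of Gaussian likelihood ratios over all lattice factors.
  The relative entropy is of the order of the number \<open>\<Sum> p\<^sub>k r\<^sub>k + r\<^sub>1 r\<^sub>2 r\<^sub>3\<close> of parameters. The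
  bounds on \<open>sin \<Theta>\<close> and on the relative error follow because the projection of the columns of
  \<open>U\<^sub>k\<close> off the estimated subspace is multiplied by at least \<open>\<lambda>\<close> in \<open>W\<close>, and \<open>\<parallel>X\<parallel>\<^sup>2 \<ge> r\<^sub>k \<lambda>\<^sup>2\<close>.
\<close>

section \<open>Lattice averages\<close>

text \<open>Two demands shape the argument. The direction of the error depends on \<open>Z\<close>,
  so noise must be controlled over all low-rank directions at once and up to a second moment; and
  the number of parameters must enter without a logarithmic factor. A finite average of functions of
  mean 1 meets the first demand: it yields t N \<le> 9 K + ln \<Xi>, where N is the norm of the
  noise compressed to the relevant subspaces, K dominates the parameter count and \<Xi> is the
  evidence. Bounding ln \<Xi> by 2 sqrt \<Xi> then makes the squared error at most an affine
  function of \<Xi>. The second demand dictates Gaussian-shaped weights. Rounding near x at spacing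
  \<delta> costs a multiple of (x/\<delta>)^2 plus a constant, and for a column of norm at most 1 in
  dimension p with \<delta> = 1/sqrt p these costs add up to order p. Uniform weights on the same
  window would charge order log p for each entry. The exponent is not convex in the factors, but its
  failure to be so along a single entry is an explicit square, and independent rounding pays only
  for these squares.\<close>

definition lattice_weight :: "int \<Rightarrow> real" where
  "lattice_weight k = exp (- (of_int k)\<^sup>2) / 3"

text \<open>A sub-probability average over the lattice points whose coordinates are at most K
  \<delta> in modulus. The truncation makes the sum finite, hence measurability and exchange with
  integrals immediate. Outside \<open>I\<close> the argument of \<open>h\<close> is a fixed default,
  so only those \<open>h\<close> that read coordinates in \<open>I\<close> are of interest.\<close>

definition lattice_sum :: "nat \<Rightarrow> real \<Rightarrow> 'i set \<Rightarrow> (('i \<Rightarrow> real) \<Rightarrow> real) \<Rightarrow> real" where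
  "lattice_sum K \<delta> I h =
     (\<Sum>g\<in>I \<rightarrow>\<^sub>E {- int K..int K}. (\<Prod>i\<in>I. lattice_weight (g i)) * h (\<lambda>i. \<delta> * of_int (g i)))"

lemma lattice_weight_pos: "lattice_weight k > 0"
  by (simp add: lattice_weight_def)

lemma sum_lattice_weight_le_1: "(\<Sum>k\<in>{- int K..int K}. lattice_weight k) \<le> 1"
proof -
  \<comment> \<open>The slack fits the induction: the step adds two weights of at most (1/2)^(K+1) /
    3 each, exactly the amount by which the slack shrinks. With the divisor 3 the base case is an
    equality.\<close>
  have "(\<Sum>k\<in>{- int K..int K}. lattice_weight k) \<le> 1 - (2/3) * (1/2) ^ K"
  proof (induction K)
    case 0
    then show ?case by (simp add: lattice_weight_def)
  next
    case (Suc K)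
    have e: "lattice_weight k \<le> (1/2) ^ Suc K / 3" if "\<bar>k\<bar> = int (Suc K)" for k
    proof -
      have "(of_int k)\<^sup>2 = (real (Suc K))\<^sup>2" using that
        by (metis of_int_abs of_int_of_nat_eq power2_abs)
      moreover have "real (Suc K) \<le> (real (Suc K))\<^sup>2" by (simp add: power2_eq_square)
      ultimately have "exp (- (of_int k)\<^sup>2) \<le> exp (- real (Suc K))" by simp
      also have "\<dots> = exp (-1) ^ Suc K" by (metis exp_of_nat_mult mult_minus1_right)
      also have "\<dots> \<le> (1/2) ^ Suc K"
      proof (rule power_mono)
        have "2 \<le> exp (1::real)" using exp_ge_add_one_self[of 1] by simp
        then show "exp (-1::real) \<le> 1/2" by (simp add: exp_minus field_simps)
      qed simp
      finally show ?thesis by (simp add: lattice_weight_def)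
    qed
    have "{- int (Suc K)..int (Suc K)} = insert (- int (Suc K)) (insert (int (Suc K)) {- int K..int K})"
      by auto
    then have "(\<Sum>k\<in>{- int (Suc K)..int (Suc K)}. lattice_weight k) =
        lattice_weight (- int (Suc K)) + (lattice_weight (int (Suc K)) + (\<Sum>k\<in>{- int K..int K}. lattice_weight k))"
      by simp
    with e[of "int (Suc K)"] e[of "- int (Suc K)"] Suc show ?case by simp
  qed
  also have "\<dots> \<le> 1" by simp
  finally show ?thesis .
qed

text \<open>
  Jensen for the two-point distribution with mean \<open>x\<close> on the lattice neighbours of \<open>x\<close>. Its
  variance is at most \<open>\<delta>\<^sup>2\<close>, and the remaining terms bound its relative entropy with respect to the
  weights.
\<close>

lemma lattice_lower_bound:
  fixes \<phi> :: "real \<Rightarrow> real"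
  assumes d: "0 < \<delta>" and c: "0 \<le> c" and conv: "convex_on UNIV (\<lambda>u. \<phi> u + c * u\<^sup>2)"
    and K: "\<bar>x\<bar> / \<delta> + 1 \<le> real K"
  shows "exp (\<phi> x - c * \<delta>\<^sup>2 - 2 * x\<^sup>2 / \<delta>\<^sup>2 - 4)
    \<le> (\<Sum>k\<in>{- int K..int K}. lattice_weight k * exp (\<phi> (\<delta> * of_int k)))"
proof -
  define k where "k = \<lfloor>x / \<delta>\<rfloor>"
  define \<theta> where "\<theta> = frac (x / \<delta>)"
  define a b where "a = \<delta> * of_int k" and "b = \<delta> * of_int (k + 1)"
  have th: "0 \<le> \<theta>" "\<theta> < 1" by (auto simp: \<theta>_def frac_lt_1)
  have xk: "x / \<delta> = of_int k + \<theta>" by (simp add: k_def \<theta>_def frac_def)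
  then have xd: "x = \<delta> * (of_int k + \<theta>)" using d by (simp add: field_simps)
  have x: "x = (1 - \<theta>) * a + \<theta> * b" by (simp add: xd a_def b_def algebra_simps)
  \<comment> \<open>Jensen for the two neighbours of x; the added square costs c times their
    variance \<theta> (1 - \<theta>) \<delta>^2.\<close>
  have "\<phi> x + c * x\<^sup>2 \<le> (1 - \<theta>) * (\<phi> a + c * a\<^sup>2) + \<theta> * (\<phi> b + c * b\<^sup>2)"
    using convex_onD[OF conv, of \<theta> a b] th by (simp add: x)
  also have "\<dots> = (1 - \<theta>) * \<phi> a + \<theta> * \<phi> b + c * ((1 - \<theta>) * a\<^sup>2 + \<theta> * b\<^sup>2)"
    by (simp add: algebra_simps)
  also have "(1 - \<theta>) * a\<^sup>2 + \<theta> * b\<^sup>2 = x\<^sup>2 + \<theta> * (1 - \<theta>) * \<delta>\<^sup>2"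
    by (simp add: xd a_def b_def algebra_simps power2_eq_square)
  also have "c * (x\<^sup>2 + \<theta> * (1 - \<theta>) * \<delta>\<^sup>2) = c * x\<^sup>2 + c * (\<theta> * (1 - \<theta>) * \<delta>\<^sup>2)"
    by (rule distrib_left)
  finally have "\<phi> x + c * x\<^sup>2 \<le> (1 - \<theta>) * \<phi> a + \<theta> * \<phi> b + (c * x\<^sup>2 + c * (\<theta> * (1 - \<theta>) * \<delta>\<^sup>2))" .
  moreover have "c * (\<theta> * (1 - \<theta>) * \<delta>\<^sup>2) \<le> c * \<delta>\<^sup>2"
  proof -
    have "\<theta> * (1 - \<theta>) \<le> 1" using th by (simp add: mult_le_one)
    then have "\<theta> * (1 - \<theta>) * \<delta>\<^sup>2 \<le> 1 * \<delta>\<^sup>2" by (rule mult_right_mono) simp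
    then show ?thesis using c by (intro mult_left_mono) auto
  qed
  ultimately have *: "\<phi> x - c * \<delta>\<^sup>2 \<le> (1 - \<theta>) * \<phi> a + \<theta> * \<phi> b"
    by linarith
  have ex: "exp ((1 - \<theta>) * \<phi> a + \<theta> * \<phi> b) \<le> (1 - \<theta>) * exp (\<phi> a) + \<theta> * exp (\<phi> b)"
    using convex_onD[OF exp_convex, of \<theta> "\<phi> a" "\<phi> b"] th by simp
  \<comment> \<open>A lower bound for the weights of both neighbours. Their index is at most
    |x|/\<delta> + 1, with square at most 2 (x/\<delta>)^2 + 2, and the divisor 3 is at most exp 2;
    this is the constant 4.\<close>
  define m where "m = exp (- 2 * x\<^sup>2 / \<delta>\<^sup>2 - 4)"
  have w: "m \<le> lattice_weight l" if "\<bar>of_int l\<bar> \<le> \<bar>x\<bar> / \<delta> + 1" for l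
  proof -
    have sq: "(a + 1)\<^sup>2 \<le> 2 * a\<^sup>2 + 2" for a :: real
      using zero_le_power2[of "a - 1"] by (simp add: power2_eq_square algebra_simps)
    have "(of_int l)\<^sup>2 \<le> (\<bar>x\<bar> / \<delta> + 1)\<^sup>2" using power_mono[OF that, of 2] by simp
    also have "\<dots> \<le> 2 * (\<bar>x\<bar> / \<delta>)\<^sup>2 + 2"
      by (rule sq)
    finally have "- (of_int l)\<^sup>2 \<ge> - (2 * x\<^sup>2 / \<delta>\<^sup>2) - 2" by (simp add: power_divide)
    then have "exp (- (2 * x\<^sup>2 / \<delta>\<^sup>2) - 2) \<le> exp (- (of_int l)\<^sup>2)" by (simp only: exp_le_cancel_iff)
    moreover have "m * 3 \<le> exp (- (2 * x\<^sup>2 / \<delta>\<^sup>2) - 2)"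
    proof -
      have "3 \<le> exp (2::real)" using exp_ge_add_one_self[of 2] by simp
      then have "m * 3 \<le> m * exp 2" by (simp add: m_def)
      also have "\<dots> = exp (- (2 * x\<^sup>2 / \<delta>\<^sup>2) - 2)" by (simp add: m_def flip: exp_add)
      finally show ?thesis .
    qed
    ultimately show ?thesis unfolding lattice_weight_def by linarith
  qed
  have kb: "\<bar>of_int k\<bar> \<le> \<bar>x\<bar> / \<delta> + 1" "\<bar>of_int (k + 1)\<bar> \<le> \<bar>x\<bar> / \<delta> + 1"
  proof -
    have "\<bar>x\<bar> / \<delta> = \<bar>x / \<delta>\<bar>" using d by simp
    also have "\<dots> = \<bar>of_int k + \<theta>\<bar>" by (simp only: xk)
    finally show "\<bar>of_int k\<bar> \<le> \<bar>x\<bar> / \<delta> + 1" "\<bar>of_int (k + 1)\<bar> \<le> \<bar>x\<bar> / \<delta> + 1"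
      using th by auto
  qed
  have "exp (\<phi> x - c * \<delta>\<^sup>2 - 2 * x\<^sup>2 / \<delta>\<^sup>2 - 4) = m * exp (\<phi> x - c * \<delta>\<^sup>2)"
    by (simp add: m_def flip: exp_add)
  also have "\<dots> \<le> m * ((1 - \<theta>) * exp (\<phi> a) + \<theta> * exp (\<phi> b))"
    using * ex by (intro mult_left_mono) (auto simp: m_def intro: order_trans)
  \<comment> \<open>Discarding the probabilities 1 - \<theta> and \<theta> gives away the entropy of
    the two-point law, which is nonnegative.\<close>
  also have "\<dots> \<le> m * (exp (\<phi> a) + exp (\<phi> b))"
    using th by (intro mult_left_mono add_mono) (auto simp: m_def mult_left_le_one_le)
  also have "\<dots> \<le> lattice_weight k * exp (\<phi> a) + lattice_weight (k + 1) * exp (\<phi> b)"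
    unfolding distrib_left by (intro add_mono mult_right_mono w kb) auto
  also have "\<dots> = (\<Sum>l\<in>{k, k + 1}. lattice_weight l * exp (\<phi> (\<delta> * of_int l)))"
    by (simp add: a_def b_def)
  also have "\<dots> \<le> (\<Sum>l\<in>{- int K..int K}. lattice_weight l * exp (\<phi> (\<delta> * of_int l)))"
  proof (rule sum_mono2)
    have "\<bar>of_int k\<bar> \<le> real K" "\<bar>of_int (k + 1)\<bar> \<le> real K" using kb K by linarith+
    then show "{k, k + 1} \<subseteq> {- int K..int K}" by (auto simp: abs_le_iff)
  qed (auto intro!: mult_nonneg_nonneg less_imp_le[OF lattice_weight_pos])
  finally show ?thesis .
qed

lemma lattice_sum_mono:
  assumes "\<And>y. h y \<le> h' y"
  shows "lattice_sum K \<delta> I h \<le> lattice_sum K \<delta> I h'"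
  unfolding lattice_sum_def
  by (intro sum_mono mult_left_mono assms prod_nonneg less_imp_le[OF lattice_weight_pos])

lemma lattice_sum_insert:
  assumes "finite I" "i \<notin> I"
  shows "lattice_sum K \<delta> (insert i I) h =
    (\<Sum>u\<in>{- int K..int K}. lattice_weight u * lattice_sum K \<delta> I (\<lambda>y. h (y(i := \<delta> * of_int u))))"
proof -
  let ?D = "{- int K..int K}"
  have inj: "inj_on (\<lambda>(y, g). g(i := y)) (?D \<times> (I \<rightarrow>\<^sub>E ?D))"
    using inj_combinator[OF \<open>i \<notin> I\<close>, of "\<lambda>_. ?D"] by simp
  have "lattice_sum K \<delta> (insert i I) h = (\<Sum>(u, g)\<in>?D \<times> (I \<rightarrow>\<^sub>E ?D).
      (\<Prod>j\<in>insert i I. lattice_weight ((g(i := u)) j)) * h (\<lambda>j. \<delta> * of_int ((g(i := u)) j)))"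
    unfolding lattice_sum_def PiE_insert_eq
    by (subst sum.reindex[OF inj]) (simp add: case_prod_unfold)
  also have "\<dots> = (\<Sum>u\<in>?D. \<Sum>g\<in>I \<rightarrow>\<^sub>E ?D.
      lattice_weight u * ((\<Prod>j\<in>I. lattice_weight (g j)) * h ((\<lambda>j. \<delta> * of_int (g j))(i := \<delta> * of_int u))))"
  proof (subst sum.cartesian_product[symmetric], intro sum.cong refl)
    fix u g
    have 1: "(\<Prod>j\<in>insert i I. lattice_weight ((g(i := u)) j)) = lattice_weight u * (\<Prod>j\<in>I. lattice_weight (g j))"
      using assms by (subst prod.insert) (auto intro!: arg_cong2[where f="(*)"] prod.cong)
    have 2: "(\<lambda>j. \<delta> * of_int ((g(i := u)) j)) = (\<lambda>j. \<delta> * of_int (g j))(i := \<delta> * of_int u)"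
      by auto
    show "(\<Prod>j\<in>insert i I. lattice_weight ((g(i := u)) j)) * h (\<lambda>j. \<delta> * of_int ((g(i := u)) j)) =
      lattice_weight u * ((\<Prod>j\<in>I. lattice_weight (g j)) * h ((\<lambda>j. \<delta> * of_int (g j))(i := \<delta> * of_int u)))"
      unfolding 1 2 by simp
  qed
  finally show ?thesis by (simp add: lattice_sum_def sum_distrib_left)
qed

text \<open>Coordinates are rounded independently, so convexity is used only along one coordinate
  with the others frozen. For a quadratic exponent this pays for the diagonal of the Hessian and not
  for its cross terms.\<close>

lemma lattice_sum_lower_bound:
  fixes f :: "('i \<Rightarrow> real) \<Rightarrow> real"
  assumes "finite I" and d: "0 < \<delta>" and c: "\<And>i. i \<in> I \<Longrightarrow> 0 \<le> c i"
    and "\<And>i y. i \<in> I \<Longrightarrow> convex_on UNIV (\<lambda>u. f (y(i := u)) + c i * u\<^sup>2)"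
    and "\<And>i. i \<in> I \<Longrightarrow> \<bar>x i\<bar> / \<delta> + 1 \<le> real K"
    and "\<And>y y'. (\<And>i. i \<in> I \<Longrightarrow> y i = y' i) \<Longrightarrow> f y = f y'"
  shows "exp (f x - (\<Sum>i\<in>I. c i * \<delta>\<^sup>2 + 2 * (x i)\<^sup>2 / \<delta>\<^sup>2 + 4)) \<le> lattice_sum K \<delta> I (\<lambda>y. exp (f y))"
  using assms(1,3-)
proof (induction I arbitrary: f rule: finite_induct)
  case empty
  \<comment> \<open>With no coordinates left the single lattice function is constantly the default
    value, and \<open>f\<close> cannot tell it from \<open>x\<close>.\<close>
  have "f x = f (\<lambda>i. \<delta> * of_int undefined)" by (rule empty.prems) simp
  then show ?case by (simp add: lattice_sum_def)
next
  case (insert i I)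
  let ?e = "\<lambda>i. c i * \<delta>\<^sup>2 + 2 * (x i)\<^sup>2 / \<delta>\<^sup>2 + 4"
  have IH: "exp (f (x(i := v)) - sum ?e I) \<le> lattice_sum K \<delta> I (\<lambda>y. exp (f (y(i := v))))" for v
  proof (rule insert.IH)
    fix j y assume j: "j \<in> I"
    then have "j \<noteq> i" using insert.hyps by auto
    then have twist: "(y(j := u))(i := v) = (y(i := v))(j := u)" for u by (rule fun_upd_twist)
    show "convex_on UNIV (\<lambda>u. f ((y(j := u))(i := v)) + c j * u\<^sup>2)"
      unfolding twist using j by (intro insert.prems(2)) auto
  next
    fix y y' :: "'i \<Rightarrow> real" assume "\<And>j. j \<in> I \<Longrightarrow> y j = y' j"
    then show "f (y(i := v)) = f (y'(i := v))" by (intro insert.prems(4)) auto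
  qed (rule insert.prems(1,3), simp)+
  \<comment> \<open>The new coordinate is rounded while the others stay at \<open>x\<close>; the
    induction hypothesis then rounds the others separately for each of its lattice values.\<close>
  have "exp (f x - sum ?e (insert i I)) = exp (f (x(i := x i)) - c i * \<delta>\<^sup>2 - 2 * (x i)\<^sup>2 / \<delta>\<^sup>2 - 4) * exp (- sum ?e I)"
    using insert.hyps by (simp add: algebra_simps flip: exp_add)
  also have "\<dots> \<le> (\<Sum>k\<in>{- int K..int K}. lattice_weight k * exp (f (x(i := \<delta> * of_int k)))) * exp (- sum ?e I)"
    by (intro mult_right_mono lattice_lower_bound d insert.prems) auto
  also have "\<dots> = (\<Sum>k\<in>{- int K..int K}. lattice_weight k * exp (f (x(i := \<delta> * of_int k)) - sum ?e I))"
  proof -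
    have "exp (a - b) = exp a * exp (- b)" for a b :: real by (simp flip: exp_add)
    then show ?thesis by (simp only: sum_distrib_right mult.assoc)
  qed
  also have "\<dots> \<le> lattice_sum K \<delta> (insert i I) (\<lambda>y. exp (f y))"
    unfolding lattice_sum_insert[OF insert.hyps]
    by (intro sum_mono mult_left_mono IH less_imp_le[OF lattice_weight_pos])
  finally show ?case .
qed

lemma lattice_sum_le_1:
  assumes "finite I"
  shows "(\<Sum>g\<in>I \<rightarrow>\<^sub>E {- int K..int K}. (\<Prod>i\<in>I. lattice_weight (g i))) \<le> 1"
proof -
  have "(\<Sum>g\<in>I \<rightarrow>\<^sub>E {- int K..int K}. (\<Prod>i\<in>I. lattice_weight (g i))) = (\<Prod>i\<in>I. \<Sum>k\<in>{- int K..int K}. lattice_weight k)"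
    using assms by (subst prod_sum_PiE) auto
  also have "\<dots> \<le> 1"
    by (intro prod_le_1) (auto intro!: sum_nonneg sum_lattice_weight_le_1 less_imp_le[OF lattice_weight_pos])
  finally show ?thesis .
qed

section \<open>The Gaussian evidence\<close>

text \<open>Operator norm at most 1. This is weaker than orthonormality of the columns because the
  bases constructed later contain zero columns when the spanning vectors are dependent.\<close>

definition contraction :: "nat \<Rightarrow> nat \<Rightarrow> (nat \<times> nat \<Rightarrow> real) \<Rightarrow> bool" where
  "contraction p n v \<longleftrightarrow> (\<forall>b. (\<Sum>i<p. (\<Sum>a<n. v (i, a) * b a)\<^sup>2) \<le> (\<Sum>a<n. (b a)\<^sup>2))"

lemma contraction_column:
  assumes "contraction p n v" "a < n"
  shows "(\<Sum>i<p. (v (i, a))\<^sup>2) \<le> 1"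
proof -
  have "(\<Sum>i<p. (\<Sum>a'<n. v (i, a') * (if a' = a then 1 else 0))\<^sup>2) \<le> (\<Sum>a'<n. (if a' = a then 1 else (0::real))\<^sup>2)"
    using assms(1) unfolding contraction_def by (rule allE[of _ "\<lambda>a'. if a' = a then 1 else 0"])
  moreover have "(\<Sum>a'<n. v (i, a') * (if a' = a then 1 else 0)) = v (i, a)" for i
  proof -
    have "(\<Sum>a'<n. v (i, a') * (if a' = a then 1 else 0)) = (\<Sum>a'<n. if a' = a then v (i, a) else 0)"
      by (intro sum.cong) auto
    then show ?thesis using assms(2) by simp
  qed
  moreover have "(\<Sum>a'<n. (if a' = a then 1 else (0::real))\<^sup>2) = (\<Sum>a'<n. if a' = a then 1 else 0)"
    by (intro sum.cong) auto
  ultimately show ?thesis using assms(2) by simp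
qed

section \<open>Rounding one factor matrix or the core\<close>

lemma convex_on_affine: "convex_on UNIV (\<lambda>u::real. \<alpha> + \<beta> * u)"
  by (rule convex_onI) (auto simp: algebra_simps)

lemma sum_adjoint:
  fixes z b :: "nat \<Rightarrow> 'm \<Rightarrow> real"
  shows "(\<Sum>i<p. \<Sum>m\<in>M. z i m * (\<Sum>a<n. v (i, a) * b a m)) = (\<Sum>a<n. \<Sum>m\<in>M. (\<Sum>i<p. v (i, a) * z i m) * b a m)"
proof -
  have "(\<Sum>i<p. \<Sum>m\<in>M. z i m * (\<Sum>a<n. v (i, a) * b a m)) = (\<Sum>i<p. \<Sum>m\<in>M. \<Sum>a<n. v (i, a) * z i m * b a m)"
    by (simp add: sum_distrib_left mult_ac)
  also have "\<dots> = (\<Sum>i<p. \<Sum>a<n. \<Sum>m\<in>M. v (i, a) * z i m * b a m)"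
    by (intro sum.cong refl sum.swap)
  also have "\<dots> = (\<Sum>a<n. \<Sum>i<p. \<Sum>m\<in>M. v (i, a) * z i m * b a m)"
    by (rule sum.swap)
  also have "\<dots> = (\<Sum>a<n. \<Sum>m\<in>M. \<Sum>i<p. v (i, a) * z i m * b a m)"
    by (intro sum.cong refl sum.swap)
  finally show ?thesis
    by (simp add: sum_distrib_right)
qed

text \<open>One mode is rounded; the other two, collected in the index \<open>m\<close>, are frozen
  inside \<open>z\<close> and \<open>b\<close>. A variance of at most 1/p per entry adds at most the
  squared norm of \<open>b\<close> to the mean squared norm of the product, and the contraction
  property bounds the unrounded product by the same amount: hence 2 s. The entropy is 6 per entry: 4
  from the weights, and 2 on average since the columns of \<open>v\<close> have norm at most
  1.\<close>

lemma lattice_block_step: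
  fixes z b :: "nat \<Rightarrow> 'm \<Rightarrow> real"
  assumes p: "0 < p" and v: "contraction p n v" and s: "0 \<le> s" and K: "sqrt (real p) + 1 \<le> real K"
    and M: "finite M"
  shows "exp ((\<Sum>a<n. \<Sum>m\<in>M. (\<Sum>i<p. v (i, a) * z i m) * b a m)
      - 2 * s * (\<Sum>a<n. \<Sum>m\<in>M. (b a m)\<^sup>2) - 6 * real (p * n))
    \<le> lattice_sum K (1 / sqrt (real p)) ({..<p} \<times> {..<n})
        (\<lambda>y. exp ((\<Sum>i<p. \<Sum>m\<in>M. z i m * (\<Sum>a<n. y (i, a) * b a m))
          - s * (\<Sum>i<p. \<Sum>m\<in>M. (\<Sum>a<n. y (i, a) * b a m)\<^sup>2)))"
proof -
  define f where "f y = (\<Sum>i<p. \<Sum>m\<in>M. z i m * (\<Sum>a<n. y (i, a) * b a m))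
      - s * (\<Sum>i<p. \<Sum>m\<in>M. (\<Sum>a<n. y (i, a) * b a m)\<^sup>2)" for y
  \<comment> \<open>Minus the coefficient of the square of the entry \<open>x\<close> in
    \<open>f\<close>, so adding it leaves a function that is affine in this entry.\<close>
  define c where "c x = s * (\<Sum>m\<in>M. (b (snd x) m)\<^sup>2)" for x :: "nat \<times> nat"
  let ?J = "{..<p} \<times> {..<n}" and ?\<delta> = "1 / sqrt (real p)"
  have delta: "?\<delta>\<^sup>2 = 1 / real p" using p by (simp add: power_divide)
  have v1: "(v x)\<^sup>2 \<le> 1" if J: "x \<in> ?J" for x
  proof -
    obtain i a where x: "x = (i, a)" "i < p" "a < n" using J by auto
    have "(v (i, a))\<^sup>2 \<le> (\<Sum>i<p. (v (i, a))\<^sup>2)"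
      using x by (intro member_le_sum) auto
    with contraction_column[OF v x(3)] x(1) show ?thesis by simp
  qed
  have "exp (f v - (\<Sum>x\<in>?J. c x * ?\<delta>\<^sup>2 + 2 * (v x)\<^sup>2 / ?\<delta>\<^sup>2 + 4)) \<le> lattice_sum K ?\<delta> ?J (\<lambda>y. exp (f y))"
  proof (rule lattice_sum_lower_bound)
    fix x y assume "x \<in> ?J"
    then obtain i0 a0 where x: "x = (i0, a0)" "i0 < p" "a0 < n" by auto
    \<comment> \<open>The part of the product that does not involve the entry
      \<open>(i0, a0)\<close>.\<close>
    define g where "g i m = (\<Sum>a\<in>{..<n} - (if i = i0 then {a0} else {}). y (i, a) * b a m)" for i m
    have g: "(\<Sum>a<n. (y(x := u)) (i, a) * b a m) = g i m + (if i = i0 then u * b a0 m else 0)" for u i m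
    proof (cases "i = i0")
      case True
      have "(\<Sum>a<n. (y(x := u)) (i, a) * b a m) = u * b a0 m + (\<Sum>a\<in>{..<n} - {a0}. (y(x := u)) (i, a) * b a m)"
        using x True by (subst sum.remove[of _ a0]) auto
      also have "(\<Sum>a\<in>{..<n} - {a0}. (y(x := u)) (i, a) * b a m) = g i m"
        unfolding g_def using True x by (intro sum.cong) auto
      finally show ?thesis using True by simp
    next
      case False
      then show ?thesis unfolding g_def using x by (auto intro!: sum.cong)
    qed
    have delta_sum: "(\<Sum>i<p. \<Sum>m\<in>M. if i = i0 then h i m else 0) = (\<Sum>m\<in>M. h i0 m)" for h :: "nat \<Rightarrow> 'm \<Rightarrow> real"
      using x by (subst sum.swap) (simp add: sum.delta)
    have lin: "(\<Sum>i<p. \<Sum>m\<in>M. z i m * (g i m + (if i = i0 then u * b a0 m else 0)))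
        = (\<Sum>i<p. \<Sum>m\<in>M. z i m * g i m) + (\<Sum>m\<in>M. z i0 m * (u * b a0 m))" for u
    proof -
      have "(\<Sum>i<p. \<Sum>m\<in>M. z i m * (g i m + (if i = i0 then u * b a0 m else 0)))
        = (\<Sum>i<p. \<Sum>m\<in>M. z i m * g i m + (if i = i0 then z i m * (u * b a0 m) else 0))"
        by (intro sum.cong refl) (simp add: distrib_left)
      then show ?thesis by (simp only: sum.distrib delta_sum)
    qed
    have quad: "(\<Sum>i<p. \<Sum>m\<in>M. (g i m + (if i = i0 then u * b a0 m else 0))\<^sup>2)
        = (\<Sum>i<p. \<Sum>m\<in>M. (g i m)\<^sup>2) + (\<Sum>m\<in>M. 2 * g i0 m * (u * b a0 m) + (u * b a0 m)\<^sup>2)" for u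
    proof -
      have "(\<Sum>i<p. \<Sum>m\<in>M. (g i m + (if i = i0 then u * b a0 m else 0))\<^sup>2)
        = (\<Sum>i<p. \<Sum>m\<in>M. (g i m)\<^sup>2 + (if i = i0 then 2 * g i m * (u * b a0 m) + (u * b a0 m)\<^sup>2 else 0))"
        by (intro sum.cong refl) (simp add: power2_sum)
      then show ?thesis by (simp only: sum.distrib[of "\<lambda>m. (g _ m)\<^sup>2"] sum.distrib[of "\<lambda>i. \<Sum>m\<in>M. (g i m)\<^sup>2"] delta_sum)
    qed
    have "f (y(x := u)) + c x * u\<^sup>2 = ((\<Sum>i<p. \<Sum>m\<in>M. z i m * g i m) - s * (\<Sum>i<p. \<Sum>m\<in>M. (g i m)\<^sup>2))
        + ((\<Sum>m\<in>M. z i0 m * b a0 m) - 2 * s * (\<Sum>m\<in>M. g i0 m * b a0 m)) * u" for u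
      unfolding f_def g lin quad unfolding c_def x(1) snd_conv
      by (simp add: sum.distrib sum_distrib_left sum_distrib_right algebra_simps power_mult_distrib)
    then show "convex_on UNIV (\<lambda>u. f (y(x := u)) + c x * u\<^sup>2)"
      by (simp only: convex_on_affine)
  next
    fix x assume "x \<in> ?J"
    then have "\<bar>v x\<bar> \<le> 1" using v1[of x] by (simp add: abs_square_le_1)
    then have "\<bar>v x\<bar> * sqrt (real p) \<le> 1 * sqrt (real p)" by (rule mult_right_mono) simp
    then show "\<bar>v x\<bar> / ?\<delta> + 1 \<le> real K" using K by simp
  next
    fix y y' :: "nat \<times> nat \<Rightarrow> real" assume "\<And>x. x \<in> ?J \<Longrightarrow> y x = y' x"
    then show "f y = f y'" unfolding f_def by simp
  qed (use p s in \<open>auto simp: c_def intro!: mult_nonneg_nonneg sum_nonneg\<close>)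
  moreover have "(\<Sum>a<n. \<Sum>m\<in>M. (\<Sum>i<p. v (i, a) * z i m) * b a m)
      - 2 * s * (\<Sum>a<n. \<Sum>m\<in>M. (b a m)\<^sup>2) - 6 * real (p * n)
      \<le> f v - (\<Sum>x\<in>?J. c x * ?\<delta>\<^sup>2 + 2 * (v x)\<^sup>2 / ?\<delta>\<^sup>2 + 4)"
  proof -
    note 1 = sum_adjoint[where p = p and M = M and z = z and n = n and v = v and b = b]
    have "(\<Sum>i<p. \<Sum>m\<in>M. (\<Sum>a<n. v (i, a) * b a m)\<^sup>2) = (\<Sum>m\<in>M. \<Sum>i<p. (\<Sum>a<n. v (i, a) * b a m)\<^sup>2)"
      by (rule sum.swap)
    also have "\<dots> \<le> (\<Sum>m\<in>M. \<Sum>a<n. (b a m)\<^sup>2)"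
    proof (rule sum_mono)
      fix m
      show "(\<Sum>i<p. (\<Sum>a<n. v (i, a) * b a m)\<^sup>2) \<le> (\<Sum>a<n. (b a m)\<^sup>2)"
        using v unfolding contraction_def by (rule allE[of _ "\<lambda>a. b a m"])
    qed
    also have "\<dots> = (\<Sum>a<n. \<Sum>m\<in>M. (b a m)\<^sup>2)" by (rule sum.swap)
    finally have 2: "s * (\<Sum>i<p. \<Sum>m\<in>M. (\<Sum>a<n. v (i, a) * b a m)\<^sup>2) \<le> s * (\<Sum>a<n. \<Sum>m\<in>M. (b a m)\<^sup>2)"
      using s by (rule mult_left_mono)
    have "(\<Sum>x\<in>?J. c x * ?\<delta>\<^sup>2) = s * (\<Sum>a<n. \<Sum>m\<in>M. (b a m)\<^sup>2)"
    proof -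
      have "(\<Sum>x\<in>?J. c x * ?\<delta>\<^sup>2) = (\<Sum>i<p. \<Sum>a<n. s * (\<Sum>m\<in>M. (b a m)\<^sup>2) / real p)"
        unfolding delta c_def by (subst sum.cartesian_product) (simp add: case_prod_unfold)
      also have "\<dots> = s * (\<Sum>a<n. \<Sum>m\<in>M. (b a m)\<^sup>2)"
        using p by (simp flip: sum_divide_distrib sum_distrib_left)
      finally show ?thesis .
    qed
    moreover have "(\<Sum>x\<in>?J. 2 * (v x)\<^sup>2 / ?\<delta>\<^sup>2) \<le> 2 * real (p * n)"
    proof -
      have "(\<Sum>x\<in>?J. 2 * (v x)\<^sup>2 / ?\<delta>\<^sup>2) = (\<Sum>i<p. \<Sum>a<n. 2 * real p * (v (i, a))\<^sup>2)"
        unfolding delta by (subst sum.cartesian_product) (simp add: case_prod_unfold mult_ac)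
      also have "\<dots> = (\<Sum>a<n. 2 * real p * (\<Sum>i<p. (v (i, a))\<^sup>2))"
        by (subst sum.swap) (simp add: sum_distrib_left)
      also have "\<dots> \<le> (\<Sum>a<n. 2 * real p * 1)"
        using contraction_column[OF v] by (intro sum_mono mult_left_mono) auto
      finally show ?thesis by (simp add: mult_ac)
    qed
    moreover have "(\<Sum>x\<in>?J. 4::real) = 4 * real (p * n)" by simp
    ultimately have "(\<Sum>x\<in>?J. c x * ?\<delta>\<^sup>2 + 2 * (v x)\<^sup>2 / ?\<delta>\<^sup>2 + 4)
        \<le> s * (\<Sum>a<n. \<Sum>m\<in>M. (b a m)\<^sup>2) + 6 * real (p * n)"
      unfolding sum.distrib by linarith
    then show ?thesis unfolding f_def 1 using 2 by linarith
  qed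
  ultimately show ?thesis unfolding f_def by (smt (verit) exp_le_cancel_iff)
qed

text \<open>The core is rounded as a single vector. With spacing 1/sqrt (card J) the total variance
  is at most 1, the same as the bound on the squared norm of \<open>S\<close>; hence 2 s.\<close>

lemma lattice_core_step:
  fixes z S :: "'i \<Rightarrow> real"
  assumes J: "finite J" "J \<noteq> {}" and s: "0 \<le> s" and K: "sqrt (real (card J)) + 1 \<le> real K"
    and S: "(\<Sum>x\<in>J. (S x)\<^sup>2) \<le> 1"
  shows "exp ((\<Sum>x\<in>J. z x * S x) - 2 * s - 6 * real (card J))
    \<le> lattice_sum K (1 / sqrt (real (card J))) J (\<lambda>y. exp ((\<Sum>x\<in>J. z x * y x) - s * (\<Sum>x\<in>J. (y x)\<^sup>2)))"
proof -
  define f where "f y = (\<Sum>x\<in>J. z x * y x) - s * (\<Sum>x\<in>J. (y x)\<^sup>2)" for y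
  let ?\<delta> = "1 / sqrt (real (card J))"
  have p: "0 < card J" using J by (simp add: card_gt_0_iff)
  have delta: "?\<delta>\<^sup>2 = 1 / real (card J)" using p by (simp add: power_divide)
  have S1: "(S x)\<^sup>2 \<le> 1" if "x \<in> J" for x
    using member_le_sum[of x J "\<lambda>x. (S x)\<^sup>2"] that J S by simp
  have "exp (f S - (\<Sum>x\<in>J. s * ?\<delta>\<^sup>2 + 2 * (S x)\<^sup>2 / ?\<delta>\<^sup>2 + 4)) \<le> lattice_sum K ?\<delta> J (\<lambda>y. exp (f y))"
  proof (rule lattice_sum_lower_bound)
    fix x y assume x: "x \<in> J"
    have r: "(\<Sum>i\<in>J. h i ((y(x := u)) i)) = h x u + (\<Sum>i\<in>J - {x}. h i (y i))" for u and h :: "'i \<Rightarrow> real \<Rightarrow> real"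
    proof -
      have "(\<Sum>i\<in>J. h i ((y(x := u)) i)) = h x u + (\<Sum>i\<in>J - {x}. h i ((y(x := u)) i))"
        using x J by (subst sum.remove[of _ x]) auto
      also have "(\<Sum>i\<in>J - {x}. h i ((y(x := u)) i)) = (\<Sum>i\<in>J - {x}. h i (y i))"
        by (intro sum.cong) auto
      finally show ?thesis .
    qed
    have "f (y(x := u)) + s * u\<^sup>2 = ((\<Sum>i\<in>J - {x}. z i * y i) - s * (\<Sum>i\<in>J - {x}. (y i)\<^sup>2)) + z x * u" for u
      unfolding f_def r[of "\<lambda>i t. z i * t"] r[of "\<lambda>i t. t\<^sup>2"] by (simp add: algebra_simps)
    then show "convex_on UNIV (\<lambda>u. f (y(x := u)) + s * u\<^sup>2)"
      by (simp only: convex_on_affine)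
  next
    fix x assume "x \<in> J"
    then have "\<bar>S x\<bar> \<le> 1" using S1[of x] by (simp add: abs_square_le_1)
    then have "\<bar>S x\<bar> * sqrt (real (card J)) \<le> 1 * sqrt (real (card J))" by (rule mult_right_mono) simp
    then show "\<bar>S x\<bar> / ?\<delta> + 1 \<le> real K" using K by simp
  next
    fix y y' :: "'i \<Rightarrow> real" assume "\<And>x. x \<in> J \<Longrightarrow> y x = y' x"
    then show "f y = f y'" unfolding f_def by simp
  qed (use p J s in auto)
  moreover have "(\<Sum>x\<in>J. z x * S x) - 2 * s - 6 * real (card J)
      \<le> f S - (\<Sum>x\<in>J. s * ?\<delta>\<^sup>2 + 2 * (S x)\<^sup>2 / ?\<delta>\<^sup>2 + 4)"
  proof -
    have "(\<Sum>x\<in>J. s * ?\<delta>\<^sup>2) = s" unfolding delta using p by simp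
    moreover have "(\<Sum>x\<in>J. 2 * (S x)\<^sup>2 / ?\<delta>\<^sup>2) \<le> 2 * real (card J)"
    proof -
      have "(\<Sum>x\<in>J. 2 * (S x)\<^sup>2 / ?\<delta>\<^sup>2) = 2 * real (card J) * (\<Sum>x\<in>J. (S x)\<^sup>2)"
        unfolding delta by (simp add: sum_distrib_left mult_ac)
      also have "\<dots> \<le> 2 * real (card J) * 1" by (intro mult_left_mono S) simp
      finally show ?thesis by simp
    qed
    moreover have "(\<Sum>x\<in>J. 4::real) = 4 * real (card J)" by simp
    moreover have "s * (\<Sum>x\<in>J. (S x)\<^sup>2) \<le> s * 1" using S s by (rule mult_left_mono)
    ultimately show ?thesis unfolding f_def sum.distrib by linarith
  qed
  ultimately show ?thesis unfolding f_def by (smt (verit) exp_le_cancel_iff)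
qed

section \<open>Means of lattice averages of likelihood ratios\<close>

text \<open>The three conclusions have the form of the hypotheses on \<open>h\<close>, so the lemma
  iterates through nested averages.\<close>

lemma nn_integral_lattice_sum_le_1:
  assumes I: "finite I" and meas: "\<And>y. h y \<in> borel_measurable M" and nonneg: "\<And>y z. 0 \<le> (h y z :: real)"
    and int: "\<And>y. (\<integral>\<^sup>+z. ennreal (h y z) \<partial>M) \<le> 1"
  shows "(\<lambda>z. lattice_sum K \<delta> I (\<lambda>y. h y z)) \<in> borel_measurable M"
    and "0 \<le> lattice_sum K \<delta> I (\<lambda>y. h y z)"
    and "(\<integral>\<^sup>+z. ennreal (lattice_sum K \<delta> I (\<lambda>y. h y z)) \<partial>M) \<le> 1"
proof -
  let ?G = "I \<rightarrow>\<^sub>E {- int K..int K}" and ?w = "\<lambda>g. \<Prod>i\<in>I. lattice_weight (g i)"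
  note [measurable] = meas
  have w: "0 \<le> ?w g" for g by (intro prod_nonneg less_imp_le[OF lattice_weight_pos])
  show "(\<lambda>z. lattice_sum K \<delta> I (\<lambda>y. h y z)) \<in> borel_measurable M"
    unfolding lattice_sum_def by measurable
  show "0 \<le> lattice_sum K \<delta> I (\<lambda>y. h y z)"
    unfolding lattice_sum_def by (intro sum_nonneg mult_nonneg_nonneg w nonneg)
  have "(\<integral>\<^sup>+z. ennreal (lattice_sum K \<delta> I (\<lambda>y. h y z)) \<partial>M)
      = (\<integral>\<^sup>+z. (\<Sum>g\<in>?G. ennreal (?w g) * ennreal (h (\<lambda>i. \<delta> * of_int (g i)) z)) \<partial>M)"
    unfolding lattice_sum_def by (simp add: ennreal_mult w nonneg flip: sum_ennreal)
  also have "\<dots> = (\<Sum>g\<in>?G. ennreal (?w g) * (\<integral>\<^sup>+z. ennreal (h (\<lambda>i. \<delta> * of_int (g i)) z) \<partial>M))"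
    by (simp add: nn_integral_sum nn_integral_cmult)
  also have "\<dots> \<le> (\<Sum>g\<in>?G. ennreal (?w g) * 1)"
    by (intro sum_mono mult_left_mono int) auto
  also have "\<dots> = ennreal (\<Sum>g\<in>?G. ?w g)" by (simp add: w sum_ennreal)
  also have "\<dots> \<le> 1" using lattice_sum_le_1[OF I] by (simp add: ennreal_le_1)
  finally show "(\<integral>\<^sup>+z. ennreal (lattice_sum K \<delta> I (\<lambda>y. h y z)) \<partial>M) \<le> 1" .
qed

text \<open>The integrand is the density of noise with mean t \<sigma>^2 T relative to centred
  noise. It factors over the entries, and completing the square turns each factor into a shifted
  normal density.\<close>

lemma nn_integral_gaussian_exp:
  fixes T :: "nat \<times> nat \<times> nat \<Rightarrow> real"
  assumes "\<sigma> > 0"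
  shows "(\<integral>\<^sup>+Z. ennreal (exp (t * (\<Sum>x\<in>idx p. Z x * T x) - t\<^sup>2 * \<sigma>\<^sup>2 / 2 * (\<Sum>x\<in>idx p. (T x)\<^sup>2))) \<partial>noise p \<sigma>) = 1"
proof -
  let ?N = "density lborel (\<lambda>x. ennreal (normal_density 0 \<sigma> x))"
  interpret prob_space ?N using assms by (rule prob_space_normal_density)
  interpret product_sigma_finite "\<lambda>_::nat \<times> nat \<times> nat. ?N" ..
  have fin: "finite (idx p)" by (simp add: idx_def)
  have one: "(\<integral>\<^sup>+z. ennreal (exp (u * z - u\<^sup>2 * \<sigma>\<^sup>2 / 2)) \<partial>?N) = 1" for u
  proof -
    have eq: "normal_density 0 \<sigma> z * exp (u * z - u\<^sup>2 * \<sigma>\<^sup>2 / 2) = normal_density (u * \<sigma>\<^sup>2) \<sigma> z" for z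
    proof -
      have "- (z\<^sup>2) / (2 * \<sigma>\<^sup>2) + (u * z - u\<^sup>2 * \<sigma>\<^sup>2 / 2) = - (z - u * \<sigma>\<^sup>2)\<^sup>2 / (2 * \<sigma>\<^sup>2)"
        using assms by (simp add: field_simps power2_eq_square)
      then have "exp (- (z\<^sup>2) / (2 * \<sigma>\<^sup>2)) * exp (u * z - u\<^sup>2 * \<sigma>\<^sup>2 / 2) = exp (- (z - u * \<sigma>\<^sup>2)\<^sup>2 / (2 * \<sigma>\<^sup>2))"
        by (simp only: exp_add[symmetric])
      then show ?thesis by (simp add: normal_density_def)
    qed
    have "(\<integral>\<^sup>+z. ennreal (exp (u * z - u\<^sup>2 * \<sigma>\<^sup>2 / 2)) \<partial>?N)
        = (\<integral>\<^sup>+z. ennreal (normal_density 0 \<sigma> z) * ennreal (exp (u * z - u\<^sup>2 * \<sigma>\<^sup>2 / 2)) \<partial>lborel)"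
      by (subst nn_integral_density) auto
    also have "\<dots> = (\<integral>\<^sup>+z. ennreal (normal_density (u * \<sigma>\<^sup>2) \<sigma> z) \<partial>lborel)"
      by (simp add: eq flip: ennreal_mult)
    also have "\<dots> = 1"
      using assms by (subst nn_integral_eq_integral) auto
    finally show ?thesis .
  qed
  have "(\<integral>\<^sup>+Z. ennreal (exp (t * (\<Sum>x\<in>idx p. Z x * T x) - t\<^sup>2 * \<sigma>\<^sup>2 / 2 * (\<Sum>x\<in>idx p. (T x)\<^sup>2))) \<partial>noise p \<sigma>)
      = (\<integral>\<^sup>+Z. (\<Prod>x\<in>idx p. ennreal (exp ((t * T x) * Z x - (t * T x)\<^sup>2 * \<sigma>\<^sup>2 / 2))) \<partial>noise p \<sigma>)"
  proof (intro nn_integral_cong)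
    fix Z
    have "t * (\<Sum>x\<in>idx p. Z x * T x) - t\<^sup>2 * \<sigma>\<^sup>2 / 2 * (\<Sum>x\<in>idx p. (T x)\<^sup>2)
        = (\<Sum>x\<in>idx p. (t * T x) * Z x - (t * T x)\<^sup>2 * \<sigma>\<^sup>2 / 2)"
      by (simp add: sum_subtractf sum_distrib_left power_mult_distrib mult_ac)
    then show "ennreal (exp (t * (\<Sum>x\<in>idx p. Z x * T x) - t\<^sup>2 * \<sigma>\<^sup>2 / 2 * (\<Sum>x\<in>idx p. (T x)\<^sup>2)))
        = (\<Prod>x\<in>idx p. ennreal (exp ((t * T x) * Z x - (t * T x)\<^sup>2 * \<sigma>\<^sup>2 / 2)))"
      using fin by (simp add: exp_sum prod_ennreal)
  qed
  also have "\<dots> = (\<Prod>x\<in>idx p. \<integral>\<^sup>+z. ennreal (exp ((t * T x) * z - (t * T x)\<^sup>2 * \<sigma>\<^sup>2 / 2)) \<partial>?N)"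
    unfolding noise_def using fin by (intro product_nn_integral_prod) auto
  also have "\<dots> = 1" by (simp add: one)
  finally show ?thesis .
qed

text \<open>The block step singles out one mode and leaves the other two as bystanders. This
  rotation moves the mode just treated among the bystanders and brings the next one to the front, so
  that the modes are treated in the order 3, 2, 1.\<close>

lemma sum_rotate:
  "(\<Sum>c\<in>C. \<Sum>m\<in>A \<times> B. g c (fst m) (snd m)) = (\<Sum>j\<in>B. \<Sum>m\<in>C \<times> A. g (fst m) (snd m) j)"
proof -
  have "(\<Sum>c\<in>C. \<Sum>m\<in>A \<times> B. g c (fst m) (snd m)) = (\<Sum>c\<in>C. \<Sum>i\<in>A. \<Sum>j\<in>B. g c i j)"
    by (simp add: sum.cartesian_product case_prod_unfold)
  also have "\<dots> = (\<Sum>c\<in>C. \<Sum>j\<in>B. \<Sum>i\<in>A. g c i j)"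
    by (intro sum.cong refl sum.swap)
  also have "\<dots> = (\<Sum>j\<in>B. \<Sum>c\<in>C. \<Sum>i\<in>A. g c i j)"
    by (rule sum.swap)
  also have "\<dots> = (\<Sum>j\<in>B. \<Sum>m\<in>C \<times> A. g (fst m) (snd m) j)"
    by (simp add: sum.cartesian_product case_prod_unfold)
  finally show ?thesis .
qed

lemma sum_triples: "(\<Sum>x\<in>A \<times> B \<times> C. f x) = (\<Sum>i\<in>A. \<Sum>m\<in>B \<times> C. f (i, fst m, snd m))"
  by (simp add: sum.cartesian_product case_prod_unfold)

lemma lattice_sum_cmult: "lattice_sum K \<delta> I (\<lambda>y. c * h y) = c * lattice_sum K \<delta> I h"
  by (simp add: lattice_sum_def sum_distrib_left mult_ac)

text \<open>
  In these two definitions the products over the modes are nested in the order in which the modes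
  are integrated out below.
\<close>

definition expansion :: "(nat \<Rightarrow> nat) \<Rightarrow> (nat \<Rightarrow> nat \<times> nat \<Rightarrow> real) \<Rightarrow> tensor \<Rightarrow> tensor" where
  "expansion n y S = (\<lambda>(i, j, k). \<Sum>c<n 3. y 3 (k, c) * (\<Sum>b<n 2. y 2 (j, b) * (\<Sum>a<n 1. y 1 (i, a) * S (a, b, c))))"

definition compression :: "(nat \<Rightarrow> nat) \<Rightarrow> (nat \<Rightarrow> nat \<times> nat \<Rightarrow> real) \<Rightarrow> tensor \<Rightarrow> tensor" where
  "compression p v Z = (\<lambda>(a, b, c). \<Sum>i<p 1. v 1 (i, a) * (\<Sum>j<p 2. v 2 (j, b) * (\<Sum>k<p 3. v 3 (k, c) * Z (i, j, k))))"

definition triple :: "'a \<Rightarrow> 'a \<Rightarrow> 'a \<Rightarrow> nat \<Rightarrow> 'a" where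
  "triple y1 y2 y3 k = (if k = 1 then y1 else if k = 2 then y2 else y3)"

lemma triple_simps [simp]:
  "triple y1 y2 y3 1 = y1" "triple y1 y2 y3 (Suc 0) = y1" "triple y1 y2 y3 2 = y2" "triple y1 y2 y3 3 = y3"
  by (simp_all add: triple_def)

text \<open>
  The average over lattice factors of the likelihood ratio of the mean \<open>t \<sigma>\<^sup>2 T\<close> against the mean
  \<open>0\<close>, where \<open>T\<close> is the tensor built from the factors. With these lattice spacings, rounding the
  factors multiplies the mean of \<open>\<parallel>T\<parallel>\<^sup>2\<close> by a bounded constant only.
\<close>

definition evidence :: "(nat \<Rightarrow> nat) \<Rightarrow> (nat \<Rightarrow> nat) \<Rightarrow> real \<Rightarrow> real \<Rightarrow> nat \<Rightarrow> tensor \<Rightarrow> real" where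
  "evidence p n \<sigma> t K Z =
     lattice_sum K (1 / sqrt (real (card (idx n)))) (idx n) (\<lambda>S.
     lattice_sum K (1 / sqrt (real (p 1))) ({..<p 1} \<times> {..<n 1}) (\<lambda>y1.
     lattice_sum K (1 / sqrt (real (p 2))) ({..<p 2} \<times> {..<n 2}) (\<lambda>y2.
     lattice_sum K (1 / sqrt (real (p 3))) ({..<p 3} \<times> {..<n 3}) (\<lambda>y3.
       exp (t * (\<Sum>x\<in>idx p. Z x * expansion n (triple y1 y2 y3) S x)
         - t\<^sup>2 * \<sigma>\<^sup>2 / 2 * (\<Sum>x\<in>idx p. (expansion n (triple y1 y2 y3) S x)\<^sup>2))))))"

lemma measurable_noise_component:
  assumes "x \<in> idx p"
  shows "(\<lambda>Z. Z x) \<in> borel_measurable (noise p \<sigma>)"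
  unfolding noise_def
  using measurable_component_singleton[OF assms, of "\<lambda>_. density lborel (\<lambda>x. ennreal (normal_density 0 \<sigma> x))"]
  by simp

lemma evidence_properties:
  assumes "\<sigma> > 0"
  shows "evidence p n \<sigma> t K \<in> borel_measurable (noise p \<sigma>)"
    and "0 \<le> evidence p n \<sigma> t K Z"
    and "(\<integral>\<^sup>+Z. ennreal (evidence p n \<sigma> t K Z) \<partial>noise p \<sigma>) \<le> 1"
proof -
  let ?h = "\<lambda>S y1 y2 y3 Z. exp (t * (\<Sum>x\<in>idx p. Z x * expansion n (triple y1 y2 y3) S x)
         - t\<^sup>2 * \<sigma>\<^sup>2 / 2 * (\<Sum>x\<in>idx p. (expansion n (triple y1 y2 y3) S x)\<^sup>2))"
  have fin: "finite (idx n)" by (simp add: idx_def)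
  have meas: "?h S y1 y2 y3 \<in> borel_measurable (noise p \<sigma>)" for S y1 y2 y3
    by (intro borel_measurable_exp borel_measurable_diff borel_measurable_const borel_measurable_times
        borel_measurable_sum measurable_noise_component borel_measurable_exp[THEN measurable_compose[rotated]])
       auto
  have one: "(\<integral>\<^sup>+Z. ennreal (?h S y1 y2 y3 Z) \<partial>noise p \<sigma>) \<le> 1" for S y1 y2 y3
    using nn_integral_gaussian_exp[OF assms, where T = "expansion n (triple y1 y2 y3) S"] by simp
  note 1 = nn_integral_lattice_sum_le_1[OF _ meas _ one]
  note 2 = nn_integral_lattice_sum_le_1[OF _ 1(1) 1(2) 1(3)]
  note 3 = nn_integral_lattice_sum_le_1[OF _ 2(1) 2(2) 2(3)]
  note 4 = nn_integral_lattice_sum_le_1[OF fin 3(1) 3(2) 3(3)]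
  show "evidence p n \<sigma> t K \<in> borel_measurable (noise p \<sigma>)"
    and "0 \<le> evidence p n \<sigma> t K Z"
    and "(\<integral>\<^sup>+Z. ennreal (evidence p n \<sigma> t K Z) \<partial>noise p \<sigma>) \<le> 1"
    unfolding evidence_def[abs_def] by (rule 4; simp)+
qed

text \<open>Rounding modes 3, 2, 1 doubles the coefficient of the squared norm each time, from s =
  t^2 \<sigma>^2 / 2 to 8 s, and the core at most doubles it again; 16 s is the term 8 t^2
  \<sigma>^2. What remains is linear in the core with coefficients given by the compressed noise,
  and the core aligned with it produces the norm.\<close>

lemma evidence_lower_bound:
  assumes p: "0 < p 1" "0 < p 2" "0 < p 3" and n: "0 < n 1" "0 < n 2" "0 < n 3"
    and v: "contraction (p 1) (n 1) (v 1)" "contraction (p 2) (n 2) (v 2)" "contraction (p 3) (n 3) (v 3)"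
    and K: "sqrt (real (p 1)) + 1 \<le> real K" "sqrt (real (p 2)) + 1 \<le> real K" "sqrt (real (p 3)) + 1 \<le> real K"
      "sqrt (real (n 1 * n 2 * n 3)) + 1 \<le> real K"
  shows "exp (t * sqrt (\<Sum>x\<in>idx n. (compression p v Z x)\<^sup>2) - 8 * t\<^sup>2 * \<sigma>\<^sup>2
      - 6 * real (p 1 * n 1 + p 2 * n 2 + p 3 * n 3 + n 1 * n 2 * n 3)) \<le> evidence p n \<sigma> t K Z"
proof -
  define s where "s = t\<^sup>2 * \<sigma>\<^sup>2 / 2"
  have s: "0 \<le> s" by (simp add: s_def)
  have card: "card (idx n) = n 1 * n 2 * n 3" by (simp add: idx_def)
  let ?L0 = "lattice_sum K (1 / sqrt (real (card (idx n)))) (idx n)"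
  let ?L1 = "lattice_sum K (1 / sqrt (real (p 1))) ({..<p 1} \<times> {..<n 1})"
  let ?L2 = "lattice_sum K (1 / sqrt (real (p 2))) ({..<p 2} \<times> {..<n 2})"
  let ?L3 = "lattice_sum K (1 / sqrt (real (p 3))) ({..<p 3} \<times> {..<n 3})"
  define b2 where "b2 S y1 = (\<lambda>b m. \<Sum>a<n 1. y1 (snd m, a) * S (a, b, fst m))" for S :: tensor and y1 :: "nat \<times> nat \<Rightarrow> real"
  define b3 where "b3 S y1 y2 = (\<lambda>c m. \<Sum>b<n 2. y2 (snd m, b) * (\<Sum>a<n 1. y1 (fst m, a) * S (a, b, c)))"
    for S :: tensor and y1 y2 :: "nat \<times> nat \<Rightarrow> real"
  define z3 where "z3 = (\<lambda>k m. t * Z (fst m, snd m, k))"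
  define z2 where "z2 = (\<lambda>j m. \<Sum>k<p 3. v 3 (k, fst m) * (t * Z (snd m, j, k)))"
  define z1 where "z1 = (\<lambda>i m. \<Sum>j<p 2. v 2 (j, fst m) * (\<Sum>k<p 3. v 3 (k, snd m) * (t * Z (i, j, k))))"
  \<comment> \<open>The exponents before modes 3, 2, 1 and the core are averaged out. The functions
    \<open>z3\<close>, \<open>z2\<close>, \<open>z1\<close> hold the noise with the finished modes
    already compressed; \<open>b3\<close> and \<open>b2\<close> hold the core with the pending modes
    expanded.\<close>
  define E3 where "E3 S y1 y2 y3 = (\<Sum>k<p 3. \<Sum>m\<in>{..<p 1} \<times> {..<p 2}. z3 k m * (\<Sum>c<n 3. y3 (k, c) * b3 S y1 y2 c m))
      - s * (\<Sum>k<p 3. \<Sum>m\<in>{..<p 1} \<times> {..<p 2}. (\<Sum>c<n 3. y3 (k, c) * b3 S y1 y2 c m)\<^sup>2)" for S y1 y2 y3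
  define E2 where "E2 S y1 y2 = (\<Sum>j<p 2. \<Sum>m\<in>{..<n 3} \<times> {..<p 1}. z2 j m * (\<Sum>b<n 2. y2 (j, b) * b2 S y1 b m))
      - 2 * s * (\<Sum>j<p 2. \<Sum>m\<in>{..<n 3} \<times> {..<p 1}. (\<Sum>b<n 2. y2 (j, b) * b2 S y1 b m)\<^sup>2)" for S y1 y2
  define E1 where "E1 S y1 = (\<Sum>i<p 1. \<Sum>m\<in>{..<n 2} \<times> {..<n 3}. z1 i m * (\<Sum>a<n 1. y1 (i, a) * S (a, fst m, snd m)))
      - 4 * s * (\<Sum>i<p 1. \<Sum>m\<in>{..<n 2} \<times> {..<n 3}. (\<Sum>a<n 1. y1 (i, a) * S (a, fst m, snd m))\<^sup>2)" for S :: tensor and y1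
  define E0 where "E0 S = (\<Sum>x\<in>idx n. t * compression p v Z x * S x) - 8 * s * (\<Sum>x\<in>idx n. (S x)\<^sup>2)" for S
  have e3: "E3 S y1 y2 y3 = t * (\<Sum>x\<in>idx p. Z x * expansion n (triple y1 y2 y3) S x)
         - t\<^sup>2 * \<sigma>\<^sup>2 / 2 * (\<Sum>x\<in>idx p. (expansion n (triple y1 y2 y3) S x)\<^sup>2)" for S y1 y2 y3
  proof -
    have 1: "(\<Sum>x\<in>idx p. f x) = (\<Sum>k<p 3. \<Sum>m\<in>{..<p 1} \<times> {..<p 2}. f (fst m, snd m, k))" for f :: "_ \<Rightarrow> real"
      unfolding idx_def sum_triples by (rule sum_rotate)
    show ?thesis unfolding 1 E3_def z3_def b3_def s_def[symmetric]
      by (simp add: expansion_def sum_distrib_left mult.assoc)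
  qed
  have s3: "exp (- 6 * real (p 3 * n 3)) * exp (E2 S y1 y2) \<le> ?L3 (\<lambda>y3. exp (E3 S y1 y2 y3))" for S y1 y2
  proof -
    have "(\<Sum>c<n 3. \<Sum>m\<in>{..<p 1} \<times> {..<p 2}. (\<Sum>k<p 3. v 3 (k, c) * z3 k m) * b3 S y1 y2 c m)
        = (\<Sum>j<p 2. \<Sum>m\<in>{..<n 3} \<times> {..<p 1}. z2 j m * (\<Sum>b<n 2. y2 (j, b) * b2 S y1 b m))"
      unfolding b3_def b2_def z3_def z2_def
      by (rule sum_rotate[where g = "\<lambda>c i j. (\<Sum>k<p 3. v 3 (k, c) * (t * Z (i, j, k))) *
        (\<Sum>b<n 2. y2 (j, b) * (\<Sum>a<n 1. y1 (i, a) * S (a, b, c)))"])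
    moreover have "(\<Sum>c<n 3. \<Sum>m\<in>{..<p 1} \<times> {..<p 2}. (b3 S y1 y2 c m)\<^sup>2)
        = (\<Sum>j<p 2. \<Sum>m\<in>{..<n 3} \<times> {..<p 1}. (\<Sum>b<n 2. y2 (j, b) * b2 S y1 b m)\<^sup>2)"
      unfolding b3_def b2_def
      by (rule sum_rotate[where g = "\<lambda>c i j. (\<Sum>b<n 2. y2 (j, b) * (\<Sum>a<n 1. y1 (i, a) * S (a, b, c)))\<^sup>2"])
    moreover have "finite ({..<p 1} \<times> {..<p 2})" by simp
    note lattice_block_step[OF p(3) v(3) s K(3) this, of z3 "b3 S y1 y2"]
    ultimately show ?thesis unfolding E3_def E2_def by (simp flip: exp_add)
  qed
  have s2: "exp (- 6 * real (p 2 * n 2)) * exp (E1 S y1) \<le> ?L2 (\<lambda>y2. exp (E2 S y1 y2))" for S y1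
  proof -
    have "(\<Sum>b<n 2. \<Sum>m\<in>{..<n 3} \<times> {..<p 1}. (\<Sum>j<p 2. v 2 (j, b) * z2 j m) * b2 S y1 b m)
        = (\<Sum>i<p 1. \<Sum>m\<in>{..<n 2} \<times> {..<n 3}. z1 i m * (\<Sum>a<n 1. y1 (i, a) * S (a, fst m, snd m)))"
      unfolding b2_def z2_def z1_def
      by (rule sum_rotate[where g = "\<lambda>b c i. (\<Sum>j<p 2. v 2 (j, b) * (\<Sum>k<p 3. v 3 (k, c) * (t * Z (i, j, k)))) *
        (\<Sum>a<n 1. y1 (i, a) * S (a, b, c))"])
    moreover have "(\<Sum>b<n 2. \<Sum>m\<in>{..<n 3} \<times> {..<p 1}. (b2 S y1 b m)\<^sup>2)
        = (\<Sum>i<p 1. \<Sum>m\<in>{..<n 2} \<times> {..<n 3}. (\<Sum>a<n 1. y1 (i, a) * S (a, fst m, snd m))\<^sup>2)"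
      unfolding b2_def
      by (rule sum_rotate[where g = "\<lambda>b c i. (\<Sum>a<n 1. y1 (i, a) * S (a, b, c))\<^sup>2"])
    moreover have "finite ({..<n 3} \<times> {..<p 1})" "0 \<le> 2 * s" using s by auto
    note lattice_block_step[OF p(2) v(2) this(2) K(2) this(1), of z2 "b2 S y1"]
    ultimately show ?thesis unfolding E2_def E1_def by (simp flip: exp_add)
  qed
  have s1: "exp (- 6 * real (p 1 * n 1)) * exp (E0 S) \<le> ?L1 (\<lambda>y1. exp (E1 S y1))" for S
  proof -
    have "(\<Sum>a<n 1. \<Sum>m\<in>{..<n 2} \<times> {..<n 3}. (\<Sum>i<p 1. v 1 (i, a) * z1 i m) * S (a, fst m, snd m))
        = (\<Sum>x\<in>idx n. t * compression p v Z x * S x)"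
    proof -
      have "(\<Sum>i<p 1. v 1 (i, a) * z1 i m) = t * compression p v Z (a, fst m, snd m)" for a m
        unfolding compression_def z1_def prod.case by (simp add: sum_distrib_left mult_ac)
      then show ?thesis unfolding idx_def sum_triples by (simp only:)
    qed
    moreover have "(\<Sum>a<n 1. \<Sum>m\<in>{..<n 2} \<times> {..<n 3}. (S (a, fst m, snd m))\<^sup>2) = (\<Sum>x\<in>idx n. (S x)\<^sup>2)"
      unfolding idx_def sum_triples ..
    moreover have "finite ({..<n 2} \<times> {..<n 3})" "0 \<le> 4 * s" using s by auto
    note lattice_block_step[OF p(1) v(1) this(2) K(1) this(1), of z1 "\<lambda>a m. S (a, fst m, snd m)"]
    ultimately show ?thesis unfolding E1_def E0_def by (simp flip: exp_add)
  qed
  define N where "N = sqrt (\<Sum>x\<in>idx n. (compression p v Z x)\<^sup>2)"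
  \<comment> \<open>For N = 0 the division yields the zero core, and both facts below
    persist.\<close>
  define S where "S x = compression p v Z x / N" for x
  have N2: "(\<Sum>x\<in>idx n. (compression p v Z x)\<^sup>2) = N\<^sup>2" by (simp add: N_def sum_nonneg)
  have S1: "(\<Sum>x\<in>idx n. (S x)\<^sup>2) \<le> 1"
    unfolding S_def power_divide by (simp add: N2 flip: sum_divide_distrib)
  have SN: "(\<Sum>x\<in>idx n. t * compression p v Z x * S x) = t * N"
  proof -
    have "(\<Sum>x\<in>idx n. t * compression p v Z x * S x) = t * ((\<Sum>x\<in>idx n. (compression p v Z x)\<^sup>2) / N)"
      by (simp add: S_def sum_distrib_left power2_eq_square sum_divide_distrib mult.assoc)
    then show ?thesis unfolding N2 by (simp add: power2_eq_square)
  qed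
  have J: "finite (idx n)" "idx n \<noteq> {}" using n by (auto simp: idx_def)
  have s0: "exp (t * N - 16 * s - 6 * real (n 1 * n 2 * n 3)) \<le> ?L0 (\<lambda>S. exp (E0 S))"
  proof -
    have "0 \<le> 8 * s" using s by simp
    moreover have "sqrt (real (card (idx n))) + 1 \<le> real K" using K(4) by (simp add: card)
    ultimately show ?thesis
      using lattice_core_step[OF J, of "8 * s" K S "\<lambda>x. t * compression p v Z x"] S1
      unfolding SN E0_def by (simp add: card)
  qed
  let ?c = "\<lambda>k. exp (- 6 * real (p k * n k))"
  have "exp (t * N - 8 * t\<^sup>2 * \<sigma>\<^sup>2 - 6 * real (p 1 * n 1 + p 2 * n 2 + p 3 * n 3 + n 1 * n 2 * n 3))
      = ?c 3 * (?c 2 * (?c 1 * exp (t * N - 16 * s - 6 * real (n 1 * n 2 * n 3))))"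
    by (simp add: s_def algebra_simps flip: exp_add)
  also have "\<dots> \<le> ?c 3 * (?c 2 * (?c 1 * ?L0 (\<lambda>S. exp (E0 S))))"
    by (intro mult_left_mono s0) auto
  also have "\<dots> = ?c 3 * (?c 2 * ?L0 (\<lambda>S. ?c 1 * exp (E0 S)))"
    by (simp only: lattice_sum_cmult)
  also have "\<dots> \<le> ?c 3 * (?c 2 * ?L0 (\<lambda>S. ?L1 (\<lambda>y1. exp (E1 S y1))))"
    by (intro mult_left_mono lattice_sum_mono s1) auto
  also have "\<dots> = ?c 3 * ?L0 (\<lambda>S. ?L1 (\<lambda>y1. ?c 2 * exp (E1 S y1)))"
    by (simp only: lattice_sum_cmult)
  also have "\<dots> \<le> ?c 3 * ?L0 (\<lambda>S. ?L1 (\<lambda>y1. ?L2 (\<lambda>y2. exp (E2 S y1 y2))))"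
    by (intro mult_left_mono lattice_sum_mono s2) auto
  also have "\<dots> = ?L0 (\<lambda>S. ?L1 (\<lambda>y1. ?L2 (\<lambda>y2. ?c 3 * exp (E2 S y1 y2))))"
    by (simp only: lattice_sum_cmult)
  also have "\<dots> \<le> ?L0 (\<lambda>S. ?L1 (\<lambda>y1. ?L2 (\<lambda>y2. ?L3 (\<lambda>y3. exp (E3 S y1 y2 y3)))))"
    by (intro lattice_sum_mono s3)
  also have "\<dots> = evidence p n \<sigma> t K Z"
    unfolding evidence_def e3 ..
  finally show ?thesis unfolding N_def .
qed

section \<open>Singular values\<close>

definition fro_sq :: "real mat \<Rightarrow> real" where
  "fro_sq A = (\<Sum>i<dim_row A. \<Sum>j<dim_col A. (A $$ (i, j))\<^sup>2)"

lemma mult_mat_entry: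
  assumes "A \<in> carrier_mat n m" "B \<in> carrier_mat m k" "i < n" "j < k"
  shows "(A * B) $$ (i, j) = (\<Sum>l<m. A $$ (i, l) * B $$ (l, j))"
  using assms by (auto simp: scalar_prod_def lessThan_atLeast0 intro!: sum.cong)

text \<open>Over the complex numbers the polynomial splits, and a symmetric real matrix has only
  real eigenvalues. The real splitting guarantees that \<open>proots\<close> in
  \<open>singular_values\<close> catches all n eigenvalues of a Gram matrix.\<close>

lemma symmetric_char_poly_splits:
  fixes A :: "real mat"
  assumes A: "A \<in> carrier_mat n n" and sym: "transpose_mat A = A"
  obtains es where "char_poly A = (\<Prod>e\<leftarrow>es. [:- e, 1:])" "length es = n"
proof -
  let ?C = "map_mat complex_of_real A"
  have C: "?C \<in> carrier_mat n n" using A by simp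
  have symA: "A $$ (i, j) = A $$ (j, i)" if "i < n" "j < n" for i j
    using that A sym by (metis carrier_matD index_transpose_mat(1))
  obtain as where as: "char_poly ?C = (\<Prod>a\<leftarrow>as. [:- a, 1:])" and len: "length as = n"
    using char_poly_factorized[OF C] by blast
  have real: "a = of_real (Re a)" if "a \<in> set as" for a
  proof -
    have "poly (char_poly ?C) a = 0"
      using that unfolding as by (induction as) auto
    then have "eigenvalue ?C a" using eigenvalue_root_char_poly[OF C] by simp
    then obtain v where v: "v \<in> carrier_vec n" "v \<noteq> 0\<^sub>v n" "?C *\<^sub>v v = a \<cdot>\<^sub>v v"
      using A unfolding eigenvalue_def eigenvector_def by auto
    define s where "s = (\<Sum>i<n. cnj (vec_index v i) * vec_index v i)"
    have row: "(\<Sum>j<n. of_real (A $$ (i, j)) * vec_index v j) = a * vec_index v i" if "i < n" for i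
    proof -
      have "vec_index (?C *\<^sub>v v) i = a * vec_index v i" using v that by simp
      then show ?thesis using that A v(1)
        by (auto simp: scalar_prod_def lessThan_atLeast0 intro!: sum.cong)
    qed
    \<comment> \<open>The Hermitian form of \<open>A\<close> at the eigenvector \<open>v\<close>. It
      equals \<open>a * s\<close> and, by symmetry of \<open>A\<close>, its own conjugate; since
      \<open>s\<close> is real and nonzero, so is \<open>a\<close> real.\<close>
    define t where "t = (\<Sum>i<n. \<Sum>j<n. cnj (vec_index v i) * of_real (A $$ (i, j)) * vec_index v j)"
    have "t = (\<Sum>i<n. cnj (vec_index v i) * (\<Sum>j<n. of_real (A $$ (i, j)) * vec_index v j))"
      by (simp add: t_def sum_distrib_left mult.assoc)
    also have "\<dots> = a * s"
      unfolding s_def sum_distrib_left[of a] by (intro sum.cong refl) (simp add: row mult.left_commute)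
    finally have ta: "t = a * s" .
    have "cnj t = (\<Sum>i<n. \<Sum>j<n. cnj (vec_index v j) * of_real (A $$ (i, j)) * vec_index v i)"
      by (simp add: t_def mult_ac)
    also have "\<dots> = (\<Sum>j<n. \<Sum>i<n. cnj (vec_index v j) * of_real (A $$ (i, j)) * vec_index v i)"
      by (rule sum.swap)
    also have "\<dots> = t" unfolding t_def by (intro sum.cong refl) (simp add: symA)
    finally have "cnj t = t" .
    moreover have "cnj s = s" by (simp add: s_def mult.commute)
    moreover have "s \<noteq> 0"
    proof
      assume "s = 0"
      have "s = of_real (\<Sum>i<n. (cmod (vec_index v i))\<^sup>2)"
        unfolding s_def of_real_sum
        by (intro sum.cong refl) (simp only: complex_norm_square mult.commute)
      with \<open>s = 0\<close> have "(\<Sum>i<n. (cmod (vec_index v i))\<^sup>2) = 0"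
        by (metis of_real_eq_0_iff)
      then have "\<forall>i<n. vec_index v i = 0"
        by (subst (asm) sum_nonneg_eq_0_iff) auto
      then have "v = 0\<^sub>v n" using v(1) by (intro eq_vecI) auto
      with v(2) show False by simp
    qed
    ultimately have "cnj a = a" unfolding ta by simp
    then show ?thesis by (metis complex_is_Real_iff complex_cnj_cancel_iff Reals_cnj_iff of_real_Re)
  qed
  define es where "es = map Re as"
  have as_es: "as = map of_real es"
    unfolding es_def using real by (simp add: map_idI comp_def)
  interpret of_real_poly: map_poly_inj_comm_ring_hom "of_real :: real \<Rightarrow> complex" ..
  have lin: "map_poly complex_of_real (\<Prod>e\<leftarrow>xs. [:- e, 1:]) = (\<Prod>a\<leftarrow>map of_real xs. [:- a, 1:])" for xs
    by (induction xs) (simp_all add: of_real_poly.hom_mult map_poly_pCons del: mult_pCons_left)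
  have "map_poly complex_of_real (char_poly A) = char_poly ?C"
    by (rule of_real_hom.char_poly_hom[OF A, symmetric])
  also have "\<dots> = map_poly complex_of_real (\<Prod>e\<leftarrow>es. [:- e, 1:])"
    by (simp only: as as_es lin)
  finally have "char_poly A = (\<Prod>e\<leftarrow>es. [:- e, 1:])"
    by (simp add: poly_eq_iff coeff_map_poly)
  moreover have "length es = n" using len by (simp add: es_def)
  ultimately show thesis by (rule that)
qed

lemma trace_similar:
  fixes A B :: "real mat"
  assumes "P \<in> carrier_mat n n" "B \<in> carrier_mat n n" "Q \<in> carrier_mat n n"
    and QP: "Q * P = 1\<^sub>m n"
  shows "(\<Sum>i<n. (P * B * Q) $$ (i, i)) = (\<Sum>i<n. B $$ (i, i))"
proof -
  have comm: "(\<Sum>i<n. (X * Y) $$ (i, i)) = (\<Sum>i<n. (Y * X) $$ (i, i))"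
    if "X \<in> carrier_mat n n" "Y \<in> carrier_mat n n" for X Y :: "real mat"
  proof -
    have "(\<Sum>i<n. (X * Y) $$ (i, i)) = (\<Sum>i<n. \<Sum>l<n. X $$ (i, l) * Y $$ (l, i))"
      using that by (intro sum.cong refl mult_mat_entry) auto
    also have "\<dots> = (\<Sum>l<n. \<Sum>i<n. Y $$ (l, i) * X $$ (i, l))"
      by (subst sum.swap) (simp add: mult.commute)
    also have "\<dots> = (\<Sum>i<n. (Y * X) $$ (i, i))"
      using that by (intro sum.cong refl mult_mat_entry[symmetric]) auto
    finally show ?thesis .
  qed
  have "(\<Sum>i<n. (P * B * Q) $$ (i, i)) = (\<Sum>i<n. (Q * (P * B)) $$ (i, i))"
    using assms by (intro comm) auto
  also have "Q * (P * B) = B"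
    using assms by (simp add: assoc_mult_mat[symmetric, of _ n n _ n _ n])
  finally show ?thesis .
qed

text \<open>Eigenvectors of the Gram matrix give the vectors on which \<open>A\<close> stretches by
  exactly \<open>s\<close>; they serve later to bound singular values of a product of orthonormal
  factors by 1. For the sum of squares, the Schur form of the Gram matrix carries the eigenvalues on
  its diagonal, and similarity preserves the trace, which is the squared Frobenius norm.\<close>

lemma singular_values_properties:
  fixes A :: "real mat"
  assumes A: "A \<in> carrier_mat m n"
  shows "length (singular_values A) = n"
    and "sorted (rev (singular_values A))"
    and "s \<in> set (singular_values A) \<Longrightarrow>
      0 \<le> s \<and> (\<exists>v\<in>carrier_vec n. 0 < v \<bullet> v \<and> (A *\<^sub>v v) \<bullet> (A *\<^sub>v v) = s\<^sup>2 * (v \<bullet> v))"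
    and "(\<Sum>s\<leftarrow>singular_values A. s\<^sup>2) = fro_sq A"
proof -
  let ?G = "transpose_mat A * A"
  have G: "?G \<in> carrier_mat n n" using A by simp
  have "transpose_mat ?G = ?G"
    using A by (subst transpose_mult[of _ n m _ n]) auto
  then obtain es where es: "char_poly ?G = (\<Prod>e\<leftarrow>es. [:- e, 1:])" and len: "length es = n"
    using symmetric_char_poly_splits[OF G] by blast
  have roots: "proots (char_poly ?G) = mset es"
  proof -
    have "(\<Prod>e\<leftarrow>xs. [:- e, 1:]) \<noteq> 0" for xs :: "real list"
      by (auto simp: prod_list_zero_iff)
    then have "proots (\<Prod>e\<leftarrow>xs. [:- e, 1:]) = mset xs" for xs :: "real list"
      by (induction xs) (simp_all add: proots_mult del: mult_pCons_left)
    then show ?thesis by (simp only: es)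
  qed
  have sv: "mset (singular_values A) = image_mset sqrt (mset es)"
    by (simp add: singular_values_def roots)
  then show l: "length (singular_values A) = n"
    by (metis len size_image_mset size_mset)
  show "sorted (rev (singular_values A))"
    by (simp add: singular_values_def)
  have ev: "0 \<le> e \<and> (\<exists>v\<in>carrier_vec n. 0 < v \<bullet> v \<and> (A *\<^sub>v v) \<bullet> (A *\<^sub>v v) = e * (v \<bullet> v))" if "e \<in> set es" for e
  proof -
    have "poly (char_poly ?G) e = 0"
      using that unfolding es by (induction es) auto
    then have "eigenvalue ?G e" using eigenvalue_root_char_poly[OF G] by simp
    then obtain v where v: "v \<in> carrier_vec n" "v \<noteq> 0\<^sub>v n" "?G *\<^sub>v v = e \<cdot>\<^sub>v v"
      using G unfolding eigenvalue_def eigenvector_def by auto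
    have "e * (v \<bullet> v) = v \<bullet> (?G *\<^sub>v v)" using v by simp
    also have "?G *\<^sub>v v = transpose_mat A *\<^sub>v (A *\<^sub>v v)"
      using A v(1) by (intro assoc_mult_mat_vec[of _ n m _ n]) auto
    also have "v \<bullet> (transpose_mat A *\<^sub>v (A *\<^sub>v v)) = (transpose_mat A *\<^sub>v (A *\<^sub>v v)) \<bullet> v"
      using A v(1) by (intro comm_scalar_prod[of _ n]) auto
    also have "\<dots> = (A *\<^sub>v v) \<bullet> (A *\<^sub>v v)"
      using A v(1) by (subst transpose_vec_mult_scalar[of A m n, symmetric]) auto
    finally have eq: "e * (v \<bullet> v) = (A *\<^sub>v v) \<bullet> (A *\<^sub>v v)" .
    moreover have "0 \<le> (A *\<^sub>v v) \<bullet> (A *\<^sub>v v)" by (simp add: scalar_prod_def sum_nonneg)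
    moreover have pos: "0 < v \<bullet> v"
    proof -
      have "v \<bullet> v \<ge> 0" by (simp add: scalar_prod_def sum_nonneg)
      moreover have "v \<bullet> v \<noteq> 0"
      proof
        assume "v \<bullet> v = 0"
        then have "\<forall>i<n. vec_index v i * vec_index v i = 0"
          using v(1) by (auto simp: scalar_prod_def sum_nonneg_eq_0_iff)
        then have "v = 0\<^sub>v n" using v(1) by (intro eq_vecI) auto
        with v(2) show False by simp
      qed
      ultimately show ?thesis by simp
    qed
    ultimately have "0 \<le> e" by (simp add: zero_le_mult_iff flip: eq)
    with v(1) pos eq show ?thesis by auto
  qed
  show "0 \<le> s \<and> (\<exists>v\<in>carrier_vec n. 0 < v \<bullet> v \<and> (A *\<^sub>v v) \<bullet> (A *\<^sub>v v) = s\<^sup>2 * (v \<bullet> v))"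
    if "s \<in> set (singular_values A)"
  proof -
    have "s \<in># image_mset sqrt (mset es)" using that by (metis sv set_mset_mset)
    then obtain e where "e \<in> set es" "s = sqrt e" by auto
    with ev[of e] show ?thesis by auto
  qed
  obtain B P Q where schur: "schur_decomposition ?G es = (B, P, Q)"
    by (cases "schur_decomposition ?G es") auto
  from schur_decomposition[OF G es schur]
  have wit: "similar_mat_wit ?G B P Q" and diag: "diag_mat B = es" by auto
  note w = similar_mat_witD2[OF G wit]
  have dB: "dim_row B = n" using w by auto
  have "(\<Sum>s\<leftarrow>singular_values A. s\<^sup>2) = (\<Sum>s\<in>#image_mset sqrt (mset es). s\<^sup>2)"
    by (metis sv mset_map sum_mset_sum_list)
  also have "\<dots> = (\<Sum>e\<in>#mset es. e)"
  proof -
    have "image_mset (\<lambda>e. (sqrt e)\<^sup>2) (mset es) = image_mset (\<lambda>e. e) (mset es)"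
      by (intro image_mset_cong) (use ev in auto)
    then show ?thesis by (simp add: image_mset.compositionality comp_def)
  qed
  also have "\<dots> = sum_list es" by (simp flip: sum_mset_sum_list)
  also have "\<dots> = (\<Sum>i<n. B $$ (i, i))"
    unfolding diag[symmetric] diag_mat_def dB by (simp add: interv_sum_list_conv_sum_set_nat lessThan_atLeast0)
  also have "\<dots> = (\<Sum>i<n. ?G $$ (i, i))"
    using trace_similar[OF w(6,5,7,2)] by (simp only: w(3)[symmetric])
  also have "\<dots> = (\<Sum>i<n. \<Sum>l<m. (A $$ (l, i))\<^sup>2)"
    using A by (intro sum.cong refl, subst mult_mat_entry[of _ n m _ n]) (auto simp: power2_eq_square)
  also have "\<dots> = fro_sq A"
    unfolding fro_sq_def using A by (subst sum.swap) simp
  finally show "(\<Sum>s\<leftarrow>singular_values A. s\<^sup>2) = fro_sq A" .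
qed

lemma sing_val_antimono:
  assumes "A \<in> carrier_mat m n" "1 \<le> i" "i \<le> j" "j \<le> n"
  shows "sing_val j A \<le> sing_val i A"
proof -
  note p = singular_values_properties[OF assms(1)]
  have "sorted_wrt (\<ge>) (singular_values A)"
    using p(2) by (simp add: sorted_wrt_rev)
  then show ?thesis
    unfolding sing_val_def using assms p(1)
    by (cases "i = j") (auto intro!: sorted_wrt_nth_less[where P = "(\<ge>)"])
qed

section \<open>Compression and expansion of tensors\<close>

text \<open>Zero columns are allowed so that n vectors, dependent or not, always yield a family of
  exactly n columns.\<close>

definition orthogonal_columns :: "nat \<Rightarrow> nat \<Rightarrow> (nat \<times> nat \<Rightarrow> real) \<Rightarrow> bool" where
  "orthogonal_columns p n v \<longleftrightarrow>
     (\<forall>a<n. \<forall>b<n. a \<noteq> b \<longrightarrow> (\<Sum>i<p. v (i, a) * v (i, b)) = 0) \<and>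
     (\<forall>a<n. (\<Sum>i<p. (v (i, a))\<^sup>2) = 1 \<or> (\<forall>i<p. v (i, a) = 0))"

text \<open>Invariance under v v^T, which for orthogonal columns of norm 1 or 0 is the orthogonal
  projection onto their span. Stating membership in the span as an equation lets expansion cancel
  compression by rewriting.\<close>

definition fixed_by :: "nat \<Rightarrow> nat \<Rightarrow> (nat \<times> nat \<Rightarrow> real) \<Rightarrow> (nat \<Rightarrow> real) \<Rightarrow> bool" where
  "fixed_by p n v f \<longleftrightarrow> (\<forall>i<p. f i = (\<Sum>a<n. v (i, a) * (\<Sum>j<p. v (j, a) * f j)))"

lemma fixed_byI:
  "(\<And>i. i < p \<Longrightarrow> (\<Sum>a<n. v (i, a) * (\<Sum>j<p. v (j, a) * f j)) = f i) \<Longrightarrow> fixed_by p n v f"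
  by (simp add: fixed_by_def)

lemma fixed_byD:
  "fixed_by p n v f \<Longrightarrow> i < p \<Longrightarrow> (\<Sum>a<n. v (i, a) * (\<Sum>j<p. v (j, a) * f j)) = f i"
  unfolding fixed_by_def by (rule sym, erule allE[of _ i], erule mp)

lemma fixed_by_sum:
  assumes "\<And>m. m \<in> M \<Longrightarrow> fixed_by p n v (g m)"
  shows "fixed_by p n v (\<lambda>i. \<Sum>m\<in>M. g m i * w m)"
  unfolding fixed_by_def
proof (intro allI impI)
  fix i assume i: "i < p"
  have "(\<Sum>m\<in>M. g m i * w m) = (\<Sum>m\<in>M. (\<Sum>a<n. v (i, a) * (\<Sum>j<p. v (j, a) * g m j)) * w m)"
  proof (rule sum.cong[OF refl])
    fix m assume "m \<in> M"
    from assms[OF this] i have "g m i = (\<Sum>a<n. v (i, a) * (\<Sum>j<p. v (j, a) * g m j))"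
      unfolding fixed_by_def by blast
    then show "g m i * w m = (\<Sum>a<n. v (i, a) * (\<Sum>j<p. v (j, a) * g m j)) * w m"
      by (rule arg_cong[where f = "\<lambda>x. x * w m"])
  qed
  also have "\<dots> = (\<Sum>m\<in>M. \<Sum>a<n. \<Sum>j<p. v (i, a) * (v (j, a) * g m j * w m))"
    by (simp add: sum_distrib_left sum_distrib_right mult.assoc)
  also have "\<dots> = (\<Sum>a<n. \<Sum>m\<in>M. \<Sum>j<p. v (i, a) * (v (j, a) * g m j * w m))"
    by (rule sum.swap)
  also have "\<dots> = (\<Sum>a<n. \<Sum>j<p. \<Sum>m\<in>M. v (i, a) * (v (j, a) * g m j * w m))"
    by (intro sum.cong refl sum.swap)
  also have "\<dots> = (\<Sum>a<n. v (i, a) * (\<Sum>j<p. v (j, a) * (\<Sum>m\<in>M. g m j * w m)))"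
    by (simp add: sum_distrib_left mult.assoc)
  finally show "(\<Sum>m\<in>M. g m i * w m) = (\<Sum>a<n. v (i, a) * (\<Sum>j<p. v (j, a) * (\<Sum>m\<in>M. g m j * w m)))" .
qed

lemma fixed_by_diff:
  assumes "fixed_by p n v f" "fixed_by p n v g"
  shows "fixed_by p n v (\<lambda>i. f i - g i)"
  by (intro fixed_byI) (simp add: right_diff_distrib sum_subtractf fixed_byD[OF assms(1)] fixed_byD[OF assms(2)])

lemma fixed_by_cong:
  assumes "fixed_by p n v f" "\<And>i. i < p \<Longrightarrow> f i = g i"
  shows "fixed_by p n v g"
proof (rule fixed_byI)
  fix i assume "i < p"
  have "(\<Sum>j<p. v (j, a) * g j) = (\<Sum>j<p. v (j, a) * f j)" for a
    by (intro sum.cong refl) (simp add: assms(2))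
  then show "(\<Sum>a<n. v (i, a) * (\<Sum>j<p. v (j, a) * g j)) = g i"
    using fixed_byD[OF assms(1) \<open>i < p\<close>] assms(2)[OF \<open>i < p\<close>] by (simp del: mult_cancel_left)
qed

text \<open>Gram-Schmidt, with a zero column whenever the next vector is already in the
  span.\<close>

lemma orthogonal_columns_exist:
  "\<exists>v. orthogonal_columns p n v \<and> (\<forall>l<n. fixed_by p n v (u l))"
proof (induction n)
  case 0
  then show ?case by (simp add: orthogonal_columns_def)
next
  case (Suc n)
  then obtain v where v: "orthogonal_columns p n v" and fix_u: "\<And>l. l < n \<Longrightarrow> fixed_by p n v (u l)" by blast
  define c where "c a = (\<Sum>j<p. v (j, a) * u n j)" for a
  define r where "r i = u n i - (\<Sum>a<n. v (i, a) * c a)" for i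
  define \<rho> where "\<rho> = (\<Sum>i<p. (r i)\<^sup>2)"
  \<comment> \<open>If the residual vanishes, division by 0 makes this the zero column.\<close>
  define w where "w i = r i / sqrt \<rho>" for i
  define v' where "v' x = (if snd x = n then w (fst x) else v x)" for x
  have rho: "0 \<le> \<rho>" by (simp add: \<rho>_def sum_nonneg)
  have r_orth: "(\<Sum>i<p. v (i, b) * r i) = 0" if "b < n" for b
  proof -
    have "(\<Sum>i<p. v (i, b) * (\<Sum>a<n. v (i, a) * c a)) = (\<Sum>a<n. (\<Sum>i<p. v (i, b) * v (i, a)) * c a)"
      unfolding sum_distrib_left sum_distrib_right by (subst sum.swap) (simp add: mult.assoc)
    also have "\<dots> = (\<Sum>a<n. if a = b then (\<Sum>i<p. v (i, b) * v (i, b)) * c b else 0)"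
      using v that unfolding orthogonal_columns_def by (intro sum.cong refl) auto
    also have "\<dots> = (\<Sum>i<p. v (i, b) * v (i, b)) * c b" using that by simp
    also have "\<dots> = c b"
      using v that unfolding orthogonal_columns_def c_def by (auto simp: power2_eq_square)
    finally show ?thesis
      by (simp add: r_def right_diff_distrib sum_subtractf c_def)
  qed
  have w_orth: "(\<Sum>i<p. v (i, b) * w i) = 0" if "b < n" for b
    using r_orth[OF that] by (simp add: w_def flip: sum_divide_distrib)
  have w_norm: "(\<Sum>i<p. (w i)\<^sup>2) = 1 \<or> (\<forall>i<p. w i = 0)"
  proof (cases "\<rho> = 0")
    case False
    then show ?thesis using rho by (simp add: w_def power_divide \<rho>_def[symmetric] flip: sum_divide_distrib)
  qed (simp add: w_def)
  have orth: "orthogonal_columns p (Suc n) v'"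
    using v w_orth w_norm unfolding orthogonal_columns_def v'_def
    by (auto simp: less_Suc_eq mult.commute)
  have split: "(\<Sum>a<Suc n. v' (i, a) * (\<Sum>j<p. v' (j, a) * f j))
      = (\<Sum>a<n. v (i, a) * (\<Sum>j<p. v (j, a) * f j)) + w i * (\<Sum>j<p. w j * f j)" for i f
    by (simp add: v'_def)
  \<comment> \<open>The new column is orthogonal to the old span, so the vectors treated earlier
    stay fixed.\<close>
  have wu: "(\<Sum>j<p. w j * (\<Sum>a<n. v (j, a) * d a)) = 0" for d
  proof -
    have "(\<Sum>j<p. w j * (\<Sum>a<n. v (j, a) * d a)) = (\<Sum>a<n. (\<Sum>j<p. v (j, a) * w j) * d a)"
      unfolding sum_distrib_left sum_distrib_right by (subst sum.swap) (simp add: mult_ac)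
    then show ?thesis by (simp add: w_orth)
  qed
  have "fixed_by p (Suc n) v' (u l)" if "l < Suc n" for l
    unfolding fixed_by_def split
  proof (intro allI impI)
    fix i assume i: "i < p"
    show "u l i = (\<Sum>a<n. v (i, a) * (\<Sum>j<p. v (j, a) * u l j)) + w i * (\<Sum>j<p. w j * u l j)"
    proof (cases "l = n")
      case False
      then have "l < n" using that by simp
      note fx = fixed_byD[OF fix_u[OF this]]
      have "(\<Sum>j<p. w j * (\<Sum>a<n. v (j, a) * (\<Sum>j<p. v (j, a) * u l j))) = (\<Sum>j<p. w j * u l j)"
        using fx by (intro sum.cong refl arg_cong2[where f = "(*)"]) auto
      then have "(\<Sum>j<p. w j * u l j) = 0" by (simp only: wu)
      then show ?thesis by (simp add: fx[OF i])
    next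
      case True
      have "(\<Sum>j<p. w j * u n j) = (\<Sum>j<p. w j * r j) + (\<Sum>j<p. w j * (\<Sum>a<n. v (j, a) * c a))"
        unfolding r_def by (simp add: algebra_simps sum.distrib sum_subtractf)
      also have "\<dots> = (\<Sum>j<p. (r j)\<^sup>2) / sqrt \<rho>"
        unfolding wu by (simp add: w_def power2_eq_square sum_divide_distrib)
      finally have "w i * (\<Sum>j<p. w j * u n j) = r i * (\<rho> / (sqrt \<rho> * sqrt \<rho>))"
        by (simp add: w_def \<rho>_def)
      also have "\<dots> = r i"
      proof (cases "\<rho> = 0")
        case True
        then have "r i = 0" using i unfolding \<rho>_def by (simp add: sum_nonneg_eq_0_iff)
        then show ?thesis by simp
      qed (use rho in simp)
      finally show ?thesis unfolding True by (simp add: r_def c_def)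
    qed
  qed
  with orth show ?case by blast
qed

lemma orthogonal_columns_contraction:
  assumes "orthogonal_columns p n v"
  shows "contraction p n v"
  unfolding contraction_def
proof
  fix b
  have "(\<Sum>i<p. (\<Sum>a<n. v (i, a) * b a)\<^sup>2) = (\<Sum>i<p. \<Sum>a<n. \<Sum>a'<n. b a * b a' * (v (i, a) * v (i, a')))"
    by (simp add: power2_eq_square sum_product mult_ac)
  also have "\<dots> = (\<Sum>a<n. \<Sum>i<p. \<Sum>a'<n. b a * b a' * (v (i, a) * v (i, a')))"
    by (rule sum.swap)
  also have "\<dots> = (\<Sum>a<n. \<Sum>a'<n. \<Sum>i<p. b a * b a' * (v (i, a) * v (i, a')))"
    by (intro sum.cong refl sum.swap)
  also have "\<dots> = (\<Sum>a<n. \<Sum>a'<n. b a * b a' * (\<Sum>i<p. v (i, a) * v (i, a')))"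
    by (simp add: sum_distrib_left)
  also have "\<dots> = (\<Sum>a<n. \<Sum>a'<n. if a' = a then (b a)\<^sup>2 * (\<Sum>i<p. (v (i, a))\<^sup>2) else 0)"
    using assms unfolding orthogonal_columns_def by (intro sum.cong refl) (auto simp: power2_eq_square)
  also have "\<dots> = (\<Sum>a<n. (b a)\<^sup>2 * (\<Sum>i<p. (v (i, a))\<^sup>2))" by simp
  also have "\<dots> \<le> (\<Sum>a<n. (b a)\<^sup>2 * 1)"
    using assms unfolding orthogonal_columns_def by (intro sum_mono mult_left_mono) auto
  finally show "(\<Sum>i<p. (\<Sum>a<n. v (i, a) * b a)\<^sup>2) \<le> (\<Sum>a<n. (b a)\<^sup>2)" by simp
qed

lemma residual_expand:
  fixes v :: "nat \<times> nat \<Rightarrow> real"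
  shows "(\<Sum>i<p. (y i - (\<Sum>a<n. v (i, a) * g a))\<^sup>2)
    = (\<Sum>i<p. (y i)\<^sup>2) - 2 * (\<Sum>a<n. (\<Sum>i<p. v (i, a) * y i) * g a) + (\<Sum>i<p. (\<Sum>a<n. v (i, a) * g a)\<^sup>2)"
proof -
  have "(\<Sum>i<p. y i * (\<Sum>a<n. v (i, a) * g a)) = (\<Sum>a<n. (\<Sum>i<p. v (i, a) * y i) * g a)"
    using sum_adjoint[where p = p and M = "{()}" and z = "\<lambda>i _. y i" and n = n and v = v and b = "\<lambda>a _. g a"] by simp
  then show ?thesis
    by (simp add: power2_diff sum.distrib sum_subtractf mult.assoc flip: sum_distrib_left)
qed

text \<open>A matrix and its transpose have the same operator norm: expand the squared norm of y - v
  v^T y, which is nonnegative, and bound that of v v^T y by that of v^T y.\<close>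

lemma contraction_transpose:
  assumes "contraction p n v"
  shows "(\<Sum>a<n. (\<Sum>i<p. v (i, a) * y i)\<^sup>2) \<le> (\<Sum>i<p. (y i)\<^sup>2)"
proof -
  define g where "g a = (\<Sum>i<p. v (i, a) * y i)" for a
  have "0 \<le> (\<Sum>i<p. (y i - (\<Sum>a<n. v (i, a) * g a))\<^sup>2)" by (simp add: sum_nonneg)
  also have "\<dots> = (\<Sum>i<p. (y i)\<^sup>2) - 2 * (\<Sum>a<n. (g a)\<^sup>2) + (\<Sum>i<p. (\<Sum>a<n. v (i, a) * g a)\<^sup>2)"
    unfolding residual_expand g_def[symmetric] by (simp add: power2_eq_square)
  also have "(\<Sum>i<p. (\<Sum>a<n. v (i, a) * g a)\<^sup>2) \<le> (\<Sum>a<n. (g a)\<^sup>2)"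
    using assms unfolding contraction_def by blast
  finally show ?thesis by (simp add: g_def)
qed

lemma contraction_transpose_sum:
  assumes "contraction p n v"
  shows "(\<Sum>a<n. \<Sum>m\<in>M. (\<Sum>i<p. v (i, a) * y i m)\<^sup>2) \<le> (\<Sum>i<p. \<Sum>m\<in>M. (y i m)\<^sup>2)"
  by (subst (1 2) sum.swap) (intro sum_mono contraction_transpose[OF assms])

lemma compression_norm_le:
  assumes v: "contraction (p 1) (n 1) (v 1)" "contraction (p 2) (n 2) (v 2)" "contraction (p 3) (n 3) (v 3)"
  shows "(\<Sum>x\<in>idx n. (compression p v W x)\<^sup>2) \<le> (\<Sum>x\<in>idx p. (W x)\<^sup>2)"
proof -
  define H where "H i j c = (\<Sum>k<p 3. v 3 (k, c) * W (i, j, k))" for i j c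
  define G where "G i b c = (\<Sum>j<p 2. v 2 (j, b) * H i j c)" for i b c
  have "(\<Sum>x\<in>idx n. (compression p v W x)\<^sup>2)
      = (\<Sum>a<n 1. \<Sum>m\<in>{..<n 2} \<times> {..<n 3}. (\<Sum>i<p 1. v 1 (i, a) * G i (fst m) (snd m))\<^sup>2)"
    unfolding idx_def sum_triples compression_def G_def H_def prod.case ..
  also have "\<dots> \<le> (\<Sum>i<p 1. \<Sum>m\<in>{..<n 2} \<times> {..<n 3}. (G i (fst m) (snd m))\<^sup>2)"
    by (rule contraction_transpose_sum[OF v(1)])
  also have "\<dots> = (\<Sum>b<n 2. \<Sum>m\<in>{..<n 3} \<times> {..<p 1}. (\<Sum>j<p 2. v 2 (j, b) * H (snd m) j (fst m))\<^sup>2)"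
    unfolding G_def by (rule sum_rotate[symmetric, where g = "\<lambda>b c i. (\<Sum>j<p 2. v 2 (j, b) * H i j c)\<^sup>2"])
  also have "\<dots> \<le> (\<Sum>j<p 2. \<Sum>m\<in>{..<n 3} \<times> {..<p 1}. (H (snd m) j (fst m))\<^sup>2)"
    by (rule contraction_transpose_sum[OF v(2)])
  also have "\<dots> = (\<Sum>c<n 3. \<Sum>m\<in>{..<p 1} \<times> {..<p 2}. (\<Sum>k<p 3. v 3 (k, c) * W (fst m, snd m, k))\<^sup>2)"
    unfolding H_def by (rule sum_rotate[symmetric, where g = "\<lambda>c i j. (\<Sum>k<p 3. v 3 (k, c) * W (i, j, k))\<^sup>2"])
  also have "\<dots> \<le> (\<Sum>k<p 3. \<Sum>m\<in>{..<p 1} \<times> {..<p 2}. (W (fst m, snd m, k))\<^sup>2)"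
    by (rule contraction_transpose_sum[OF v(3)])
  also have "\<dots> = (\<Sum>x\<in>idx p. (W x)\<^sup>2)"
    unfolding idx_def sum_triples by (rule sum_rotate[symmetric, where g = "\<lambda>i j k. (W (i, j, k))\<^sup>2"])
  finally show ?thesis .
qed

lemma expansion_adjoint:
  "(\<Sum>x\<in>idx p. Z x * expansion n v S x) = (\<Sum>x\<in>idx n. compression p v Z x * S x)"
proof -
  let ?z3 = "\<lambda>k m. Z (fst m, snd m, k)"
  let ?z2 = "\<lambda>j m. \<Sum>k<p 3. v 3 (k, fst m) * Z (snd m, j, k)"
  let ?z1 = "\<lambda>i m. \<Sum>j<p 2. v 2 (j, fst m) * (\<Sum>k<p 3. v 3 (k, snd m) * Z (i, j, k))"
  let ?b1 = "\<lambda>a m. S (a, fst m, snd m)"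
  let ?b2 = "\<lambda>b m. \<Sum>a<n 1. v 1 (snd m, a) * S (a, b, fst m)"
  let ?b3 = "\<lambda>c m. \<Sum>b<n 2. v 2 (snd m, b) * (\<Sum>a<n 1. v 1 (fst m, a) * S (a, b, c))"
  have "(\<Sum>x\<in>idx p. Z x * expansion n v S x)
      = (\<Sum>i<p 1. \<Sum>m\<in>{..<p 2} \<times> {..<p 3}. Z (i, fst m, snd m) * (\<Sum>c<n 3. v 3 (snd m, c) *
          (\<Sum>b<n 2. v 2 (fst m, b) * (\<Sum>a<n 1. v 1 (i, a) * S (a, b, c)))))"
    unfolding idx_def sum_triples expansion_def prod.case ..
  also have "\<dots> = (\<Sum>k<p 3. \<Sum>m\<in>{..<p 1} \<times> {..<p 2}. ?z3 k m * (\<Sum>c<n 3. v 3 (k, c) * ?b3 c m))"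
    by (rule sum_rotate[where g = "\<lambda>i j k. Z (i, j, k) * (\<Sum>c<n 3. v 3 (k, c) *
          (\<Sum>b<n 2. v 2 (j, b) * (\<Sum>a<n 1. v 1 (i, a) * S (a, b, c))))"])
  also have "\<dots> = (\<Sum>c<n 3. \<Sum>m\<in>{..<p 1} \<times> {..<p 2}. (\<Sum>k<p 3. v 3 (k, c) * ?z3 k m) * ?b3 c m)"
    by (rule sum_adjoint)
  also have "\<dots> = (\<Sum>j<p 2. \<Sum>m\<in>{..<n 3} \<times> {..<p 1}. ?z2 j m * (\<Sum>b<n 2. v 2 (j, b) * ?b2 b m))"
    by (rule sum_rotate[where g = "\<lambda>c i j. (\<Sum>k<p 3. v 3 (k, c) * Z (i, j, k)) *
        (\<Sum>b<n 2. v 2 (j, b) * (\<Sum>a<n 1. v 1 (i, a) * S (a, b, c)))"])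
  also have "\<dots> = (\<Sum>b<n 2. \<Sum>m\<in>{..<n 3} \<times> {..<p 1}. (\<Sum>j<p 2. v 2 (j, b) * ?z2 j m) * ?b2 b m)"
    by (rule sum_adjoint)
  also have "\<dots> = (\<Sum>i<p 1. \<Sum>m\<in>{..<n 2} \<times> {..<n 3}. ?z1 i m * (\<Sum>a<n 1. v 1 (i, a) * ?b1 a m))"
    by (rule sum_rotate[where g = "\<lambda>b c i. (\<Sum>j<p 2. v 2 (j, b) * (\<Sum>k<p 3. v 3 (k, c) * Z (i, j, k))) *
        (\<Sum>a<n 1. v 1 (i, a) * S (a, b, c))"])
  also have "\<dots> = (\<Sum>a<n 1. \<Sum>m\<in>{..<n 2} \<times> {..<n 3}. (\<Sum>i<p 1. v 1 (i, a) * ?z1 i m) * ?b1 a m)"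
    by (rule sum_adjoint)
  also have "\<dots> = (\<Sum>x\<in>idx n. compression p v Z x * S x)"
    unfolding idx_def sum_triples compression_def prod.case ..
  finally show ?thesis .
qed

text \<open>Membership in the tensor product of the three spans, stated fibre by fibre so that it
  can be checked on columns of matricizations.\<close>

definition mode_fixed :: "(nat \<Rightarrow> nat) \<Rightarrow> (nat \<Rightarrow> nat) \<Rightarrow> (nat \<Rightarrow> nat \<times> nat \<Rightarrow> real) \<Rightarrow> tensor \<Rightarrow> bool" where
  "mode_fixed p n v W \<longleftrightarrow>
     (\<forall>j<p 2. \<forall>k<p 3. fixed_by (p 1) (n 1) (v 1) (\<lambda>i. W (i, j, k))) \<and>
     (\<forall>i<p 1. \<forall>k<p 3. fixed_by (p 2) (n 2) (v 2) (\<lambda>j. W (i, j, k))) \<and>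
     (\<forall>i<p 1. \<forall>j<p 2. fixed_by (p 3) (n 3) (v 3) (\<lambda>k. W (i, j, k)))"

lemma expansion_compression:
  assumes W: "mode_fixed p n v W" and x: "x \<in> idx p"
  shows "expansion n v (compression p v W) x = W x"
proof -
  obtain i j k where ijk: "x = (i, j, k)" "i < p 1" "j < p 2" "k < p 3"
    using x by (auto simp: idx_def)
  define H where "H c i j = (\<Sum>k<p 3. v 3 (k, c) * W (i, j, k))" for c i j
  define G where "G b c i = (\<Sum>j<p 2. v 2 (j, b) * H c i j)" for b c i
  have H1: "fixed_by (p 1) (n 1) (v 1) (\<lambda>i. H c i j)" if "j < p 2" for c j
    unfolding H_def mult.commute[of "v 3 _"] using W that unfolding mode_fixed_def by (intro fixed_by_sum) auto
  have H2: "fixed_by (p 2) (n 2) (v 2) (H c i)" for c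
    unfolding H_def mult.commute[of "v 3 _"] using W ijk unfolding mode_fixed_def by (intro fixed_by_sum) auto
  have G1: "fixed_by (p 1) (n 1) (v 1) (G b c)" for b c
    unfolding G_def mult.commute[of "v 2 _"] by (intro fixed_by_sum H1) simp
  have "expansion n v (compression p v W) x
      = (\<Sum>c<n 3. v 3 (k, c) * (\<Sum>b<n 2. v 2 (j, b) * (\<Sum>a<n 1. v 1 (i, a) * (\<Sum>i<p 1. v 1 (i, a) * G b c i))))"
    by (simp add: ijk(1) expansion_def compression_def G_def H_def)
  also have "\<dots> = (\<Sum>c<n 3. v 3 (k, c) * (\<Sum>b<n 2. v 2 (j, b) * G b c i))"
    by (simp only: fixed_byD[OF G1 ijk(2)])
  also have "\<dots> = (\<Sum>c<n 3. v 3 (k, c) * H c i j)"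
    unfolding G_def by (simp only: fixed_byD[OF H2 ijk(3)])
  also have "\<dots> = W (i, j, k)"
  proof -
    have "fixed_by (p 3) (n 3) (v 3) (\<lambda>k. W (i, j, k))" using W ijk unfolding mode_fixed_def by blast
    from fixed_byD[OF this ijk(4)] show ?thesis by (simp only: H_def)
  qed
  finally show ?thesis by (simp add: ijk(1))
qed

section \<open>Orthonormal factors and least squares\<close>

definition orthonormal_columns :: "nat \<Rightarrow> nat \<Rightarrow> (nat \<times> nat \<Rightarrow> real) \<Rightarrow> bool" where
  "orthonormal_columns p n v \<longleftrightarrow> (\<forall>a<n. \<forall>b<n. (\<Sum>i<p. v (i, a) * v (i, b)) = (if a = b then 1 else 0))"

lemma orthonormal_columns_contraction:
  assumes "orthonormal_columns p n v"
  shows "contraction p n v"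
  using assms unfolding orthonormal_columns_def
  by (intro orthogonal_columns_contraction) (auto simp: orthogonal_columns_def power2_eq_square)

lemma orthonormal_columns_left_inverse:
  assumes "orthonormal_columns p n v" "a < n"
  shows "(\<Sum>i<p. v (i, a) * (\<Sum>b<n. v (i, b) * f b)) = f a"
proof -
  have "(\<Sum>i<p. v (i, a) * (\<Sum>b<n. v (i, b) * f b)) = (\<Sum>b<n. (\<Sum>i<p. v (i, a) * v (i, b)) * f b)"
    unfolding sum_distrib_left sum_distrib_right by (subst sum.swap) (simp add: mult.assoc)
  also have "\<dots> = (\<Sum>b<n. if b = a then f a else 0)"
    using assms unfolding orthonormal_columns_def by (intro sum.cong refl) auto
  finally show ?thesis using assms(2) by simp
qed

lemma orthonormal_columns_isometry:
  assumes "orthonormal_columns p n v"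
  shows "(\<Sum>i<p. (\<Sum>a<n. v (i, a) * f a)\<^sup>2) = (\<Sum>a<n. (f a)\<^sup>2)"
proof -
  have "(\<Sum>i<p. (\<Sum>a<n. v (i, a) * f a) * (\<Sum>a<n. v (i, a) * f a))
      = (\<Sum>a<n. (\<Sum>i<p. v (i, a) * (\<Sum>a<n. v (i, a) * f a)) * f a)"
    using sum_adjoint[where p = p and M = "{()}" and z = "\<lambda>i _. \<Sum>a<n. v (i, a) * f a" and n = n and v = v and b = "\<lambda>a _. f a"] by simp
  then show ?thesis using orthonormal_columns_left_inverse[OF assms] by (simp add: power2_eq_square)
qed

lemma orthonormal_columns_fixed_by:
  assumes "orthonormal_columns p n v"
  shows "fixed_by p n v (\<lambda>i. \<Sum>a<n. v (i, a) * w a)"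
  by (rule fixed_byI) (simp add: orthonormal_columns_left_inverse[OF assms])

lemma compression_expansion:
  assumes "orthonormal_columns (p 1) (n 1) (v 1)" "orthonormal_columns (p 2) (n 2) (v 2)" "orthonormal_columns (p 3) (n 3) (v 3)"
    and "x \<in> idx n"
  shows "compression p v (expansion n v S) x = S x"
proof -
  obtain a b c where "x = (a, b, c)" "a < n 1" "b < n 2" "c < n 3"
    using assms(4) by (auto simp: idx_def)
  then show ?thesis
    by (simp add: compression_def expansion_def orthonormal_columns_left_inverse[OF assms(1)]
        orthonormal_columns_left_inverse[OF assms(2)] orthonormal_columns_left_inverse[OF assms(3)]
        orthonormal_columns_left_inverse[OF assms(1), unfolded One_nat_def])
qed

text \<open>Pythagoras. The best core for given factors is the compression of \<open>Y\<close>, so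
  maximizing the norm of the compression is the same as minimizing the residual; this connects the
  maximum likelihood problem with the residual comparison.\<close>

lemma residual_eq:
  assumes "orthonormal_columns (p 1) (n 1) (v 1)" "orthonormal_columns (p 2) (n 2) (v 2)" "orthonormal_columns (p 3) (n 3) (v 3)"
  shows "(\<Sum>x\<in>idx p. (Y x - expansion n v S x)\<^sup>2)
    = (\<Sum>x\<in>idx p. (Y x)\<^sup>2) - (\<Sum>x\<in>idx n. (compression p v Y x)\<^sup>2) + (\<Sum>x\<in>idx n. (S x - compression p v Y x)\<^sup>2)"
proof -
  have "(\<Sum>x\<in>idx p. (expansion n v S x)\<^sup>2) = (\<Sum>x\<in>idx n. (S x)\<^sup>2)"
    using expansion_adjoint[where Z = "expansion n v S" and n = n and v = v and S = S and p = p] compression_expansion[OF assms]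
    by (simp add: power2_eq_square)
  moreover have "(\<Sum>x\<in>idx p. Y x * expansion n v S x) = (\<Sum>x\<in>idx n. compression p v Y x * S x)"
    by (rule expansion_adjoint)
  ultimately show ?thesis
    by (simp add: power2_diff sum.distrib sum_subtractf mult.assoc mult.commute[of "S _"] flip: sum_distrib_left)
qed

text \<open>Since \<open>W\<close> is the expansion of its compression, the inner product moves to
  the compressed side, where Cauchy-Schwarz applies. All dependence on the direction of
  \<open>W\<close> inside the subspaces disappears; only the subspaces remain.\<close>

lemma inner_le_compression:
  assumes W: "mode_fixed p n v W"
    and v: "contraction (p 1) (n 1) (v 1)" "contraction (p 2) (n 2) (v 2)" "contraction (p 3) (n 3) (v 3)"
  shows "(\<Sum>x\<in>idx p. Z x * W x) \<le> sqrt (\<Sum>x\<in>idx n. (compression p v Z x)\<^sup>2) * sqrt (\<Sum>x\<in>idx p. (W x)\<^sup>2)"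
proof -
  have "(\<Sum>x\<in>idx p. Z x * W x) = (\<Sum>x\<in>idx p. Z x * expansion n v (compression p v W) x)"
    using expansion_compression[OF W] by simp
  also have "\<dots> = (\<Sum>x\<in>idx n. compression p v Z x * compression p v W x)"
    by (rule expansion_adjoint)
  also have "\<dots> \<le> L2_set (compression p v Z) (idx n) * L2_set (compression p v W) (idx n)"
    by (rule order_trans[OF _ L2_set_mult_ineq]) (intro sum_mono, simp add: abs_mult[symmetric])
  also have "\<dots> \<le> L2_set (compression p v Z) (idx n) * L2_set W (idx p)"
    unfolding L2_set_def using compression_norm_le[OF v, of W] by (intro mult_left_mono) (auto simp: sum_nonneg)
  finally show ?thesis by (simp add: L2_set_def)
qed

section \<open>Subspaces and matricizations\<close>

declare One_nat_def [simp del]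

definition entries :: "real mat \<Rightarrow> nat \<times> nat \<Rightarrow> real" where
  "entries A x = A $$ x"

lemma stiefelD:
  assumes "U \<in> stiefel p r"
  shows "dim_row U = p" "dim_col U = r" "U \<in> carrier_mat p r" "orthonormal_columns p r (entries U)"
proof -
  show U: "U \<in> carrier_mat p r" and "dim_row U = p" "dim_col U = r"
    using assms by (auto simp: stiefel_def)
  show "orthonormal_columns p r (entries U)"
    unfolding orthonormal_columns_def
  proof (intro allI impI)
    fix a b assume ab: "a < r" "b < r"
    have "(\<Sum>i<p. entries U (i, a) * entries U (i, b)) = (transpose_mat U * U) $$ (a, b)"
      using U ab by (subst mult_mat_entry[of _ r p _ r]) (auto simp: entries_def)
    also have "transpose_mat U * U = 1\<^sub>m r" using assms by (simp add: stiefel_def)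
    finally show "(\<Sum>i<p. entries U (i, a) * entries U (i, b)) = (if a = b then 1 else 0)"
      using ab by simp
  qed
qed

lemma sum_comm:
  fixes f :: "'a \<Rightarrow> real"
  shows "(\<Sum>x\<in>A. f x * (\<Sum>y\<in>B. g y * h x y)) = (\<Sum>y\<in>B. g y * (\<Sum>x\<in>A. f x * h x y))"
  unfolding sum_distrib_left by (subst sum.swap) (simp add: mult.left_commute)

text \<open>\<open>compression\<close> sums over mode 1 outermost, matching the order of rounding,
  whereas \<open>tucker_prod\<close> applies mode 3 last.\<close>

lemma compression_alt:
  "compression p v Y (a, b, c) =
     (\<Sum>k<p 3. v 3 (k, c) * (\<Sum>j<p 2. v 2 (j, b) * (\<Sum>i<p 1. v 1 (i, a) * Y (i, j, k))))"
proof -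
  have "compression p v Y (a, b, c) = (\<Sum>i<p 1. v 1 (i, a) * (\<Sum>k<p 3. v 3 (k, c) * (\<Sum>j<p 2. v 2 (j, b) * Y (i, j, k))))"
    unfolding compression_def prod.case by (subst sum_comm[of "\<lambda>j. v 2 (j, b)"]) (rule refl)
  also have "\<dots> = (\<Sum>k<p 3. v 3 (k, c) * (\<Sum>i<p 1. v 1 (i, a) * (\<Sum>j<p 2. v 2 (j, b) * Y (i, j, k))))"
    by (rule sum_comm)
  also have "\<dots> = (\<Sum>k<p 3. v 3 (k, c) * (\<Sum>j<p 2. v 2 (j, b) * (\<Sum>i<p 1. v 1 (i, a) * Y (i, j, k))))"
    by (subst sum_comm[of "\<lambda>i. v 1 (i, a)"]) (rule refl)
  finally show ?thesis .
qed

lemma tucker_prod_eq_expansion: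
  assumes "dim_col (V 1) = n 1" "dim_col (V 2) = n 2" "dim_col (V 3) = n 3"
  shows "tucker_prod S V = expansion n (\<lambda>k. entries (V k)) S"
  by (rule ext) (auto simp: tucker_prod_def mode_prod1_def mode_prod2_def mode_prod3_def expansion_def entries_def assms)

lemma tucker_prod_transpose:
  assumes V: "V 1 \<in> carrier_mat (p 1) (n 1)" "V 2 \<in> carrier_mat (p 2) (n 2)" "V 3 \<in> carrier_mat (p 3) (n 3)"
    and x: "x \<in> idx n"
  shows "tucker_prod Y (\<lambda>k. transpose_mat (V k)) x = compression p (\<lambda>k. entries (V k)) Y x"
proof -
  obtain a b c where "x = (a, b, c)" "a < n 1" "b < n 2" "c < n 3" using x by (auto simp: idx_def)
  then show ?thesis using V
    by (simp add: compression_alt tucker_prod_def mode_prod1_def mode_prod2_def mode_prod3_def entries_def)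
qed

text \<open>Projecting all modes is compressing and then expanding, so the maximum likelihood tensor
  is a Tucker product whose core is the compression of \<open>Y\<close>.\<close>

lemma tucker_prod_proj:
  assumes V: "V 1 \<in> carrier_mat (p 1) (n 1)" "V 2 \<in> carrier_mat (p 2) (n 2)" "V 3 \<in> carrier_mat (p 3) (n 3)"
    and x: "x \<in> idx p"
  shows "tucker_prod Y (\<lambda>k. proj (V k)) x
    = expansion n (\<lambda>k. entries (V k)) (compression p (\<lambda>k. entries (V k)) Y) x"
proof -
  obtain i j k where ijk: "x = (i, j, k)" "i < p 1" "j < p 2" "k < p 3" using x by (auto simp: idx_def)
  let ?v = "\<lambda>k. entries (V k)"
  have P: "(\<Sum>l<dim_col (proj A). proj A $$ (i, l) * f l) = (\<Sum>a<r. entries A (i, a) * (\<Sum>l<q. entries A (l, a) * f l))"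
    if "A \<in> carrier_mat q r" "i < q" for A q r i f
  proof -
    have "(\<Sum>l<dim_col (proj A). proj A $$ (i, l) * f l) = (\<Sum>l<q. \<Sum>a<r. entries A (i, a) * (entries A (l, a) * f l))"
      using that unfolding proj_def
      by (intro sum.cong) (auto simp: mult_mat_entry[of _ q r _ q] entries_def sum_distrib_right mult.assoc
          simp del: index_mult_mat(1))
    also have "\<dots> = (\<Sum>a<r. entries A (i, a) * (\<Sum>l<q. entries A (l, a) * f l))"
      by (subst sum.swap) (simp add: sum_distrib_left)
    finally show ?thesis .
  qed
  let ?Y1 = "\<lambda>a j k. \<Sum>i<p 1. ?v 1 (i, a) * Y (i, j, k)"
  have "tucker_prod Y (\<lambda>k. proj (V k)) x = (\<Sum>c<n 3. ?v 3 (k, c) * (\<Sum>k<p 3. ?v 3 (k, c) *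
      (\<Sum>b<n 2. ?v 2 (j, b) * (\<Sum>j<p 2. ?v 2 (j, b) * (\<Sum>a<n 1. ?v 1 (i, a) * ?Y1 a j k)))))"
    unfolding tucker_prod_def mode_prod1_def mode_prod2_def mode_prod3_def ijk(1) prod.case
      P[OF V(1) ijk(2)] P[OF V(2) ijk(3)] P[OF V(3) ijk(4)] ..
  also have "\<dots> = (\<Sum>c<n 3. ?v 3 (k, c) * (\<Sum>k<p 3. ?v 3 (k, c) *
      (\<Sum>b<n 2. ?v 2 (j, b) * (\<Sum>a<n 1. ?v 1 (i, a) * (\<Sum>j<p 2. ?v 2 (j, b) * ?Y1 a j k)))))"
    by (intro sum.cong refl arg_cong2[where f = "(*)"] sum_comm)
  also have "\<dots> = (\<Sum>c<n 3. ?v 3 (k, c) * (\<Sum>b<n 2. ?v 2 (j, b) *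
      (\<Sum>k<p 3. ?v 3 (k, c) * (\<Sum>a<n 1. ?v 1 (i, a) * (\<Sum>j<p 2. ?v 2 (j, b) * ?Y1 a j k)))))"
    by (intro sum.cong refl arg_cong2[where f = "(*)"] sum_comm)
  also have "\<dots> = (\<Sum>c<n 3. ?v 3 (k, c) * (\<Sum>b<n 2. ?v 2 (j, b) *
      (\<Sum>a<n 1. ?v 1 (i, a) * (\<Sum>k<p 3. ?v 3 (k, c) * (\<Sum>j<p 2. ?v 2 (j, b) * ?Y1 a j k)))))"
    by (intro sum.cong refl arg_cong2[where f = "(*)"] sum_comm)
  also have "\<dots> = expansion n ?v (compression p ?v Y) x"
    unfolding ijk(1) expansion_def prod.case compression_alt ..
  finally show ?thesis .
qed

text \<open>Allows a core to be made extensional, hence a member of \<open>tensors\<close>.\<close>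

lemma expansion_restrict: "expansion n v (restrict S (idx n)) = expansion n v S"
  by (rule ext) (auto simp: expansion_def idx_def intro!: sum.cong)

lemma sum_div_mod:
  fixes f :: "nat \<Rightarrow> nat \<Rightarrow> real"
  shows "(\<Sum>c<m * n. f (c div n) (c mod n)) = (\<Sum>j<m. \<Sum>k<n. f j k)"
proof -
  have "(\<Sum>(j, k)\<in>{..<m} \<times> {..<n}. f j k) = (\<Sum>c<m * n. f (c div n) (c mod n))"
  proof (rule sum.reindex_bij_witness[where i = "\<lambda>c. (c div n, c mod n)" and j = "\<lambda>(j, k). j * n + k"])
    fix c assume "c \<in> {..<m * n}"
    then have c: "c < m * n" by simp
    then have "0 < n" by (cases n) auto
    with c show "(c div n, c mod n) \<in> {..<m} \<times> {..<n}"
      by (auto simp: less_mult_imp_div_less)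
    show "(case (c div n, c mod n) of (j, k) \<Rightarrow> j * n + k) = c" by simp
  next
    fix x assume "x \<in> {..<m} \<times> {..<n}"
    then obtain j k where x: "x = (j, k)" "j < m" "k < n" by auto
    have "j * n + k < Suc j * n" using x by simp
    also have "\<dots> \<le> m * n" using x by (intro mult_le_mono1) simp
    finally show "(case x of (j, k) \<Rightarrow> j * n + k) \<in> {..<m * n}" using x by simp
    show "((case x of (j, k) \<Rightarrow> j * n + k) div n, (case x of (j, k) \<Rightarrow> j * n + k) mod n) = x"
      using x by simp
    show "f ((case x of (j, k) \<Rightarrow> j * n + k) div n) ((case x of (j, k) \<Rightarrow> j * n + k) mod n) = (case x of (j, k) \<Rightarrow> f j k)"
      using x by simp
  qed
  then show ?thesis by (simp add: sum.cartesian_product)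
qed

lemma dim_row_matricize: "m \<in> {1, 2, 3} \<Longrightarrow> dim_row (matricize p m X) = p m"
  by (auto simp: matricize_def)

lemma dim_col_matricize: "dim_col (matricize p m X) = dim_col (matricize p m Y)"
  by (auto simp: matricize_def)

lemma matricize_diff:
  assumes "m \<in> {1, 2, 3}" "i < p m" "c < dim_col (matricize p m X)"
  shows "matricize p m (\<lambda>x. X x - Y x) $$ (i, c) = matricize p m X $$ (i, c) - matricize p m Y $$ (i, c)"
  using assms by (auto simp: matricize_def)

lemma sum_matricize_sq:
  assumes "m \<in> {1, 2, 3}"
  shows "(\<Sum>i<p m. \<Sum>c<dim_col (matricize p m X). (matricize p m X $$ (i, c))\<^sup>2) = (\<Sum>x\<in>idx p. (X x)\<^sup>2)"
proof -
  have idx: "(\<Sum>x\<in>idx p. (X x)\<^sup>2) = (\<Sum>i<p 1. \<Sum>j<p 2. \<Sum>k<p 3. (X (i, j, k))\<^sup>2)"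
    unfolding idx_def by (simp add: sum.cartesian_product case_prod_unfold)
  consider "m = 1" | "m = 2" | "m = 3" using assms by auto
  then show ?thesis
  proof cases
    case 1
    then show ?thesis unfolding idx
      by (simp add: matricize_def sum_div_mod[where f = "\<lambda>j k. (X (_, j, k))\<^sup>2"])
  next
    case 2
    have "(\<Sum>j<p 2. \<Sum>k<p 3. \<Sum>i<p 1. (X (i, j, k))\<^sup>2) = (\<Sum>j<p 2. \<Sum>i<p 1. \<Sum>k<p 3. (X (i, j, k))\<^sup>2)"
      by (intro sum.cong refl sum.swap)
    also have "\<dots> = (\<Sum>i<p 1. \<Sum>j<p 2. \<Sum>k<p 3. (X (i, j, k))\<^sup>2)" by (rule sum.swap)
    finally show ?thesis unfolding idx using 2
      by (simp add: matricize_def sum_div_mod[where f = "\<lambda>k i. (X (i, _, k))\<^sup>2"])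
  next
    case 3
    have "(\<Sum>k<p 3. \<Sum>i<p 1. \<Sum>j<p 2. (X (i, j, k))\<^sup>2) = (\<Sum>i<p 1. \<Sum>k<p 3. \<Sum>j<p 2. (X (i, j, k))\<^sup>2)"
      by (rule sum.swap)
    also have "\<dots> = (\<Sum>i<p 1. \<Sum>j<p 2. \<Sum>k<p 3. (X (i, j, k))\<^sup>2)" by (intro sum.cong refl sum.swap)
    finally show ?thesis unfolding idx using 3
      by (simp add: matricize_def sum_div_mod[where f = "\<lambda>i j. (X (i, j, _))\<^sup>2"])
  qed
qed

lemma mode_fixedI:
  assumes "\<And>m c. m \<in> {1, 2, 3} \<Longrightarrow> c < dim_col (matricize p m X) \<Longrightarrow>
    fixed_by (p m) (n m) (v m) (\<lambda>i. matricize p m X $$ (i, c))"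
  shows "mode_fixed p n v X"
proof -
  have lt: "j * n + k < m * n" if "j < m" "k < n" for j k m n :: nat
  proof -
    have "j * n + k < Suc j * n" using that by simp
    also have "\<dots> \<le> m * n" using that by (intro mult_le_mono1) simp
    finally show ?thesis .
  qed
  show ?thesis unfolding mode_fixed_def
  proof (intro conjI allI impI)
    fix j k assume jk: "j < p 2" "k < p 3"
    show "fixed_by (p 1) (n 1) (v 1) (\<lambda>i. X (i, j, k))"
      using jk lt[OF jk] by (intro fixed_by_cong[OF assms[of 1 "j * p 3 + k"]]) (auto simp: matricize_def)
  next
    fix i k assume ik: "i < p 1" "k < p 3"
    show "fixed_by (p 2) (n 2) (v 2) (\<lambda>j. X (i, j, k))"
      using ik lt[OF ik(2) ik(1)] by (intro fixed_by_cong[OF assms[of 2 "k * p 1 + i"]]) (auto simp: matricize_def)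
  next
    fix i j assume ij: "i < p 1" "j < p 2"
    show "fixed_by (p 3) (n 3) (v 3) (\<lambda>k. X (i, j, k))"
      using ij lt[OF ij] by (intro fixed_by_cong[OF assms[of 3 "i * p 2 + j"]]) (auto simp: matricize_def)
  qed
qed

text \<open>Later only the column space matters, so the coefficients are left existential. The
  tensor \<open>X\<close> serves to name the number of columns, which depends on \<open>p\<close>
  and \<open>m\<close> alone.\<close>

lemma matricize_expansion:
  assumes "m \<in> {1, 2, 3}"
  shows "\<exists>G. \<forall>i<p m. \<forall>c<dim_col (matricize p m X).
    matricize p m (expansion n v S) $$ (i, c) = (\<Sum>a<n m. v m (i, a) * G a c)"
proof -
  consider "m = 1" | "m = 2" | "m = 3" using assms by auto
  then show ?thesis
  proof cases
    case 1
    have "expansion n v S (i, j, k) = (\<Sum>a<n 1. v 1 (i, a) * (\<Sum>c<n 3. v 3 (k, c) * (\<Sum>b<n 2. v 2 (j, b) * S (a, b, c))))" for i j k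
    proof -
      have "expansion n v S (i, j, k) = (\<Sum>c<n 3. v 3 (k, c) * (\<Sum>a<n 1. v 1 (i, a) * (\<Sum>b<n 2. v 2 (j, b) * S (a, b, c))))"
        unfolding expansion_def prod.case by (intro sum.cong refl arg_cong2[where f = "(*)"] sum_comm)
      also have "\<dots> = (\<Sum>a<n 1. v 1 (i, a) * (\<Sum>c<n 3. v 3 (k, c) * (\<Sum>b<n 2. v 2 (j, b) * S (a, b, c))))"
        by (rule sum_comm)
      finally show ?thesis .
    qed
    then show ?thesis using 1
      by (intro exI[of _ "\<lambda>a l. \<Sum>c<n 3. v 3 (l mod p 3, c) * (\<Sum>b<n 2. v 2 (l div p 3, b) * S (a, b, c))"])
        (auto simp: matricize_def)
  next
    case 2
    have "expansion n v S (i, j, k) = (\<Sum>b<n 2. v 2 (j, b) * (\<Sum>c<n 3. v 3 (k, c) * (\<Sum>a<n 1. v 1 (i, a) * S (a, b, c))))" for i j k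
      unfolding expansion_def prod.case by (rule sum_comm)
    then show ?thesis using 2
      by (intro exI[of _ "\<lambda>b l. \<Sum>c<n 3. v 3 (l div p 1, c) * (\<Sum>a<n 1. v 1 (l mod p 1, a) * S (a, b, c))"])
        (auto simp: matricize_def)
  next
    case 3
    then show ?thesis
      by (intro exI[of _ "\<lambda>c l. \<Sum>b<n 2. v 2 (l mod p 2, b) * (\<Sum>a<n 1. v 1 (l div p 2, a) * S (a, b, c))"])
        (auto simp: matricize_def expansion_def)
  qed
qed

lemma left_singular_matrixD:
  assumes "is_left_singular_matrix A U" and r: "r = mat_rank A" and A: "A \<in> carrier_mat p q"
  obtains w where "orthonormal_columns q r w" "orthonormal_columns p r (entries U)" "r \<le> q"
    "\<And>i c. i < p \<Longrightarrow> c < q \<Longrightarrow> A $$ (i, c) = (\<Sum>a<r. entries U (i, a) * (sing_val (a + 1) A * w (c, a)))"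
proof -
  have dims: "dim_row A = p" "dim_col A = q" using A by auto
  from assms obtain V where U: "U \<in> stiefel p r" and V: "V \<in> stiefel q r"
    and eq: "A = U * mat_diag r (\<lambda>i. sing_val (i + 1) A) * transpose_mat V"
    unfolding is_left_singular_matrix_def dims by auto
  note U = stiefelD[OF U] and V = stiefelD[OF V]
  let ?d = "\<lambda>i. sing_val (i + 1) A"
  have UD: "U * mat_diag r ?d \<in> carrier_mat p r" using U(3) by (rule mult_carrier_mat) simp
  \<comment> \<open>Keeps the first r singular values inside the list of length q.\<close>
  have "r \<le> q" unfolding r mat_rank_def dims by (rule vec_space.rank_le_nc[OF A])
  moreover have "A $$ (i, c) = (\<Sum>a<r. entries U (i, a) * (?d a * entries V (c, a)))" if "i < p" "c < q" for i c
  proof -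
    have "A $$ (i, c) = (U * mat_diag r ?d * transpose_mat V) $$ (i, c)" using eq by metis
    also have "\<dots> = (\<Sum>a<r. (U * mat_diag r ?d) $$ (i, a) * transpose_mat V $$ (a, c))"
      using UD V(3) that by (intro mult_mat_entry) auto
    also have "\<dots> = (\<Sum>a<r. entries U (i, a) * (?d a * entries V (c, a)))"
      using U(3) V(3) that by (intro sum.cong refl) (auto simp: mat_diag_mult_right entries_def)
    finally show ?thesis .
  qed
  ultimately show thesis using that U(4) V(4) by blast
qed

section \<open>From Frobenius error to subspace error\<close>

lemma factored_norm:
  assumes w: "orthonormal_columns q r w" and u: "orthonormal_columns p r u"
  shows "(\<Sum>i<p. \<Sum>c<q. (\<Sum>a<r. u (i, a) * (d a * w (c, a)))\<^sup>2) = (\<Sum>a<r. (d a)\<^sup>2)"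
proof -
  have "(\<Sum>i<p. \<Sum>c<q. (\<Sum>a<r. u (i, a) * (d a * w (c, a)))\<^sup>2) = (\<Sum>i<p. \<Sum>c<q. (\<Sum>a<r. w (c, a) * (u (i, a) * d a))\<^sup>2)"
    by (simp add: mult_ac)
  also have "\<dots> = (\<Sum>i<p. \<Sum>a<r. (u (i, a) * d a)\<^sup>2)"
    by (simp only: orthonormal_columns_isometry[OF w])
  also have "\<dots> = (\<Sum>a<r. (\<Sum>i<p. u (i, a) * u (i, a)) * (d a)\<^sup>2)"
    by (subst sum.swap) (simp add: sum_distrib_left power2_eq_square mult_ac)
  also have "\<dots> = (\<Sum>a<r. (d a)\<^sup>2)" using u by (simp add: orthonormal_columns_def)
  finally show ?thesis .
qed

text \<open>The left side is the squared distance from \<open>y\<close> to the span of the columns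
  of \<open>v\<close>.\<close>

lemma residual_ge:
  assumes "orthonormal_columns p n v"
  shows "(\<Sum>i<p. (y i)\<^sup>2) - (\<Sum>a<n. (\<Sum>i<p. v (i, a) * y i)\<^sup>2) \<le> (\<Sum>i<p. (y i - (\<Sum>a<n. v (i, a) * g a))\<^sup>2)"
proof -
  define h where "h a = (\<Sum>i<p. v (i, a) * y i)" for a
  have "0 \<le> (\<Sum>a<n. (g a - h a)\<^sup>2)" by (simp add: sum_nonneg)
  also have "\<dots> = (\<Sum>a<n. (g a)\<^sup>2) - 2 * (\<Sum>a<n. h a * g a) + (\<Sum>a<n. (h a)\<^sup>2)"
    by (simp add: power2_diff sum.distrib sum_subtractf sum_distrib_left mult_ac)
  finally show ?thesis
    unfolding residual_expand orthonormal_columns_isometry[OF assms] h_def[symmetric] by simp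
qed

text \<open>The columns of B lie in the span of \<open>v\<close>, so the distance from B to A is at
  least the norm of the part of A off that span. With A in singular form the square of this norm is
  the sum of d_a^2 (1 - |v^T u_a|^2), and \<open>lam\<close> bounds each d_a from below. The
  parenthesis on the left is the squared Frobenius norm of sin \<Theta>.\<close>

lemma subspace_distance_bound:
  assumes w: "orthonormal_columns q r w" and u: "orthonormal_columns p r u" and v: "orthonormal_columns p r v"
    and A: "\<And>i c. i < p \<Longrightarrow> c < q \<Longrightarrow> A i c = (\<Sum>a<r. u (i, a) * (d a * w (c, a)))"
    and B: "\<And>i c. i < p \<Longrightarrow> c < q \<Longrightarrow> B i c = (\<Sum>a<r. v (i, a) * g a c)"
    and lam: "0 \<le> lam" "\<And>a. a < r \<Longrightarrow> lam \<le> d a"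
  shows "lam\<^sup>2 * (real r - (\<Sum>b<r. \<Sum>a<r. (\<Sum>i<p. v (i, b) * u (i, a))\<^sup>2)) \<le> (\<Sum>i<p. \<Sum>c<q. (B i c - A i c)\<^sup>2)"
proof -
  define t where "t b a = (\<Sum>i<p. v (i, b) * u (i, a))" for b a
  have vA: "(\<Sum>i<p. v (i, b) * A i c) = (\<Sum>a<r. w (c, a) * (d a * t b a))" if "c < q" for b c
  proof -
    have "(\<Sum>i<p. v (i, b) * A i c) = (\<Sum>i<p. v (i, b) * (\<Sum>a<r. (d a * w (c, a)) * u (i, a)))"
      using A that by (simp add: mult_ac)
    also have "\<dots> = (\<Sum>a<r. (d a * w (c, a)) * (\<Sum>i<p. v (i, b) * u (i, a)))"
      by (rule sum_comm)
    finally show ?thesis by (simp add: t_def mult_ac)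
  qed
  have t1: "(\<Sum>b<r. (t b a)\<^sup>2) \<le> 1" if "a < r" for a
  proof -
    have "(\<Sum>b<r. (t b a)\<^sup>2) \<le> (\<Sum>i<p. (u (i, a))\<^sup>2)"
      unfolding t_def by (rule contraction_transpose[OF orthonormal_columns_contraction[OF v]])
    also have "\<dots> = 1" using u that by (simp add: orthonormal_columns_def power2_eq_square)
    finally show ?thesis .
  qed
  have "lam\<^sup>2 * (real r - (\<Sum>b<r. \<Sum>a<r. (t b a)\<^sup>2)) = (\<Sum>a<r. lam\<^sup>2 * (1 - (\<Sum>b<r. (t b a)\<^sup>2)))"
    by (subst sum.swap) (simp add: sum_subtractf flip: sum_distrib_left)
  \<comment> \<open>Replacing \<open>lam\<close> by \<open>d a\<close> is monotone because
    \<open>t1\<close> makes each remaining factor nonnegative.\<close>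
  also have "\<dots> \<le> (\<Sum>a<r. (d a)\<^sup>2 * (1 - (\<Sum>b<r. (t b a)\<^sup>2)))"
    using lam t1 by (intro sum_mono mult_right_mono power_mono) auto
  also have "\<dots> = (\<Sum>a<r. (d a)\<^sup>2) - (\<Sum>a<r. \<Sum>b<r. (d a * t b a)\<^sup>2)"
    by (simp add: right_diff_distrib sum_subtractf sum_distrib_left power_mult_distrib)
  also have "(\<Sum>a<r. \<Sum>b<r. (d a * t b a)\<^sup>2) = (\<Sum>b<r. \<Sum>a<r. (d a * t b a)\<^sup>2)" by (rule sum.swap)
  also have "\<dots> = (\<Sum>b<r. \<Sum>c<q. (\<Sum>a<r. w (c, a) * (d a * t b a))\<^sup>2)"
    by (simp only: orthonormal_columns_isometry[OF w])
  also have "\<dots> = (\<Sum>b<r. \<Sum>c<q. (\<Sum>i<p. v (i, b) * A i c)\<^sup>2)"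
    by (intro sum.cong refl) (simp add: vA)
  also have "\<dots> = (\<Sum>c<q. \<Sum>b<r. (\<Sum>i<p. v (i, b) * A i c)\<^sup>2)" by (rule sum.swap)
  also have "(\<Sum>a<r. (d a)\<^sup>2) = (\<Sum>c<q. \<Sum>i<p. (A i c)\<^sup>2)"
    using factored_norm[OF w u, of d] A by (subst sum.swap) simp
  also have "(\<Sum>c<q. \<Sum>i<p. (A i c)\<^sup>2) - (\<Sum>c<q. \<Sum>b<r. (\<Sum>i<p. v (i, b) * A i c)\<^sup>2)
      = (\<Sum>c<q. (\<Sum>i<p. (A i c)\<^sup>2) - (\<Sum>b<r. (\<Sum>i<p. v (i, b) * A i c)\<^sup>2))"
    by (simp add: sum_subtractf)
  also have "\<dots> \<le> (\<Sum>c<q. \<Sum>i<p. (A i c - (\<Sum>a<r. v (i, a) * g a c))\<^sup>2)"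
    by (intro sum_mono residual_ge[OF v])
  also have "\<dots> = (\<Sum>c<q. \<Sum>i<p. (B i c - A i c)\<^sup>2)"
    using B by (intro sum.cong refl) (simp add: power2_commute)
  also have "\<dots> = (\<Sum>i<p. \<Sum>c<q. (B i c - A i c)\<^sup>2)" by (rule sum.swap)
  finally show ?thesis by (simp only: t_def)
qed

text \<open>For q \<le> 2 the function x^(q/2) is concave. Its tangent at the mean m, here an
  instance of Young's inequality, sums to r m^(q/2). This reduces every q to the Frobenius case q =
  2.\<close>

lemma power_mean_le:
  fixes x :: "nat \<Rightarrow> real"
  assumes q: "1 \<le> q" "q \<le> 2" and r: "0 < r" and x: "\<And>i. i \<in> {1..r} \<Longrightarrow> 0 \<le> x i"
  shows "real r powr (- 1 / q) * (\<Sum>i = 1..r. x i powr (q / 2)) powr (1 / q) \<le> sqrt ((\<Sum>i = 1..r. x i) / real r)"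
proof -
  define m where "m = (\<Sum>i = 1..r. x i) / real r"
  have m0: "0 \<le> m" using x by (auto simp: m_def intro!: divide_nonneg_nonneg sum_nonneg)
  show ?thesis
  proof (cases "m = 0")
    case True
    then have "(\<Sum>i = 1..r. x i) = 0" using r by (simp add: m_def)
    then have "\<forall>i\<in>{1..r}. x i = 0" using x by (subst (asm) sum_nonneg_eq_0_iff) auto
    then have "(\<Sum>i = 1..r. x i powr (q / 2)) = 0" by simp
    then show ?thesis using m0 by (simp add: m_def)
  next
    case False
    then have m: "0 < m" using m0 by simp
    have "x i powr (q / 2) \<le> m powr (q / 2) * ((1 - q / 2) + q / 2 * (x i / m))" if "i \<in> {1..r}" for i
    proof (cases "x i = 0")
      case True
      then show ?thesis using q by simp
    next
      case False
      then have xi: "0 < x i" using x[OF that] by simp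
      have "1 powr (1 - q / 2) * (x i / m) powr (q / 2) \<le> (1 - q / 2) * 1 + q / 2 * (x i / m)"
        using q m xi by (intro Youngs_inequality_0) auto
      then have "m powr (q / 2) * (x i / m) powr (q / 2) \<le> m powr (q / 2) * ((1 - q / 2) + q / 2 * (x i / m))"
        by (intro mult_left_mono) auto
      moreover have "m powr (q / 2) * (x i / m) powr (q / 2) = x i powr (q / 2)"
        using m xi by (simp flip: powr_mult)
      ultimately show ?thesis by simp
    qed
    then have "(\<Sum>i = 1..r. x i powr (q / 2)) \<le> (\<Sum>i = 1..r. m powr (q / 2) * ((1 - q / 2) + q / 2 * (x i / m)))"
      by (rule sum_mono)
    also have "\<dots> = m powr (q / 2) * (real r * (1 - q / 2) + q / 2 * ((\<Sum>i = 1..r. x i) / m))"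
    proof -
      have "(\<Sum>i = 1..r. (1 - q / 2) + q / 2 * (x i / m)) = real r * (1 - q / 2) + q / 2 * ((\<Sum>i = 1..r. x i) / m)"
        unfolding sum.distrib sum_distrib_left[symmetric] sum_divide_distrib[symmetric] by simp
      then show ?thesis by (simp only: sum_distrib_left[symmetric])
    qed
    also have "(\<Sum>i = 1..r. x i) / m = real r"
      using False r by (simp add: m_def)
    also have "m powr (q / 2) * (real r * (1 - q / 2) + q / 2 * real r) = real r * m powr (q / 2)"
      by (simp add: algebra_simps)
    finally have "(\<Sum>i = 1..r. x i powr (q / 2)) powr (1 / q) \<le> (real r * m powr (q / 2)) powr (1 / q)"
      using q by (intro powr_mono2) (auto intro: sum_nonneg)
    also have "\<dots> = real r powr (1 / q) * m powr (1 / 2)"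
      using q by (simp add: powr_mult powr_powr)
    finally have "real r powr (- 1 / q) * (\<Sum>i = 1..r. x i powr (q / 2)) powr (1 / q)
        \<le> real r powr (- 1 / q) * (real r powr (1 / q) * m powr (1 / 2))"
      by (intro mult_left_mono) auto
    also have "\<dots> = m powr (1 / 2)" using r by (simp add: powr_minus field_simps)
    also have "\<dots> = sqrt m" using m0 by (simp add: powr_half_sqrt)
    finally show ?thesis by (simp add: m_def)
  qed
qed

lemma sin_theta_norm_le:
  assumes E: "E \<in> stiefel p r" and U: "U \<in> stiefel p r" and r: "0 < r" and q: "1 \<le> q" "q \<le> 2"
  shows "real r powr (- 1 / q) * sin_theta_norm q E U
    \<le> sqrt ((real r - (\<Sum>b<r. \<Sum>a<r. (\<Sum>i<p. entries E (i, b) * entries U (i, a))\<^sup>2)) / real r)"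
proof -
  note E = stiefelD[OF E] and U = stiefelD[OF U]
  define T where "T = transpose_mat E * U"
  have T: "T \<in> carrier_mat r r" using E(3) U(3) by (simp add: T_def)
  have Tij: "T $$ (b, a) = (\<Sum>i<p. entries E (i, b) * entries U (i, a))" if "b < r" "a < r" for b a
    unfolding T_def using E(3) U(3) that by (subst mult_mat_entry[of _ r p _ r]) (auto simp: entries_def)
  note sv = singular_values_properties[OF T]
  have mem: "sing_val i T \<in> set (singular_values T)" if "i \<in> {1..r}" for i
    using that sv(1) by (auto simp: sing_val_def intro!: nth_mem)
  \<comment> \<open>Needed so that the bases of the powers in \<open>sin_theta_norm\<close> are
    nonnegative. A vector z stretched by exactly the singular value has image E^T U z, no longer
    than U z, which is as long as z.\<close>
  have le1: "(sing_val i T)\<^sup>2 \<le> 1" if "i \<in> {1..r}" for i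
  proof -
    from sv(3)[OF mem[OF that]] obtain z where z: "z \<in> carrier_vec r" "0 < scalar_prod z z"
      "scalar_prod (T *\<^sub>v z) (T *\<^sub>v z) = (sing_val i T)\<^sup>2 * (scalar_prod z z)" by auto
    define y where "y i = (\<Sum>a<r. entries U (i, a) * vec_index z a)" for i
    have Tz: "vec_index (T *\<^sub>v z) b = (\<Sum>i<p. entries E (i, b) * y i)" if "b < r" for b
    proof -
      have "vec_index (T *\<^sub>v z) b = (\<Sum>a<r. vec_index z a * T $$ (b, a))"
        using T z(1) that by (auto simp: scalar_prod_def lessThan_atLeast0 mult.commute intro!: sum.cong)
      also have "\<dots> = (\<Sum>a<r. vec_index z a * (\<Sum>i<p. entries E (i, b) * entries U (i, a)))"
        using Tij that by simp
      also have "\<dots> = (\<Sum>i<p. entries E (i, b) * (\<Sum>a<r. vec_index z a * entries U (i, a)))"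
        by (rule sum_comm)
      finally show ?thesis by (simp add: y_def mult.commute)
    qed
    have "scalar_prod (T *\<^sub>v z) (T *\<^sub>v z) = (\<Sum>b<r. (\<Sum>i<p. entries E (i, b) * y i)\<^sup>2)"
      unfolding scalar_prod_def using T by (simp add: Tz power2_eq_square lessThan_atLeast0 del: index_mult_mat_vec)
    also have "\<dots> \<le> (\<Sum>i<p. (y i)\<^sup>2)"
      by (rule contraction_transpose[OF orthonormal_columns_contraction[OF E(4)]])
    also have "\<dots> = (\<Sum>a<r. (vec_index z a)\<^sup>2)"
      unfolding y_def by (rule orthonormal_columns_isometry[OF U(4)])
    also have "\<dots> = scalar_prod z z"
      using z(1) by (simp add: scalar_prod_def power2_eq_square lessThan_atLeast0)
    finally have "(sing_val i T)\<^sup>2 * (scalar_prod z z) \<le> 1 * (scalar_prod z z)" using z(3) by simp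
    then show ?thesis using z(2) by (rule mult_right_le_imp_le)
  qed
  \<comment> \<open>Shift from singular values counted from 1 to list positions counted from
    0.\<close>
  have "(\<Sum>i = 1..r. (sing_val i T)\<^sup>2) = (\<Sum>i<r. (singular_values T ! i)\<^sup>2)"
    unfolding sing_val_def
    by (rule sum.reindex_bij_witness[where i = Suc and j = "\<lambda>i. i - 1"]) auto
  also have "\<dots> = (\<Sum>s\<leftarrow>singular_values T. s\<^sup>2)"
    using sv(1) by (simp add: sum_list_sum_nth lessThan_atLeast0)
  also have "\<dots> = (\<Sum>b<r. \<Sum>a<r. (T $$ (b, a))\<^sup>2)"
    using sv(4) T by (simp add: fro_sq_def)
  also have "\<dots> = (\<Sum>b<r. \<Sum>a<r. (\<Sum>i<p. entries E (i, b) * entries U (i, a))\<^sup>2)"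
    by (intro sum.cong refl) (simp add: Tij)
  finally have s: "(\<Sum>i = 1..r. 1 - (sing_val i T)\<^sup>2)
      = real r - (\<Sum>b<r. \<Sum>a<r. (\<Sum>i<p. entries E (i, b) * entries U (i, a))\<^sup>2)"
    by (simp add: sum_subtractf)
  show ?thesis
    using power_mean_le[OF q r, of "\<lambda>i. 1 - (sing_val i T)\<^sup>2"] le1
    unfolding s sin_theta_norm_def T_def[symmetric] E(2) by simp
qed

section \<open>Risk bounds\<close>

lemma prob_space_noise:
  assumes "\<sigma> > 0"
  shows "prob_space (noise p \<sigma>)"
  unfolding noise_def using assms by (intro prob_space_PiM prob_space_normal_density)

text \<open>The losses enter only through an affine majorant in the evidence, which is measurable;
  monotonicity of the extended integral then transfers its mean bound.\<close>

lemma nn_integral_le_evidence: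
  assumes \<sigma>: "\<sigma> > 0" and nonneg: "0 \<le> \<alpha>" "0 \<le> \<beta>"
    and f: "AE Z in noise p \<sigma>. f Z \<le> \<alpha> + \<beta> * evidence p n \<sigma> t K Z" and R: "\<alpha> + \<beta> \<le> R"
  shows "(\<integral>\<^sup>+Z. ennreal (f Z) \<partial>noise p \<sigma>) \<le> ennreal R"
proof -
  interpret prob_space "noise p \<sigma>" using \<sigma> by (rule prob_space_noise)
  note ev = evidence_properties[OF \<sigma>, of p n t K]
  note [measurable] = ev(1)
  have "(\<integral>\<^sup>+Z. ennreal (f Z) \<partial>noise p \<sigma>) \<le> (\<integral>\<^sup>+Z. ennreal \<alpha> + ennreal \<beta> * ennreal (evidence p n \<sigma> t K Z) \<partial>noise p \<sigma>)"
  proof (rule nn_integral_mono_AE)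
    show "AE Z in noise p \<sigma>. ennreal (f Z) \<le> ennreal \<alpha> + ennreal \<beta> * ennreal (evidence p n \<sigma> t K Z)"
      using f
    proof eventually_elim
      case (elim Z)
      then have "ennreal (f Z) \<le> ennreal (\<alpha> + \<beta> * evidence p n \<sigma> t K Z)" by (rule ennreal_leI)
      then show ?case using nonneg ev(2) by (simp add: ennreal_mult ennreal_plus)
    qed
  qed
  also have "\<dots> = ennreal \<alpha> + ennreal \<beta> * (\<integral>\<^sup>+Z. ennreal (evidence p n \<sigma> t K Z) \<partial>noise p \<sigma>)"
    by (simp add: nn_integral_add nn_integral_cmult emeasure_space_1)
  also have "\<dots> \<le> ennreal \<alpha> + ennreal \<beta> * 1"
    by (intro add_left_mono mult_left_mono ev(3)) auto
  also have "\<dots> = ennreal (\<alpha> + \<beta>)" using nonneg by (simp add: ennreal_plus)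
  also have "\<dots> \<le> ennreal R" using R by (rule ennreal_leI)
  finally show ?thesis .
qed

lemma sqrt_nat_le: "sqrt (real n) \<le> real n"
  by (rule real_le_lsqrt) (auto simp: power2_eq_square simp flip: of_nat_mult)

text \<open>A deterministic inequality, valid for each single \<open>Z\<close>. The coefficients 12
  and 48 are the entropy constant 6 times 2 and 8, the effect of doubling the ranks on p_k r_k and
  on r1 r2 r3.\<close>

lemma estimation_error_le_evidence:
  assumes pos: "\<And>k. k \<in> {1, 2, 3} \<Longrightarrow> 0 < p k \<and> 0 < r k" and \<sigma>: "\<sigma> > 0"
    and e: "\<And>k. k \<in> {1, 2, 3} \<Longrightarrow> orthonormal_columns (p k) (r k) (e k)"
    and X: "\<And>k i c. k \<in> {1, 2, 3} \<Longrightarrow> i < p k \<Longrightarrow> c < dim_col (matricize p k X) \<Longrightarrow>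
      matricize p k X $$ (i, c) = (\<Sum>a<r k. u k (i, a) * g k a c)"
    and opt: "(\<Sum>x\<in>idx p. (X x + Z x - expansion r e S x)\<^sup>2) \<le> (\<Sum>x\<in>idx p. (Z x)\<^sup>2)"
    and K: "12 * real (p 1 * r 1 + p 2 * r 2 + p 3 * r 3) + 48 * real (r 1 * r 2 * r 3) \<le> K" "1 \<le> K"
    and N: "N = p 1 + p 2 + p 3 + 8 * (r 1 * r 2 * r 3) + 1"
  shows "(\<Sum>x\<in>idx p. (expansion r e S x - X x)\<^sup>2)
    \<le> 8 * \<sigma>\<^sup>2 * (81 * K + 4 * evidence p (\<lambda>k. 2 * r k) \<sigma> (sqrt K / \<sigma>) N Z)"
proof -
  let ?n = "\<lambda>k. 2 * r k"
  define W where "W x = expansion r e S x - X x" for x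
  \<comment> \<open>The columns of the true factor followed by those of the estimated one: the 2 r_k
    vectors that span the mode-k fibres of the error.\<close>
  define cols where "cols k l i = (if l < r k then u k (i, l) else e k (i, l - r k))" for k l i
  have "\<forall>k. \<exists>v. orthogonal_columns (p k) (?n k) v \<and> (\<forall>l<?n k. fixed_by (p k) (?n k) v (cols k l))"
    using orthogonal_columns_exist by blast
  then obtain v where v: "\<And>k. orthogonal_columns (p k) (?n k) (v k)"
    and fx: "\<And>k l. l < ?n k \<Longrightarrow> fixed_by (p k) (?n k) (v k) (cols k l)"
    by metis
  note con = orthogonal_columns_contraction[OF v]
  have fu: "fixed_by (p k) (?n k) (v k) (\<lambda>i. u k (i, a))" if "a < r k" for k a
  proof -
    have "cols k a = (\<lambda>i. u k (i, a))" using that by (simp add: cols_def fun_eq_iff)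
    with fx[of a k] that show ?thesis by simp
  qed
  have fe: "fixed_by (p k) (?n k) (v k) (\<lambda>i. e k (i, a))" if "a < r k" for k a
  proof -
    have "cols k (r k + a) = (\<lambda>i. e k (i, a))" by (simp add: cols_def fun_eq_iff)
    with fx[of "r k + a" k] that show ?thesis by simp
  qed
  have W_fixed: "mode_fixed p ?n v W"
  proof (rule mode_fixedI)
    fix m c assume m: "m \<in> {1, 2, 3::nat}" and c: "c < dim_col (matricize p m W)"
    from matricize_expansion[OF m, where p = p and X = W and n = r and v = e and S = S]
    obtain G where G: "\<forall>i<p m. \<forall>c<dim_col (matricize p m W).
        matricize p m (expansion r e S) $$ (i, c) = (\<Sum>a<r m. e m (i, a) * G a c)" by (rule exE)
    have c': "c < dim_col (matricize p m Q)" for Q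
      using c by (simp only: dim_col_matricize[of p m Q W])
    show "fixed_by (p m) (?n m) (v m) (\<lambda>i. matricize p m W $$ (i, c))"
    proof (rule fixed_by_cong)
      show "fixed_by (p m) (?n m) (v m) (\<lambda>i. (\<Sum>a<r m. e m (i, a) * G a c) - (\<Sum>a<r m. u m (i, a) * g m a c))"
        by (intro fixed_by_diff fixed_by_sum fu fe) auto
    next
      fix i assume i: "i < p m"
      show "(\<Sum>a<r m. e m (i, a) * G a c) - (\<Sum>a<r m. u m (i, a) * g m a c) = matricize p m W $$ (i, c)"
        unfolding W_def matricize_diff[OF m i c'] G[rule_format, OF i c] X[OF m i c'] ..
    qed
  qed
  define w where "w = sqrt (\<Sum>x\<in>idx p. (W x)\<^sup>2)"
  define cz where "cz = sqrt (\<Sum>x\<in>idx ?n. (compression p v Z x)\<^sup>2)"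
  have w0: "0 \<le> w" and cz0: "0 \<le> cz" by (auto simp: w_def cz_def sum_nonneg)
  have w2: "(\<Sum>x\<in>idx p. (W x)\<^sup>2) = w\<^sup>2" by (simp add: w_def sum_nonneg)
  have "(\<Sum>x\<in>idx p. (X x + Z x - expansion r e S x)\<^sup>2)
      = (\<Sum>x\<in>idx p. (Z x)\<^sup>2) - 2 * (\<Sum>x\<in>idx p. Z x * W x) + (\<Sum>x\<in>idx p. (W x)\<^sup>2)"
  proof -
    have "X x + Z x - expansion r e S x = Z x - W x" for x by (simp add: W_def)
    then show ?thesis by (simp only: power2_diff sum.distrib sum_subtractf mult.assoc sum_distrib_left)
  qed
  with opt have "w\<^sup>2 \<le> 2 * (\<Sum>x\<in>idx p. Z x * W x)" by (simp add: w2)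
  also have "\<dots> \<le> 2 * (cz * w)"
    using inner_le_compression[OF W_fixed con con con, of Z] by (simp add: w_def cz_def)
  finally have "w * w \<le> (2 * cz) * w" by (simp add: power2_eq_square)
  then have w_le: "w \<le> 2 * cz"
    using w0 cz0 by (cases "w = 0") auto
  \<comment> \<open>Balances the two costs: the variance term 8 t^2 \<sigma>^2 becomes 8 K and the
    entropy is at most K, together 9 K.\<close>
  define t where "t = sqrt K / \<sigma>"
  define \<Xi> where "\<Xi> = evidence p ?n \<sigma> t N Z"
  have t2: "t\<^sup>2 * \<sigma>\<^sup>2 = K" using K(2) \<sigma> by (simp add: t_def power_divide)
  have np: "0 < p 1" "0 < p 2" "0 < p 3" "0 < ?n 1" "0 < ?n 2" "0 < ?n 3" using pos by auto
  have lower: "exp (t * cz - 8 * t\<^sup>2 * \<sigma>\<^sup>2 - 6 * real (p 1 * ?n 1 + p 2 * ?n 2 + p 3 * ?n 3 + ?n 1 * ?n 2 * ?n 3)) \<le> \<Xi>"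
    unfolding cz_def \<Xi>_def
  proof (rule evidence_lower_bound[OF np con con con])
    have *: "sqrt (real m) + 1 \<le> real N" if "m + 1 \<le> N" for m
      using sqrt_nat_le[of m] that by linarith
    show "sqrt (real (p 1)) + 1 \<le> real N" "sqrt (real (p 2)) + 1 \<le> real N" "sqrt (real (p 3)) + 1 \<le> real N"
      "sqrt (real (?n 1 * ?n 2 * ?n 3)) + 1 \<le> real N"
      by (rule *; simp add: N)+
  qed
  have "6 * real (p 1 * ?n 1 + p 2 * ?n 2 + p 3 * ?n 3 + ?n 1 * ?n 2 * ?n 3)
      = 12 * real (p 1 * r 1 + p 2 * r 2 + p 3 * r 3) + 48 * real (r 1 * r 2 * r 3)"
    by simp
  with K(1) have "t * cz - 9 * K \<le> t * cz - 8 * t\<^sup>2 * \<sigma>\<^sup>2 - 6 * real (p 1 * ?n 1 + p 2 * ?n 2 + p 3 * ?n 3 + ?n 1 * ?n 2 * ?n 3)"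
    using t2 by (simp only: mult.assoc)
  with lower have "exp (t * cz - 9 * K) \<le> \<Xi>" by (meson exp_le_cancel_iff order_trans)
  moreover from this have Xi: "0 < \<Xi>" by (meson exp_gt_zero less_le_trans)
  ultimately have "t * cz - 9 * K \<le> ln \<Xi>" by (simp add: ln_ge_iff)
  \<comment> \<open>After squaring, sqrt \<Xi> leaves the first power of \<Xi>, whose mean is at
    most 1; the cruder ln \<Xi> \<le> \<Xi> would leave a second moment.\<close>
  also have "ln \<Xi> = 2 * ln (sqrt \<Xi>)" using Xi by (simp add: ln_sqrt)
  also have "ln (sqrt \<Xi>) \<le> sqrt \<Xi>" using ln_le_minus_one[of "sqrt \<Xi>"] Xi by simp
  finally have tcz: "t * cz \<le> 9 * K + 2 * sqrt \<Xi>" by simp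
  have "cz = \<sigma> * (t * cz) / sqrt K" using \<sigma> K(2) by (simp add: t_def)
  also have "\<dots> \<le> \<sigma> * (9 * K + 2 * sqrt \<Xi>) / sqrt K"
    using tcz \<sigma> K(2) by (intro divide_right_mono mult_left_mono) auto
  finally have w_bound: "w \<le> 2 * (\<sigma> * (9 * K + 2 * sqrt \<Xi>) / sqrt K)" using w_le by linarith
  have quot: "(9 * K + 2 * sqrt \<Xi>)\<^sup>2 / K \<le> 2 * (81 * K + 4 * \<Xi>)"
  proof -
    have "(9 * K + 2 * sqrt \<Xi>)\<^sup>2 \<le> 2 * (9 * K)\<^sup>2 + 2 * (2 * sqrt \<Xi>)\<^sup>2"
      using sum_squares_bound[of "9 * K" "2 * sqrt \<Xi>"] by (simp only: power2_sum)
    also have "\<dots> = 162 * K * K + 8 * \<Xi>" using Xi by (simp add: power_mult_distrib power2_eq_square)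
    also have "\<dots> \<le> 162 * K * K + 8 * \<Xi> * K" using K(2) Xi by simp
    finally show ?thesis using K(2) by (simp add: divide_le_eq algebra_simps)
  qed
  have "w\<^sup>2 \<le> (2 * (\<sigma> * (9 * K + 2 * sqrt \<Xi>) / sqrt K))\<^sup>2" using w_bound w0 by (rule power_mono)
  also have "\<dots> = 4 * \<sigma>\<^sup>2 * ((9 * K + 2 * sqrt \<Xi>)\<^sup>2 / K)"
    using K(2) by (simp add: power_mult_distrib power_divide)
  also have "\<dots> \<le> 4 * \<sigma>\<^sup>2 * (2 * (81 * K + 4 * \<Xi>))"
    by (intro mult_left_mono quot) simp
  also have "\<dots> = 8 * \<sigma>\<^sup>2 * (81 * K + 4 * \<Xi>)" by simp
  finally have "w\<^sup>2 \<le> 8 * \<sigma>\<^sup>2 * (81 * K + 4 * \<Xi>)" .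
  then show ?thesis unfolding w2[symmetric] W_def \<Xi>_def t_def .
qed

text \<open>Origin of the constants: 680 = 8 * 81 + 32 collects both terms of the error bound, using
  K \<ge> 1; 12 + 48 C0^2 expresses the entropy through \<open>K0\<close>, the core being at most
  C0^2 p1 r1; and 1 + 3 C0 covers the factors 3 C0, 1 and C0 of the three risk bounds.\<close>

lemma risk_boundsI:
  fixes C0 :: real
  defines "B \<equiv> 680 * (12 + 48 * C0\<^sup>2)"
  assumes C0: "0 < C0" and \<sigma>: "\<sigma> > 0" and lam: "lam > 0"
    and pos: "\<And>k. k \<in> {1, 2, 3} \<Longrightarrow> 0 < p k \<and> 0 < r k"
    and ratio: "\<And>j k. j \<in> {1, 2, 3} \<Longrightarrow> k \<in> {1, 2, 3} \<Longrightarrow>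
      real (p j) \<le> C0 * real (p k) \<and> real (r j) \<le> C0 * real (r k)"
    and rank: "real (r 2) * real (r 3) \<le> C0\<^sup>2 * real (p 1)"
    and gap: "real (p 1 + p 2 + p 3) / (lam\<^sup>2 / \<sigma>\<^sup>2) \<le> 1"
    and U: "\<And>k. k \<in> {1, 2, 3} \<Longrightarrow> is_left_singular_matrix (matricize p k X) (U k) \<and>
      mat_rank (matricize p k X) = r k \<and> lam \<le> sing_val (r k) (matricize p k X)"
    and E: "\<And>k. k \<in> {1, 2, 3} \<Longrightarrow> subspace_estimator p (p k) (r k) (E k)"
    and XE: "AE Z in noise p \<sigma>.
      (\<Sum>x\<in>idx p. (X x + Z x - XE (observation p X Z) x)\<^sup>2) \<le> (\<Sum>x\<in>idx p. (Z x)\<^sup>2) \<and>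
      (\<exists>S. \<forall>x\<in>idx p. XE (observation p X Z) x = expansion r (\<lambda>k. entries (E k (observation p X Z))) S x)"
  shows "risk_bounds (B * (1 + 3 * C0)) p r \<sigma> lam X U E XE"
proof -
  let ?M = "\<lambda>k. matricize p k X" and ?Y = "observation p X"
  define q where "q k = dim_col (?M k)" for k
  have M: "?M k \<in> carrier_mat (p k) (q k)" if "k \<in> {1, 2, 3}" for k
    using dim_row_matricize[OF that] by (auto simp: q_def)
  have Est: "E k (?Y Z) \<in> stiefel (p k) (r k)" if "k \<in> {1, 2, 3}" for k Z
    using E[OF that] unfolding subspace_estimator_def by (auto simp: observation_def tensors_def)
  define svd where "svd k w \<longleftrightarrow> orthonormal_columns (q k) (r k) w \<and>
      orthonormal_columns (p k) (r k) (entries (U k)) \<and> r k \<le> q k \<and>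
      (\<forall>i<p k. \<forall>c<q k. ?M k $$ (i, c) = (\<Sum>a<r k. entries (U k) (i, a) * (sing_val (a + 1) (?M k) * w (c, a))))" for k w
  have "\<exists>w. svd k w" if k: "k \<in> {1, 2, 3}" for k
  proof -
    have l: "is_left_singular_matrix (?M k) (U k)" and rk: "r k = mat_rank (?M k)"
      using U[OF k] by auto
    show ?thesis by (rule left_singular_matrixD[OF l rk M[OF k]]) (auto simp: svd_def)
  qed
  then have "\<forall>k\<in>{1, 2, 3}. \<exists>w. svd k w" by blast
  then obtain w where svd: "\<forall>k\<in>{1, 2, 3}. svd k (w k)" by (rule bchoice[THEN exE])
  have w: "\<And>k. k \<in> {1, 2, 3} \<Longrightarrow> orthonormal_columns (q k) (r k) (w k)"
    and u: "\<And>k. k \<in> {1, 2, 3} \<Longrightarrow> orthonormal_columns (p k) (r k) (entries (U k))"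
    and rq: "\<And>k. k \<in> {1, 2, 3} \<Longrightarrow> r k \<le> q k"
    and Mw: "\<And>k i c. k \<in> {1, 2, 3} \<Longrightarrow> i < p k \<Longrightarrow> c < q k \<Longrightarrow>
      ?M k $$ (i, c) = (\<Sum>a<r k. entries (U k) (i, a) * (sing_val (a + 1) (?M k) * w k (c, a)))"
    using svd unfolding svd_def by blast+
  have d: "lam \<le> sing_val (a + 1) (?M k)" if "k \<in> {1, 2, 3}" "a < r k" for k a
  proof -
    have "sing_val (r k) (?M k) \<le> sing_val (a + 1) (?M k)"
      using that rq[OF that(1)] by (intro sing_val_antimono[OF M[OF that(1)]]) auto
    with U[OF that(1)] show ?thesis by simp
  qed
  have Ust: "U k \<in> stiefel (p k) (r k)" if "k \<in> {1, 2, 3}" for k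
    using U[OF that] dim_row_matricize[OF that] unfolding is_left_singular_matrix_def by auto
  define K0 where "K0 = real (p 1 * r 1 + p 2 * r 2 + p 3 * r 3)"
  define K where "K = (12 + 48 * C0\<^sup>2) * K0"
  define N where "N = p 1 + p 2 + p 3 + 8 * (r 1 * r 2 * r 3) + 1"
  define \<Xi> where "\<Xi> = evidence p (\<lambda>k. 2 * r k) \<sigma> (sqrt K / \<sigma>) N"
  define G where "G Z = 8 * \<sigma>\<^sup>2 * (81 * K + 4 * \<Xi> Z)" for Z
  define err where "err Z = (\<Sum>x\<in>idx p. (XE (?Y Z) x - X x)\<^sup>2)" for Z
  have K0: "1 \<le> K0"
  proof -
    have "0 < p 1 * r 1" using pos[of 1] by simp
    then show ?thesis unfolding K0_def by linarith
  qed
  have K12: "12 * K0 \<le> K" "1 \<le> K" using K0 by (auto simp: K_def algebra_simps intro: order_trans[of _ "12 * K0"])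
  have KB: "12 * K0 + 48 * real (r 1 * r 2 * r 3) \<le> K"
  proof -
    have "real (r 1 * r 2 * r 3) = real (r 1) * (real (r 2) * real (r 3))" by simp
    also have "\<dots> \<le> real (r 1) * (C0\<^sup>2 * real (p 1))" by (intro mult_left_mono rank) simp
    also have "\<dots> = C0\<^sup>2 * real (p 1 * r 1)" by simp
    also have "\<dots> \<le> C0\<^sup>2 * K0" unfolding K0_def by (intro mult_left_mono of_nat_mono) auto
    finally show ?thesis by (simp add: K_def algebra_simps)
  qed
  have \<Xi>0: "0 \<le> \<Xi> Z" for Z using evidence_properties(2)[OF \<sigma>] by (simp add: \<Xi>_def)
  have G0: "0 \<le> G Z" for Z using \<Xi>0[of Z] K12 by (simp add: G_def)
  have B1: "1 \<le> B" unfolding B_def by (simp add: algebra_simps add_increasing2)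
  define M2 where "M2 = B * \<sigma>\<^sup>2 * K0"
  have M2: "0 < M2" using B1 K0 \<sigma> by (simp add: M2_def)
  have GM: "8 * \<sigma>\<^sup>2 * (81 * K) + 32 * \<sigma>\<^sup>2 \<le> M2"
  proof -
    have "8 * \<sigma>\<^sup>2 * (81 * K) + 32 * \<sigma>\<^sup>2 * 1 \<le> 8 * \<sigma>\<^sup>2 * (81 * K) + 32 * \<sigma>\<^sup>2 * K"
      using K12(2) by (intro add_left_mono mult_left_mono) auto
    also have "\<dots> = M2" by (simp add: M2_def B_def K_def algebra_simps)
    finally show ?thesis by simp
  qed
  \<comment> \<open>Every risk bound is reduced to an affine majorant in \<open>G\<close>, with
    \<open>M2\<close> standing for the mean of \<open>G\<close>.\<close>
  have expect: "(\<integral>\<^sup>+Z. ennreal (f Z) \<partial>noise p \<sigma>) \<le> ennreal R"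
    if f: "AE Z in noise p \<sigma>. f Z \<le> ca + cb * G Z" and c: "0 \<le> ca" "0 \<le> cb" and R: "ca + cb * M2 \<le> R" for f ca cb R
  proof (rule nn_integral_le_evidence[OF \<sigma>])
    show "AE Z in noise p \<sigma>. f Z \<le> (ca + cb * (8 * \<sigma>\<^sup>2 * (81 * K))) + cb * (32 * \<sigma>\<^sup>2) * evidence p (\<lambda>k. 2 * r k) \<sigma> (sqrt K / \<sigma>) N Z"
      using f by eventually_elim (simp add: G_def \<Xi>_def algebra_simps)
    show "0 \<le> ca + cb * (8 * \<sigma>\<^sup>2 * (81 * K))" "0 \<le> cb * (32 * \<sigma>\<^sup>2)" using c K12 by auto
    have "cb * (8 * \<sigma>\<^sup>2 * (81 * K) + 32 * \<sigma>\<^sup>2) \<le> cb * M2" using GM c by (intro mult_left_mono) auto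
    then show "ca + cb * (8 * \<sigma>\<^sup>2 * (81 * K)) + cb * (32 * \<sigma>\<^sup>2) \<le> R" using R by (simp add: distrib_left)
  qed
  have main: "AE Z in noise p \<sigma>. err Z \<le> G Z \<and> (\<forall>k\<in>{1, 2, 3}. lam\<^sup>2 * (real (r k) - (\<Sum>b<r k. \<Sum>a<r k.
      (\<Sum>i<p k. entries (E k (?Y Z)) (i, b) * entries (U k) (i, a))\<^sup>2)) \<le> err Z)"
    using XE
  proof eventually_elim
    case (elim Z)
    then obtain S where opt: "(\<Sum>x\<in>idx p. (X x + Z x - XE (?Y Z) x)\<^sup>2) \<le> (\<Sum>x\<in>idx p. (Z x)\<^sup>2)"
      and S: "\<And>x. x \<in> idx p \<Longrightarrow> XE (?Y Z) x = expansion r (\<lambda>k. entries (E k (?Y Z))) S x" by auto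
    let ?e = "\<lambda>k. entries (E k (?Y Z))"
    have e: "orthonormal_columns (p k) (r k) (?e k)" if "k \<in> {1, 2, 3}" for k
      using stiefelD(4)[OF Est[OF that]] .
    have err: "err Z = (\<Sum>x\<in>idx p. (expansion r ?e S x - X x)\<^sup>2)"
      unfolding err_def by (intro sum.cong refl) (simp add: S)
    have opt': "(\<Sum>x\<in>idx p. (X x + Z x - expansion r ?e S x)\<^sup>2) \<le> (\<Sum>x\<in>idx p. (Z x)\<^sup>2)"
      using opt by (simp add: S)
    have "err Z \<le> G Z"
      unfolding err G_def \<Xi>_def
    proof (rule estimation_error_le_evidence[OF pos \<sigma> e _ opt' _ K12(2) N_def])
      show "?M k $$ (i, c) = (\<Sum>a<r k. entries (U k) (i, a) * (\<lambda>k a c. sing_val (a + 1) (?M k) * w k (c, a)) k a c)"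
        if "k \<in> {1, 2, 3}" "i < p k" "c < dim_col (?M k)" for k i c
        using Mw[OF that(1,2)] that(3) by (simp add: q_def)
      show "12 * real (p 1 * r 1 + p 2 * r 2 + p 3 * r 3) + 48 * real (r 1 * r 2 * r 3) \<le> K"
        using KB by (simp add: K0_def)
    qed auto
    moreover have "lam\<^sup>2 * (real (r k) - (\<Sum>b<r k. \<Sum>a<r k. (\<Sum>i<p k. ?e k (i, b) * entries (U k) (i, a))\<^sup>2)) \<le> err Z"
      if k: "k \<in> {1, 2, 3}" for k
    proof -
      from matricize_expansion[OF k, where p = p and X = X and n = r and v = ?e and S = S]
      obtain H where H: "\<forall>i<p k. \<forall>c<dim_col (?M k).
          matricize p k (expansion r ?e S) $$ (i, c) = (\<Sum>a<r k. ?e k (i, a) * H a c)" by (rule exE)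
      have "lam\<^sup>2 * (real (r k) - (\<Sum>b<r k. \<Sum>a<r k. (\<Sum>i<p k. ?e k (i, b) * entries (U k) (i, a))\<^sup>2))
          \<le> (\<Sum>i<p k. \<Sum>c<q k. (matricize p k (expansion r ?e S) $$ (i, c) - ?M k $$ (i, c))\<^sup>2)"
        by (rule subspace_distance_bound[OF w[OF k] u[OF k] e[OF k] Mw[OF k], where g = H])
          (use H lam d[OF k] in \<open>auto simp: q_def\<close>)
      also have "\<dots> = (\<Sum>i<p k. \<Sum>c<dim_col (matricize p k (\<lambda>x. expansion r ?e S x - X x)).
          (matricize p k (\<lambda>x. expansion r ?e S x - X x) $$ (i, c))\<^sup>2)"
        unfolding q_def dim_col_matricize[of p k X "\<lambda>x. expansion r ?e S x - X x"]
        by (intro sum.cong refl) (simp add: matricize_diff[OF k] dim_col_matricize[of p k "expansion r ?e S" "\<lambda>x. expansion r ?e S x - X x"])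
      also have "\<dots> = err Z" unfolding err by (rule sum_matricize_sq[OF k])
      finally show ?thesis .
    qed
    ultimately show ?case by blast
  qed
  have fro: "(fro_norm p (\<lambda>x. XE (?Y Z) x - X x))\<^sup>2 = err Z" for Z
    by (simp add: fro_norm_def err_def sum_nonneg)
  have C_ge: "B \<le> B * (1 + 3 * C0)" "B * C0 \<le> B * (1 + 3 * C0)" "3 * B * C0 \<le> B * (1 + 3 * C0)"
    using B1 C0 by (auto simp: algebra_simps)
  show ?thesis unfolding risk_bounds_def fro
  proof (intro conjI ballI allI impI)
    fix k and qq :: real
    assume k: "k \<in> {1, 2, 3::nat}" and qq: "1 \<le> qq \<and> qq \<le> 2"
    have rk: "0 < real (r k)" and pk: "0 < real (p k)" using pos[OF k] by auto
    define D where "D = lam * sqrt (real (r k))"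
    have D: "0 < D" using lam rk by (simp add: D_def)
    \<comment> \<open>The sin \<Theta> loss is at most sqrt G / D. The arithmetic-geometric mean
      inequality sqrt G \<le> (m + G / m) / 2 makes this affine in G, and the choice of m gives back
      m / D after averaging.\<close>
    define m where "m = sqrt M2"
    have m: "0 < m" "m\<^sup>2 = M2" using M2 by (auto simp: m_def)
    show "(\<integral>\<^sup>+Z. ennreal (real (r k) powr (- 1 / qq) * sin_theta_norm qq (E k (?Y Z)) (U k)) \<partial>noise p \<sigma>)
        \<le> ennreal (B * (1 + 3 * C0) * sqrt (real (p k)) / (lam / \<sigma>))"
    proof (rule expect)
      show "AE Z in noise p \<sigma>. real (r k) powr (- 1 / qq) * sin_theta_norm qq (E k (?Y Z)) (U k)
          \<le> m / (2 * D) + 1 / (2 * m * D) * G Z"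
        using main
      proof eventually_elim
        case (elim Z)
        define T where "T = (\<Sum>b<r k. \<Sum>a<r k. (\<Sum>i<p k. entries (E k (?Y Z)) (i, b) * entries (U k) (i, a))\<^sup>2)"
        have "lam\<^sup>2 * (real (r k) - T) \<le> err Z" using elim k unfolding T_def by blast
        then have "lam\<^sup>2 * (real (r k) - T) \<le> G Z" using elim by linarith
        then have "lam\<^sup>2 * (real (r k) - T) / D\<^sup>2 \<le> G Z / D\<^sup>2" by (intro divide_right_mono) auto
        moreover have "lam\<^sup>2 * (real (r k) - T) / D\<^sup>2 = (real (r k) - T) / real (r k)"
          using lam rk by (simp add: D_def power_mult_distrib)
        ultimately have "sqrt ((real (r k) - T) / real (r k)) \<le> sqrt (G Z / D\<^sup>2)" by simp
        also have "\<dots> = sqrt (G Z) / D" using D by (simp add: real_sqrt_divide)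
        also have "\<dots> \<le> ((m + G Z / m) / 2) / D"
        proof (rule divide_right_mono)
          have "2 * sqrt (G Z) * m \<le> (sqrt (G Z))\<^sup>2 + m\<^sup>2" by (rule sum_squares_bound)
          then show "sqrt (G Z) \<le> (m + G Z / m) / 2" using m(1) G0[of Z] by (simp add: field_simps power2_eq_square)
        qed (use D in simp)
        also have "\<dots> = m / (2 * D) + 1 / (2 * m * D) * G Z" using m(1) D by (simp add: field_simps)
        finally show ?case
          using sin_theta_norm_le[OF Est[OF k, of Z] Ust[OF k], of qq] qq pos[OF k]
          unfolding T_def by linarith
      qed
      show "0 \<le> m / (2 * D)" "0 \<le> 1 / (2 * m * D)" using m D by auto
      have "m / (2 * D) + 1 / (2 * m * D) * M2 = m / D"
        using m D by (simp add: m(2)[symmetric] power2_eq_square field_simps)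
      also have "\<dots> \<le> (3 * B * C0 * \<sigma> * sqrt (real (p k)) * sqrt (real (r k))) / D"
      proof (rule divide_right_mono)
        have summand: "real (p j * r j) \<le> C0\<^sup>2 * (real (p k) * real (r k))" if "j \<in> {1, 2, 3}" for j
        proof -
          have "real (p j) * real (r j) \<le> (C0 * real (p k)) * (C0 * real (r k))"
            using ratio[OF that k] C0 by (intro mult_mono) auto
          then show ?thesis by (simp add: power2_eq_square mult_ac)
        qed
        have "K0 \<le> 3 * (C0\<^sup>2 * (real (p k) * real (r k)))"
          unfolding K0_def of_nat_add using summand[of 1] summand[of 2] summand[of 3] by simp
        then have "M2 \<le> B * \<sigma>\<^sup>2 * (3 * (C0\<^sup>2 * (real (p k) * real (r k))))"
          unfolding M2_def using B1 by (intro mult_left_mono) auto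
        \<comment> \<open>The factor 3 B, at least 1, is inserted to obtain a perfect
          square.\<close>
        also have "\<dots> \<le> (3 * B * B) * \<sigma>\<^sup>2 * (3 * (C0\<^sup>2 * (real (p k) * real (r k))))"
          using B1 by (intro mult_right_mono) (auto simp: mult_ge1_I)
        also have "\<dots> = (3 * B * C0 * \<sigma> * sqrt (real (p k)) * sqrt (real (r k)))\<^sup>2"
          by (simp add: power_mult_distrib power2_eq_square[of B] mult_ac)
        finally have "M2 \<le> (3 * B * C0 * \<sigma> * sqrt (real (p k)) * sqrt (real (r k)))\<^sup>2" .
        then show "m \<le> 3 * B * C0 * \<sigma> * sqrt (real (p k)) * sqrt (real (r k))"
          unfolding m_def using B1 C0 \<sigma> by (intro real_le_lsqrt) auto
      qed (use D in simp)
      also have "\<dots> = 3 * B * C0 * (sqrt (real (p k)) / (lam / \<sigma>))"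
        using rk by (simp add: D_def)
      also have "\<dots> \<le> B * (1 + 3 * C0) * (sqrt (real (p k)) / (lam / \<sigma>))"
        using C_ge(3) lam \<sigma> by (intro mult_right_mono) auto
      finally show "m / (2 * D) + 1 / (2 * m * D) * M2 \<le> B * (1 + 3 * C0) * sqrt (real (p k)) / (lam / \<sigma>)"
        by simp
    qed
  next
    show "(\<integral>\<^sup>+Z. ennreal (err Z) \<partial>noise p \<sigma>) \<le> ennreal (B * (1 + 3 * C0) * \<sigma>\<^sup>2 * real (p 1 * r 1 + p 2 * r 2 + p 3 * r 3))"
    proof (rule expect[where ca = 0 and cb = 1])
      show "AE Z in noise p \<sigma>. err Z \<le> 0 + 1 * G Z" using main by eventually_elim simp
      have "M2 = B * (\<sigma>\<^sup>2 * K0)" by (simp add: M2_def)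
      also have "\<dots> \<le> B * (1 + 3 * C0) * (\<sigma>\<^sup>2 * K0)"
        using C_ge(1) K0 by (intro mult_right_mono) auto
      finally show "0 + 1 * M2 \<le> B * (1 + 3 * C0) * \<sigma>\<^sup>2 * real (p 1 * r 1 + p 2 * r 2 + p 3 * r 3)"
        by (simp add: K0_def mult.assoc)
    qed auto
  next
    define F where "F = (fro_norm p X)\<^sup>2"
    \<comment> \<open>The squared norm of \<open>X\<close> is the sum of the r1 squared singular
      values in mode 1, each at least lam^2.\<close>
    have F: "real (r 1) * lam\<^sup>2 \<le> F"
    proof -
      have one: "(1::nat) \<in> {1, 2, 3}" by simp
      have "real (r 1) * lam\<^sup>2 = (\<Sum>a<r 1. lam\<^sup>2)" by simp
      also have "\<dots> \<le> (\<Sum>a<r 1. (sing_val (a + 1) (?M 1))\<^sup>2)"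
        using d[OF one] lam by (intro sum_mono power_mono) auto
      also have "\<dots> = (\<Sum>i<p 1. \<Sum>c<q 1. (\<Sum>a<r 1. entries (U 1) (i, a) * (sing_val (a + 1) (?M 1) * w 1 (c, a)))\<^sup>2)"
        by (rule factored_norm[OF w[OF one] u[OF one], symmetric])
      also have "\<dots> = (\<Sum>i<p 1. \<Sum>c<dim_col (?M 1). (?M 1 $$ (i, c))\<^sup>2)"
        unfolding q_def[symmetric] by (intro sum.cong refl) (simp add: Mw[OF one])
      also have "\<dots> = F"
        unfolding sum_matricize_sq[OF one] F_def fro_norm_def by (simp add: sum_nonneg)
      finally show ?thesis .
    qed
    have rl: "0 < real (r 1) * lam\<^sup>2" using pos[of 1] lam by simp
    show "(\<integral>\<^sup>+Z. ennreal (err Z / F) \<partial>noise p \<sigma>)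
        \<le> ennreal (B * (1 + 3 * C0) * min (real (p 1 + p 2 + p 3) / (lam\<^sup>2 / \<sigma>\<^sup>2)) 1)"
    proof (rule expect[where ca = 0 and cb = "1 / (real (r 1) * lam\<^sup>2)"])
      show "AE Z in noise p \<sigma>. err Z / F \<le> 0 + 1 / (real (r 1) * lam\<^sup>2) * G Z"
        using main
      proof eventually_elim
        case (elim Z)
        have "err Z / F \<le> G Z / (real (r 1) * lam\<^sup>2)"
          using elim F rl G0 by (intro frac_le) auto
        then show ?case by simp
      qed
      \<comment> \<open>Comparability of the ranks: the factor r1 cancels against the lower bound
        for \<open>F\<close>.\<close>
      have "K0 \<le> C0 * real (r 1) * real (p 1 + p 2 + p 3)"
      proof -
        have "real (p j * r j) \<le> C0 * real (r 1) * real (p j)" if "j \<in> {1, 2, 3}" for j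
        proof -
          have "real (r j) * real (p j) \<le> (C0 * real (r 1)) * real (p j)"
            using ratio[OF that, of 1] by (intro mult_right_mono) auto
          then show ?thesis by (simp add: mult_ac)
        qed
        from this[of 1] this[of 2] this[of 3] show ?thesis
          unfolding K0_def of_nat_add by (simp add: distrib_left)
      qed
      then have "M2 \<le> B * \<sigma>\<^sup>2 * (C0 * real (r 1) * real (p 1 + p 2 + p 3))"
        unfolding M2_def using B1 by (intro mult_left_mono) auto
      then have "M2 / (real (r 1) * lam\<^sup>2) \<le> (B * \<sigma>\<^sup>2 * (C0 * real (r 1) * real (p 1 + p 2 + p 3))) / (real (r 1) * lam\<^sup>2)"
        using rl by (intro divide_right_mono) auto
      also have "\<dots> = B * C0 * (real (p 1 + p 2 + p 3) / (lam\<^sup>2 / \<sigma>\<^sup>2))"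
        using pos[of 1] lam by (simp add: field_simps)
      also have "\<dots> \<le> B * (1 + 3 * C0) * (real (p 1 + p 2 + p 3) / (lam\<^sup>2 / \<sigma>\<^sup>2))"
        using C_ge(2) by (intro mult_right_mono) auto
      finally show "0 + 1 / (real (r 1) * lam\<^sup>2) * M2 \<le> B * (1 + 3 * C0) * min (real (p 1 + p 2 + p 3) / (lam\<^sup>2 / \<sigma>\<^sup>2)) 1"
        using gap by (simp add: min_absorb1)
    qed (use rl in auto)
  qed
qed

section \<open>Reduction of both classes of estimators to the residual comparison\<close>

lemma left_singular_mode_fixed:
  assumes "\<And>k. k \<in> {1, 2, 3} \<Longrightarrow> is_left_singular_matrix (matricize p k X) (U k) \<and> mat_rank (matricize p k X) = r k"
  shows "mode_fixed p r (\<lambda>k. entries (U k)) X"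
proof (rule mode_fixedI)
  fix k c assume k: "k \<in> {1, 2, 3::nat}" and c: "c < dim_col (matricize p k X)"
  let ?A = "matricize p k X"
  have l: "is_left_singular_matrix ?A (U k)" and rk: "r k = mat_rank ?A" using assms[OF k] by auto
  have A: "?A \<in> carrier_mat (p k) (dim_col ?A)" using dim_row_matricize[OF k] by auto
  obtain w where u: "orthonormal_columns (p k) (r k) (entries (U k))"
    and eq: "\<And>i c. i < p k \<Longrightarrow> c < dim_col ?A \<Longrightarrow>
      ?A $$ (i, c) = (\<Sum>a<r k. entries (U k) (i, a) * (sing_val (a + 1) ?A * w (c, a)))"
    by (rule left_singular_matrixD[OF l rk A]) auto
  show "fixed_by (p k) (r k) (entries (U k)) (\<lambda>i. ?A $$ (i, c))"
    by (rule fixed_by_cong[OF orthonormal_columns_fixed_by[OF u]]) (rule eq[OF _ c, symmetric])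
qed

lemma sq_residual_eq:
  assumes "dim_col (V 1) = r 1" "dim_col (V 2) = r 2" "dim_col (V 3) = r 3"
  shows "sq_residual p Y V S = (\<Sum>x\<in>idx p. (Y x - expansion r (\<lambda>k. entries (V k)) S x)\<^sup>2)"
  unfolding sq_residual_def fro_norm_def tucker_prod_eq_expansion[OF assms] by (simp add: sum_nonneg)

theorem theorem2:
  fixes C0 c0 :: real
  assumes "C0 > 0" and "c0 > 0"
  shows "\<exists>Cgap C :: real. Cgap > 0 \<and> C > 0 \<and>
    (\<forall>(p :: nat \<Rightarrow> nat) (r :: nat \<Rightarrow> nat) (\<sigma> :: real) (X :: tensor) (U :: nat \<Rightarrow> real mat)
       (pmin :: nat) (lam :: real).
      \<sigma> > 0 \<and> X \<in> tensors p \<and>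
      (\<forall>k\<in>{1, 2, 3}. r k \<ge> 1 \<and> mat_rank (matricize p k X) = r k \<and>
                     is_left_singular_matrix (matricize p k X) (U k)) \<and>
      pmin = Min (p ` {1, 2, 3}) \<and>
      lam = Min ((\<lambda>k. sing_val (r k) (matricize p k X)) ` {1, 2, 3}) \<and>
      (\<forall>k\<in>{1, 2, 3}. real (p k) \<le> C0 * real pmin \<and> real (r k) \<le> C0 * sqrt (real pmin)) \<and>
      fro_norm p X \<le> C0 * \<sigma> * exp (c0 * real pmin) \<and>
      real (Max (r ` {1, 2, 3})) \<le> C0 * real (Min (r ` {1, 2, 3})) \<and>
      lam / \<sigma> \<ge> Cgap * sqrt (real pmin)
      \<longrightarrow>
      (\<forall>(E :: nat \<Rightarrow> tensor \<Rightarrow> real mat) (SE :: tensor \<Rightarrow> tensor).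
         (\<forall>k\<in>{1, 2, 3}. subspace_estimator p (p k) (r k) (E k)) \<and>
         (AE Z in noise p \<sigma>.
            let Y = observation p X Z in
            (INF S\<in>tensors r. sq_residual p Y (\<lambda>k. E k Y) S) \<le> (INF S\<in>tensors r. sq_residual p Y U S) \<and>
            is_arg_min (sq_residual p Y (\<lambda>k. E k Y)) (\<lambda>S. S \<in> tensors r) (SE Y))
         \<longrightarrow> risk_bounds C p r \<sigma> lam X U E (\<lambda>Y. tucker_prod (SE Y) (\<lambda>k. E k Y))) \<and>
      (\<forall>E :: nat \<Rightarrow> tensor \<Rightarrow> real mat.
         (\<forall>k\<in>{1, 2, 3}. subspace_estimator p (p k) (r k) (E k)) \<and>
         (AE Z in noise p \<sigma>.
            let Y = observation p X Z in
            is_arg_max (\<lambda>V. (fro_norm r (tucker_prod Y (\<lambda>k. transpose_mat (V k))))\<^sup>2)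
              (\<lambda>V. \<forall>k\<in>{1, 2, 3}. V k \<in> stiefel (p k) (r k)) (\<lambda>k. E k Y))
         \<longrightarrow> risk_bounds C p r \<sigma> lam X U E (\<lambda>Y. tucker_prod Y (\<lambda>k. proj (E k Y)))))"
proof -
  define C where "C = 680 * (12 + 48 * C0\<^sup>2) * (1 + 3 * C0)"
  \<comment> \<open>Since p1 + p2 + p3 is at most 3 C0 pmin, this is the value for which the gap
    condition makes the relative rate at most 1, so the minimum with 1 is the rate itself.\<close>
  define Cgap where "Cgap = sqrt (3 * C0)"
  have C_pos: "0 < C" unfolding C_def using \<open>C0 > 0\<close> by (intro mult_pos_pos add_pos_nonneg) auto
  have "0 < Cgap" using \<open>C0 > 0\<close> by (simp add: Cgap_def)
  show ?thesis
  proof (rule exI[of _ Cgap], rule exI[of _ C], intro conjI[OF \<open>0 < Cgap\<close>] conjI[OF C_pos] allI, rule impI, elim conjE)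
    fix p r \<sigma> X U pmin lam
    assume \<sigma>: "\<sigma> > (0::real)"
      and X_all: "\<forall>k\<in>{1, 2, 3}. r k \<ge> 1 \<and> mat_rank (matricize p k X) = r k \<and> is_left_singular_matrix (matricize p k X) (U k)"
      and pmin: "pmin = Min (p ` {1, 2, 3})"
      and lam: "lam = Min ((\<lambda>k. sing_val (r k) (matricize p k X)) ` {1, 2, 3})"
      and dims_all: "\<forall>k\<in>{1, 2, 3}. real (p k) \<le> C0 * real pmin \<and> real (r k) \<le> C0 * sqrt (real pmin)"
      and ranks: "real (Max (r ` {1, 2, 3})) \<le> C0 * real (Min (r ` {1, 2, 3}))"
      and gap: "lam / \<sigma> \<ge> Cgap * sqrt (real pmin)"
    note X = X_all[rule_format] and dims = dims_all[rule_format]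
    let ?u = "\<lambda>k. entries (U k)"
    have U: "U k \<in> stiefel (p k) (r k)" if "k \<in> {1, 2, 3}" for k
      using X[OF that] dim_row_matricize[OF that] unfolding is_left_singular_matrix_def by auto
    have pos: "0 < p k \<and> 0 < r k" if "k \<in> {1, 2, 3}" for k
    proof -
      have "r k \<ge> 1" using X[OF that] by simp
      \<comment> \<open>A unit column exists because the rank is positive, so the dimension cannot
        be 0.\<close>
      then have "(\<Sum>i<p k. ?u k (i, 0) * ?u k (i, 0)) = 1"
        using stiefelD(4)[OF U[OF that]] by (simp add: orthonormal_columns_def)
      then have "p k \<noteq> 0" by (cases "p k = 0") auto
      with \<open>r k \<ge> 1\<close> show ?thesis by simp
    qed
    have pmin_le: "pmin \<le> p k" if "k \<in> {1, 2, 3}" for k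
      unfolding pmin using that by (intro Min_le) auto
    have "pmin \<in> p ` {1, 2, 3}" unfolding pmin by (intro Min_in) auto
    then have pmin_pos: "0 < pmin" using pos by blast
    have lam_le: "lam \<le> sing_val (r k) (matricize p k X)" if "k \<in> {1, 2, 3}" for k
      unfolding lam using that by (intro Min_le) auto
    have "0 < Cgap * sqrt (real pmin)" using \<open>0 < Cgap\<close> pmin_pos by simp
    with gap have ratio_pos: "0 < lam / \<sigma>" by linarith
    then have lam_pos: "0 < lam" using \<sigma> by (simp add: zero_less_divide_iff)
    have ratio: "real (p j) \<le> C0 * real (p k) \<and> real (r j) \<le> C0 * real (r k)"
      if j: "j \<in> {1, 2, 3}" and k: "k \<in> {1, 2, 3}" for j k
    proof
      have "real (p j) \<le> C0 * real pmin" using dims[OF j] by simp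
      also have "\<dots> \<le> C0 * real (p k)" using pmin_le[OF k] \<open>C0 > 0\<close> by simp
      finally show "real (p j) \<le> C0 * real (p k)" .
      have "r j \<le> Max (r ` {1, 2, 3})" using j by (intro Max_ge) auto
      moreover have "Min (r ` {1, 2, 3}) \<le> r k" using k by (intro Min_le) auto
      then have "C0 * real (Min (r ` {1, 2, 3})) \<le> C0 * real (r k)" using \<open>C0 > 0\<close> by (intro mult_left_mono) auto
      ultimately show "real (r j) \<le> C0 * real (r k)" using ranks by linarith
    qed
    \<comment> \<open>Makes the core size r1 r2 r3 at most C0^2 p1 r1, so the core costs no more
      than a multiple of a factor matrix.\<close>
    have rank: "real (r 2) * real (r 3) \<le> C0\<^sup>2 * real (p 1)"
    proof -
      have "real (r 2) * real (r 3) \<le> (C0 * sqrt (real pmin)) * (C0 * sqrt (real pmin))"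
        using dims[of 2] dims[of 3] \<open>C0 > 0\<close> by (intro mult_mono) auto
      also have "\<dots> = C0\<^sup>2 * (sqrt (real pmin) * sqrt (real pmin))"
        by (simp only: power2_eq_square mult_ac)
      also have "\<dots> = C0\<^sup>2 * real pmin" by simp
      also have "\<dots> \<le> C0\<^sup>2 * real (p 1)" using pmin_le[of 1] by (intro mult_left_mono) auto
      finally show ?thesis .
    qed
    have gap': "real (p 1 + p 2 + p 3) / (lam\<^sup>2 / \<sigma>\<^sup>2) \<le> 1"
    proof -
      have "real (p 1 + p 2 + p 3) \<le> 3 * C0 * real pmin"
        using dims[of 1] dims[of 2] dims[of 3] by simp
      also have "\<dots> = (Cgap * sqrt (real pmin))\<^sup>2"
        using \<open>C0 > 0\<close> by (simp add: Cgap_def power_mult_distrib)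
      also have "\<dots> \<le> (lam / \<sigma>)\<^sup>2" using gap \<open>0 < Cgap\<close> by (intro power_mono) auto
      also have "\<dots> = lam\<^sup>2 / \<sigma>\<^sup>2" by (rule power_divide)
      finally have "real (p 1 + p 2 + p 3) \<le> lam\<^sup>2 / \<sigma>\<^sup>2" .
      moreover have "0 < lam\<^sup>2 / \<sigma>\<^sup>2" using lam_pos \<sigma> by simp
      ultimately show ?thesis by (simp only: divide_le_eq_1_pos)
    qed
    have bounds: "risk_bounds C p r \<sigma> lam X U E XE"
      if "\<And>k. k \<in> {1, 2, 3} \<Longrightarrow> subspace_estimator p (p k) (r k) (E k)"
        and "AE Z in noise p \<sigma>.
          (\<Sum>x\<in>idx p. (X x + Z x - XE (observation p X Z) x)\<^sup>2) \<le> (\<Sum>x\<in>idx p. (Z x)\<^sup>2) \<and>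
          (\<exists>S. \<forall>x\<in>idx p. XE (observation p X Z) x = expansion r (\<lambda>k. entries (E k (observation p X Z))) S x)"
      for E XE
      unfolding C_def
      by (rule risk_boundsI[OF \<open>C0 > 0\<close> \<sigma> lam_pos pos ratio rank gap' _ that]) (use X lam_le in auto)
    have Est: "E k (observation p X Z) \<in> stiefel (p k) (r k)"
      if "\<forall>k\<in>{1, 2, 3}. subspace_estimator p (p k) (r k) (E k)" "k \<in> {1, 2, 3}" for E k Z
      using that unfolding subspace_estimator_def by (auto simp: observation_def tensors_def)
    have obs: "observation p X Z x = X x + Z x" if "x \<in> idx p" for x Z
      using that by (simp add: observation_def)
    \<comment> \<open>The core of \<open>X\<close> in the basis \<open>U\<close>. As a competitor it
      reproduces \<open>X\<close> and so leaves exactly the noise as residual.\<close>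
    define S0 where "S0 = restrict (compression p ?u X) (idx r)"
    have S0: "S0 \<in> tensors r" by (simp add: S0_def tensors_def)
    have "mode_fixed p r ?u X" by (rule left_singular_mode_fixed) (use X in auto)
    then have XS0: "expansion r ?u S0 x = X x" if "x \<in> idx p" for x
      unfolding S0_def expansion_restrict using that by (rule expansion_compression)
    have noise_residual: "(\<Sum>x\<in>idx p. (observation p X Z x - expansion r ?u S0 x)\<^sup>2) = (\<Sum>x\<in>idx p. (Z x)\<^sup>2)" for Z
      by (intro sum.cong refl) (simp add: XS0 obs)
    note k123 = insertI1[of 1 "{2, 3::nat}"] insertI2[OF insertI1[of 2 "{3::nat}"], of 1]
      insertI2[OF insertI2[OF insertI1[of 3 "{}::nat set"], of 2], of 1]
    have dimU: "dim_col (U 1) = r 1" "dim_col (U 2) = r 2" "dim_col (U 3) = r 3"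
      using stiefelD(2)[OF U[OF k123(1)]] stiefelD(2)[OF U[OF k123(2)]] stiefelD(2)[OF U[OF k123(3)]] by auto
    show "(\<forall>E SE. (\<forall>k\<in>{1, 2, 3}. subspace_estimator p (p k) (r k) (E k)) \<and>
       (AE Z in noise p \<sigma>.
          let Y = observation p X Z in
          (INF S\<in>tensors r. sq_residual p Y (\<lambda>k. E k Y) S) \<le> (INF S\<in>tensors r. sq_residual p Y U S) \<and>
          is_arg_min (sq_residual p Y (\<lambda>k. E k Y)) (\<lambda>S. S \<in> tensors r) (SE Y))
       \<longrightarrow> risk_bounds C p r \<sigma> lam X U E (\<lambda>Y. tucker_prod (SE Y) (\<lambda>k. E k Y))) \<and>
     (\<forall>E. (\<forall>k\<in>{1, 2, 3}. subspace_estimator p (p k) (r k) (E k)) \<and>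
       (AE Z in noise p \<sigma>.
          let Y = observation p X Z in
          is_arg_max (\<lambda>V. (fro_norm r (tucker_prod Y (\<lambda>k. transpose_mat (V k))))\<^sup>2)
            (\<lambda>V. \<forall>k\<in>{1, 2, 3}. V k \<in> stiefel (p k) (r k)) (\<lambda>k. E k Y))
       \<longrightarrow> risk_bounds C p r \<sigma> lam X U E (\<lambda>Y. tucker_prod Y (\<lambda>k. proj (E k Y))))"
    proof (intro conjI allI impI)
      fix E :: "nat \<Rightarrow> tensor \<Rightarrow> real mat" and SE :: "tensor \<Rightarrow> tensor"
      assume "(\<forall>k\<in>{1, 2, 3}. subspace_estimator p (p k) (r k) (E k)) \<and>
       (AE Z in noise p \<sigma>.
          let Y = observation p X Z in
          (INF S\<in>tensors r. sq_residual p Y (\<lambda>k. E k Y) S) \<le> (INF S\<in>tensors r. sq_residual p Y U S) \<and>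
          is_arg_min (sq_residual p Y (\<lambda>k. E k Y)) (\<lambda>S. S \<in> tensors r) (SE Y))"
      then have E: "\<forall>k\<in>{1, 2, 3}. subspace_estimator p (p k) (r k) (E k)"
        and min: "AE Z in noise p \<sigma>.
          let Y = observation p X Z in
          (INF S\<in>tensors r. sq_residual p Y (\<lambda>k. E k Y) S) \<le> (INF S\<in>tensors r. sq_residual p Y U S) \<and>
          is_arg_min (sq_residual p Y (\<lambda>k. E k Y)) (\<lambda>S. S \<in> tensors r) (SE Y)" by blast+
      show "risk_bounds C p r \<sigma> lam X U E (\<lambda>Y. tucker_prod (SE Y) (\<lambda>k. E k Y))"
      proof (rule bounds)
        show "AE Z in noise p \<sigma>.
          (\<Sum>x\<in>idx p. (X x + Z x - tucker_prod (SE (observation p X Z)) (\<lambda>k. E k (observation p X Z)) x)\<^sup>2)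
            \<le> (\<Sum>x\<in>idx p. (Z x)\<^sup>2) \<and>
          (\<exists>S. \<forall>x\<in>idx p. tucker_prod (SE (observation p X Z)) (\<lambda>k. E k (observation p X Z)) x
            = expansion r (\<lambda>k. entries (E k (observation p X Z))) S x)"
          using min
        proof eventually_elim
          case (elim Z)
          define Y where "Y = observation p X Z"
          have dimE: "dim_col (E 1 Y) = r 1" "dim_col (E 2 Y) = r 2" "dim_col (E 3 Y) = r 3"
            unfolding Y_def using stiefelD(2)[OF Est[OF E k123(1)]] stiefelD(2)[OF Est[OF E k123(2)]]
              stiefelD(2)[OF Est[OF E k123(3)]] by auto
          from elim have inf: "(INF S\<in>tensors r. sq_residual p Y (\<lambda>k. E k Y) S) \<le> (INF S\<in>tensors r. sq_residual p Y U S)"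
            and arg: "is_arg_min (sq_residual p Y (\<lambda>k. E k Y)) (\<lambda>S. S \<in> tensors r) (SE Y)"
            by (simp_all add: Let_def Y_def)
          have "(\<Sum>x\<in>idx p. (X x + Z x - tucker_prod (SE Y) (\<lambda>k. E k Y) x)\<^sup>2) = sq_residual p Y (\<lambda>k. E k Y) (SE Y)"
            unfolding sq_residual_def fro_norm_def by (simp add: Y_def obs sum_nonneg)
          also have "\<dots> \<le> (INF S\<in>tensors r. sq_residual p Y (\<lambda>k. E k Y) S)"
            using arg S0 by (intro cINF_greatest) (auto simp: is_arg_min_def not_less)
          also note inf
          \<comment> \<open>The real infimum is a genuine lower bound because residuals are bounded
            below by 0.\<close>
          also have "(INF S\<in>tensors r. sq_residual p Y U S) \<le> sq_residual p Y U S0"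
            by (rule cINF_lower[OF _ S0]) (auto simp: sq_residual_def intro!: bdd_belowI2[where m = 0])
          also have "\<dots> = (\<Sum>x\<in>idx p. (Z x)\<^sup>2)"
            unfolding sq_residual_eq[OF dimU] Y_def by (rule noise_residual)
          finally show ?case
            using tucker_prod_eq_expansion[of "\<lambda>k. E k Y", OF dimE] unfolding Y_def by auto
        qed
      qed (use E in auto)
    next
      fix E :: "nat \<Rightarrow> tensor \<Rightarrow> real mat"
      assume "(\<forall>k\<in>{1, 2, 3}. subspace_estimator p (p k) (r k) (E k)) \<and>
       (AE Z in noise p \<sigma>.
          let Y = observation p X Z in
          is_arg_max (\<lambda>V. (fro_norm r (tucker_prod Y (\<lambda>k. transpose_mat (V k))))\<^sup>2)
            (\<lambda>V. \<forall>k\<in>{1, 2, 3}. V k \<in> stiefel (p k) (r k)) (\<lambda>k. E k Y))"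
      then have E: "\<forall>k\<in>{1, 2, 3}. subspace_estimator p (p k) (r k) (E k)"
        and max: "AE Z in noise p \<sigma>.
          let Y = observation p X Z in
          is_arg_max (\<lambda>V. (fro_norm r (tucker_prod Y (\<lambda>k. transpose_mat (V k))))\<^sup>2)
            (\<lambda>V. \<forall>k\<in>{1, 2, 3}. V k \<in> stiefel (p k) (r k)) (\<lambda>k. E k Y)" by blast+
      show "risk_bounds C p r \<sigma> lam X U E (\<lambda>Y. tucker_prod Y (\<lambda>k. proj (E k Y)))"
      proof (rule bounds)
        show "AE Z in noise p \<sigma>.
          (\<Sum>x\<in>idx p. (X x + Z x - tucker_prod (observation p X Z) (\<lambda>k. proj (E k (observation p X Z))) x)\<^sup>2)
            \<le> (\<Sum>x\<in>idx p. (Z x)\<^sup>2) \<and>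
          (\<exists>S. \<forall>x\<in>idx p. tucker_prod (observation p X Z) (\<lambda>k. proj (E k (observation p X Z))) x
            = expansion r (\<lambda>k. entries (E k (observation p X Z))) S x)"
          using max
        proof eventually_elim
          case (elim Z)
          define Y where "Y = observation p X Z"
          let ?e = "\<lambda>k. entries (E k Y)"
          define obj where "obj V = (fro_norm r (tucker_prod Y (\<lambda>k. transpose_mat (V k))))\<^sup>2" for V
          have obj: "obj V = (\<Sum>x\<in>idx r. (compression p (\<lambda>k. entries (V k)) Y x)\<^sup>2)"
            if V: "\<forall>k\<in>{1, 2, 3}. V k \<in> stiefel (p k) (r k)" for V
          proof -
            have "tucker_prod Y (\<lambda>k. transpose_mat (V k)) x = compression p (\<lambda>k. entries (V k)) Y x" if "x \<in> idx r" for x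
              by (rule tucker_prod_transpose[OF V[rule_format, OF k123(1), THEN stiefelD(3)]
                    V[rule_format, OF k123(2), THEN stiefelD(3)] V[rule_format, OF k123(3), THEN stiefelD(3)] that])
            then show ?thesis by (simp add: obj_def fro_norm_def sum_nonneg)
          qed
          have EY: "\<forall>k\<in>{1, 2, 3}. E k Y \<in> stiefel (p k) (r k)"
            unfolding Y_def using Est[OF E] by blast
          note EYk = EY[rule_format, OF k123(1)] EY[rule_format, OF k123(2)] EY[rule_format, OF k123(3)]
          have UY: "\<forall>k\<in>{1, 2, 3}. U k \<in> stiefel (p k) (r k)" using U by blast
          from elim have "is_arg_max obj (\<lambda>V. \<forall>k\<in>{1, 2, 3}. V k \<in> stiefel (p k) (r k)) (\<lambda>k. E k Y)"
            unfolding Let_def Y_def[symmetric] obj_def[abs_def] .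
          with UY have le: "obj U \<le> obj (\<lambda>k. E k Y)" unfolding is_arg_max_def by (auto simp: not_less)
          have orthE: "orthonormal_columns (p 1) (r 1) (?e 1)" "orthonormal_columns (p 2) (r 2) (?e 2)"
            "orthonormal_columns (p 3) (r 3) (?e 3)"
            by (rule EYk[THEN stiefelD(4)])+
          have orthU: "orthonormal_columns (p 1) (r 1) (?u 1)" "orthonormal_columns (p 2) (r 2) (?u 2)"
            "orthonormal_columns (p 3) (r 3) (?u 3)"
            by (rule U[OF k123(1), THEN stiefelD(4)] U[OF k123(2), THEN stiefelD(4)] U[OF k123(3), THEN stiefelD(4)])+
          have P: "tucker_prod Y (\<lambda>k. proj (E k Y)) x = expansion r ?e (compression p ?e Y) x" if "x \<in> idx p" for x
            by (rule tucker_prod_proj[OF EYk(1,2,3)[THEN stiefelD(3)] that])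
          have "(\<Sum>x\<in>idx p. (X x + Z x - tucker_prod Y (\<lambda>k. proj (E k Y)) x)\<^sup>2)
              = (\<Sum>x\<in>idx p. (Y x - expansion r ?e (compression p ?e Y) x)\<^sup>2)"
            by (intro sum.cong refl) (simp add: P obs[of _ Z, folded Y_def])
          also have "\<dots> = (\<Sum>x\<in>idx p. (Y x)\<^sup>2) - obj (\<lambda>k. E k Y)"
            unfolding residual_eq[where v = ?e, OF orthE] obj[OF EY] by simp
          \<comment> \<open>Pythagoras is used twice: for \<open>E\<close> the core is the
            compression and the last term vanishes, while for \<open>U\<close> the nonnegative term
            of the core \<open>S0\<close> is added to arrive at the residual of
            \<open>X\<close>.\<close>
          also have "\<dots> \<le> (\<Sum>x\<in>idx p. (Y x)\<^sup>2) - obj U + (\<Sum>x\<in>idx r. (S0 x - compression p ?u Y x)\<^sup>2)"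
            using le sum_nonneg[of "idx r" "\<lambda>x. (S0 x - compression p ?u Y x)\<^sup>2"] by simp
          also have "\<dots> = (\<Sum>x\<in>idx p. (Y x - expansion r ?u S0 x)\<^sup>2)"
            unfolding residual_eq[where v = ?u, OF orthU] obj[OF UY] ..
          also have "\<dots> = (\<Sum>x\<in>idx p. (Z x)\<^sup>2)" unfolding Y_def by (rule noise_residual)
          finally have le_noise: "(\<Sum>x\<in>idx p. (X x + Z x - tucker_prod Y (\<lambda>k. proj (E k Y)) x)\<^sup>2) \<le> (\<Sum>x\<in>idx p. (Z x)\<^sup>2)" .
          have "\<exists>S. \<forall>x\<in>idx p. tucker_prod Y (\<lambda>k. proj (E k Y)) x = expansion r ?e S x" using P by blast
          with le_noise show ?case unfolding Y_def by (rule conjI)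
        qed
      qed (use E in auto)
    qed
  qed
qed

end
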